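(* Let $G$ be a finite simple graph with edges labelled $e_1,\ldots,e_n$, let $I_G\subseteq\mathbb{K}[E(G)]=\mathbb{K}[e_1,\ldots,e_n]$ be its toric ideal, and let $<_G$ be the lexicographic order with $e_1>e_2>\cdots>e_n$. Suppose that $\mathrm{in}_{<_G}(I_G)$ is a square-free monomial ideal. If $\mathbb{K}[E(G)]/I^G_{E,F}$ is equidimensional for every choice of $E,F,\ell$ such that $E\cap F=\emptyset$, $E\cup F=E_\ell=\{e_1,\ldots,e_\ell\}$ and $0\leq\ell\leq n$ (with $E_0=\emptyset$), then $I_G$ is geometrically vertex decomposable.
   Context: $\mathbb{K}$ is an algebraically closed field of characteristic zero. A ring $R/I$ is equidimensional if $\dim(R/I)=\dim(R/P)$ for all minimal primes $P$ of $\mathrm{Ass}_R(R/I)$. Toric ideal of a graph. For a finite simple graph $G$ with vertices $V(G)=\{x_1,\ldots,x_m\}$ and edges $E(G)=\{e_1,\ldots,e_n\}$, the toric ideal $I_G\subseteq\mathbb{K}[E(G)]=\mathbb{K}[e_1,\ldots,e_n]$ is the kernel of the $\mathbb{K}$-algebra homomorphism $\varphi_G:\mathbb{K}[E(G)]\to\mathbb{K}[x_1,\ldots,x_m]$, $\varphi_G(e_i)=x_jx_k$ where $e_i=\{x_j,x_k\}$. Each closed even walk $(e_{i_1},\ldots,e_{i_{2s}})$ of $G$ corresponds to the binomial $e_{i_1}e_{i_3}\cdots e_{i_{2s-1}}-e_{i_2}e_{i_4}\cdots e_{i_{2s}}\in I_G$. A binomial $u-v\in I_G$ ($u,v$ monomials)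 is primitive if there is no other binomial $u'-v'\in I_G$ with $u'\mid u$ and $v'\mid v$. $\mathcal{U}(I_G)$ denotes the set of all primitive binomials corresponding to closed even walks of $G$; it is a universal Gröbner basis of $I_G$. The ideals $I^G_{E,F}$. For disjoint $E,F$ with $E\cup F=E_k=\{e_1,\ldots,e_k\}$, put $I^G_{E,F}=I_{G\setminus(E\cup F)}+M^G_{E,F}\subseteq\mathbb{K}[e_1,\ldots,e_n]$. Here $G\setminus(E\cup F)$ is $G$ with the edges in $E\cup F$ removed (its toric ideal being extended to $\mathbb{K}[E(G)]$), and $M^G_{E,F}$ is the ideal generated by those monomials $m$ for which there is $m\ell-p\in\mathcal{U}(I_G)$ such that (1) $\mathrm{in}_{<_G}(m\ell-p)=m\ell$; (2) $\ell$ is a monomial only involving some non-empty subset of variables in $E$; (3) no $f\in F$ divides $m\ell$ and no $e\in E$ divides $m$. If there is no such $m$, $M^G_{E,F}=\langle0\rangle$; $m=1$ is allowed, giving $M^G_{E,F}=\langle1\rangle$. Geometric vertex decomposability. Let $R=\mathbb{K}[x_1,\ldots,x_n]$ be a polynomial ring and fix a variable $y=x_i$. Write $0\neq f\in R$ as $f=\sum_j\alpha_jy^j$ with $\alpha_j$ not involving $y$; if $d$ is the largest index with $\alpha_d\neq0$, put $\mathrm{in}_y(f)=\alpha_dy^d$. For an ideal $I$, $\mathrm{in}_y(I)=\langle \mathrm{in}_y(f)\mid f\in I\rangle$. A monomial order $<$ is $y$-compatible if $\mathrm{in}_<(f)=\mathrm{in}_<(\mathrm{in}_y(f))$ for all $f$.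 Given a $y$-compatible order $<$ and a Gröbner basis $\{g_1,\ldots,g_m\}$ of $I$ with respect to $<$, write $g_j=y^{d_j}q_j+r_j$ with $\mathrm{in}_y(g_j)=y^{d_j}q_j$ and $y$ dividing no term of $q_j$, and set $C_{y,I}=\langle q_1,\ldots,q_m\rangle$ and $N_{y,I}=\langle q_j\mid d_j=0\rangle$. An ideal $I$ is unmixed if $\dim(R/I)=\dim(R/P)$ for all $P\in\mathrm{Ass}_R(R/I)$. The ideal $I$ is geometrically vertex decomposable if $I$ is unmixed and either (1) $I=\langle1\rangle$ or $I$ is generated by a (possibly empty) subset of the variables of $R$; or (2) there are a variable $y=x_i$ and a $y$-compatible monomial order $<$ such that $\mathrm{in}_y(I)=C_{y,I}\cap(N_{y,I}+\langle y\rangle)$ and the contractions of $C_{y,I}$ and $N_{y,I}$ to $\mathbb{K}[x_1,\ldots,\hat{x}_i,\ldots,x_n]$ are geometrically vertex decomposable. By convention the ideals $\langle0\rangle$ and $\langle1\rangle$ of the ring $\mathbb{K}$ are geometrically vertex decomposable. *)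

theory Defs
  imports
    "HOL-Algebra.QuotRing"
    "HOL-Library.Poly_Mapping"
    "HOL-Library.Extended_Nat"
    "HOL-Computational_Algebra.Polynomial"
begin

section \<open>Polynomial rings\<close>

text \<open>
  A monomial is identified with its exponent vector, so that multiplication of monomials is
  addition of exponent vectors.  The ring \<open>mpoly_ring X\<close> is \<open>\<bbbK>[x | x \<in> X]\<close>, for a set \<open>X\<close> of
  variable names.
\<close>

abbreviation keys :: "('a \<Rightarrow>\<^sub>0 'b::zero) \<Rightarrow> 'a set" where
  "keys \<equiv> Poly_Mapping.keys"

abbreviation lookup :: "('a \<Rightarrow>\<^sub>0 'b::zero) \<Rightarrow> 'a \<Rightarrow> 'b" where
  "lookup \<equiv> Poly_Mapping.lookup"

type_synonym 'x mon = "'x \<Rightarrow>\<^sub>0 nat"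
type_synonym ('x, 'k) mpoly = "'x mon \<Rightarrow>\<^sub>0 'k"

definition mons :: "'x set \<Rightarrow> 'x mon set" where
  "mons X = {m. keys m \<subseteq> X}"

definition mpoly_ring :: "'x set \<Rightarrow> ('x, 'k::field) mpoly ring" where
  "mpoly_ring X =
    \<lparr>carrier = {f. keys f \<subseteq> mons X}, monoid.mult = (*), one = 1, ring.zero = 0, add = (+)\<rparr>"

definition mon_poly :: "'x mon \<Rightarrow> ('x, 'k::field) mpoly" where
  "mon_poly m = Poly_Mapping.single m 1"

definition mvar :: "'x \<Rightarrow> ('x, 'k::field) mpoly" where
  "mvar x = mon_poly (Poly_Mapping.single x 1)"

definition mon_dvd :: "'x mon \<Rightarrow> 'x mon \<Rightarrow> bool" where
  "mon_dvd u v \<longleftrightarrow> (\<exists>w. v = u + w)"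

section \<open>Dimension, associated primes\<close>

text \<open>
  Krull dimension.  The zero ring gets dimension \<open>0\<close> here (the supremum of the empty set in
  \<^typ>\<open>enat\<close>); this plays no role below, because an improper ideal has no associated primes.
\<close>

definition krull_dim :: "('a, 'b) ring_scheme \<Rightarrow> enat" where
  "krull_dim R = Sup {enat d | d. \<exists>P :: nat \<Rightarrow> 'a set.
     (\<forall>i\<le>d. primeideal (P i) R) \<and> (\<forall>i<d. P i \<subset> P (Suc i))}"

text \<open>The set on the right of the inner equation is the annihilator of the class of \<open>f\<close> in \<open>R/I\<close>.\<close>

definition assoc_primes :: "('a, 'b) ring_scheme \<Rightarrow> 'a set \<Rightarrow> 'a set set" where
  "assoc_primes R I =
    {P. primeideal P R \<and> (\<exists>f\<in>carrier R. P = {a \<in> carrier R. a \<otimes>\<^bsub>R\<^esub> f \<in> I})}"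

definition minimal_primes :: "('a, 'b) ring_scheme \<Rightarrow> 'a set \<Rightarrow> 'a set set" where
  "minimal_primes R I = {P \<in> assoc_primes R I. \<not> (\<exists>Q \<in> assoc_primes R I. Q \<subset> P)}"

definition unmixed :: "('a, 'b) ring_scheme \<Rightarrow> 'a set \<Rightarrow> bool" where
  "unmixed R I \<longleftrightarrow> (\<forall>P \<in> assoc_primes R I. krull_dim (R Quot I) = krull_dim (R Quot P))"

definition equidimensional :: "('a, 'b) ring_scheme \<Rightarrow> 'a set \<Rightarrow> bool" where
  "equidimensional R I \<longleftrightarrow>
    (\<forall>P \<in> minimal_primes R I. krull_dim (R Quot I) = krull_dim (R Quot P))"

section \<open>Monomial orders and Groebner bases\<close>

text \<open>A pair \<open>(a, b) \<in> r\<close> means \<open>a \<le> b\<close>.\<close>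

definition monomial_order :: "'x set \<Rightarrow> 'x mon rel \<Rightarrow> bool" where
  "monomial_order X r \<longleftrightarrow>
    well_order_on (mons X) r \<and> (\<forall>(a, b) \<in> r. \<forall>c \<in> mons X. (a + c, b + c) \<in> r)"

text \<open>
  The order on exponent vectors provided by \<^theory>\<open>HOL-Library.Poly_Mapping\<close> compares the
  exponents at the smallest index where they differ; it is thus the lexicographic order in which
  the variable with the smallest index is the largest one.
\<close>

definition lex_order :: "nat \<Rightarrow> nat mon rel" where
  "lex_order n = {(a, b). a \<in> mons {1..n} \<and> b \<in> mons {1..n} \<and> a \<le> b}"

definition lead_mon :: "'x mon rel \<Rightarrow> ('x, 'k::field) mpoly \<Rightarrow> 'x mon" where
  "lead_mon r f = (THE m. m \<in> keys f \<and> (\<forall>m' \<in> keys f. (m', m) \<in> r))"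

text \<open>For \<open>f = 0\<close> this is \<open>0\<close>, whatever \<open>lead_mon r 0\<close> is.\<close>

definition init_term :: "'x mon rel \<Rightarrow> ('x, 'k::field) mpoly \<Rightarrow> ('x, 'k) mpoly" where
  "init_term r f = Poly_Mapping.single (lead_mon r f) (lookup f (lead_mon r f))"

definition init_ideal :: "'x set \<Rightarrow> 'x mon rel \<Rightarrow> ('x, 'k::field) mpoly set \<Rightarrow> ('x, 'k) mpoly set"
  where "init_ideal X r I = Idl\<^bsub>mpoly_ring X\<^esub> (init_term r ` I)"

definition groebner_basis ::
    "'x set \<Rightarrow> 'x mon rel \<Rightarrow> ('x, 'k::field) mpoly set \<Rightarrow> ('x, 'k) mpoly set \<Rightarrow> bool" where
  "groebner_basis X r I B \<longleftrightarrow>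
    finite B \<and> B \<subseteq> I - {0} \<and> init_ideal X r I = Idl\<^bsub>mpoly_ring X\<^esub> (init_term r ` B)"

definition squarefree_monomial_ideal :: "'x set \<Rightarrow> ('x, 'k::field) mpoly set \<Rightarrow> bool" where
  "squarefree_monomial_ideal X I \<longleftrightarrow>
    (\<exists>S \<subseteq> {m \<in> mons X. \<forall>x. lookup m x \<le> 1}. I = Idl\<^bsub>mpoly_ring X\<^esub> (mon_poly ` S))"

section \<open>Geometric vertex decomposability\<close>

text \<open>
  For \<open>f = \<Sum>j. \<alpha>\<^sub>j y ^ j\<close> with \<open>\<alpha>\<^sub>j\<close> not involving \<open>y\<close>, \<open>deg_in y f\<close> is the largest \<open>d\<close> with
  \<open>\<alpha>\<^sub>d \<noteq> 0\<close>, \<open>top_coeff y f\<close> is \<open>\<alpha>\<^sub>d\<close> and \<open>init_y y f\<close> is \<open>\<alpha>\<^sub>d y ^ d\<close>.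
\<close>

definition deg_in :: "'x \<Rightarrow> ('x, 'k::field) mpoly \<Rightarrow> nat" where
  "deg_in y f = Max (insert 0 ((\<lambda>m. lookup m y) ` keys f))"

definition top_coeff :: "'x \<Rightarrow> ('x, 'k::field) mpoly \<Rightarrow> ('x, 'k) mpoly" where
  "top_coeff y f = (\<Sum>m \<in> {m \<in> keys f. lookup m y = deg_in y f}.
     Poly_Mapping.single (m - Poly_Mapping.single y (deg_in y f)) (lookup f m))"

definition init_y :: "'x \<Rightarrow> ('x, 'k::field) mpoly \<Rightarrow> ('x, 'k) mpoly" where
  "init_y y f = top_coeff y f * mvar y ^ deg_in y f"

definition init_y_ideal :: "'x set \<Rightarrow> 'x \<Rightarrow> ('x, 'k::field) mpoly set \<Rightarrow> ('x, 'k) mpoly set" where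
  "init_y_ideal X y I = Idl\<^bsub>mpoly_ring X\<^esub> (init_y y ` (I - {0}))"

definition y_compatible :: "'k::field itself \<Rightarrow> 'x set \<Rightarrow> 'x \<Rightarrow> 'x mon rel \<Rightarrow> bool" where
  "y_compatible _ X y r \<longleftrightarrow>
    (\<forall>f \<in> carrier (mpoly_ring X) :: ('x, 'k) mpoly set. init_term r f = init_term r (init_y y f))"

text \<open>The ideals \<open>C\<close> and \<open>N\<close> associated with \<open>y\<close>, read off from a Groebner basis \<open>B\<close>.\<close>

definition C_ideal :: "'x set \<Rightarrow> 'x \<Rightarrow> ('x, 'k::field) mpoly set \<Rightarrow> ('x, 'k) mpoly set" where
  "C_ideal X y B = Idl\<^bsub>mpoly_ring X\<^esub> (top_coeff y ` B)"

definition N_ideal :: "'x set \<Rightarrow> 'x \<Rightarrow> ('x, 'k::field) mpoly set \<Rightarrow> ('x, 'k) mpoly set" where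
  "N_ideal X y B = Idl\<^bsub>mpoly_ring X\<^esub> (top_coeff y ` {g \<in> B. deg_in y g = 0})"

inductive gvd :: "'x set \<Rightarrow> ('x, 'k::field) mpoly set \<Rightarrow> bool" where
  const: "gvd {} {0}"
| const_unit: "gvd {} (carrier (mpoly_ring {}))"
| unit: "\<lbrakk>I = carrier (mpoly_ring X); unmixed (mpoly_ring X) I\<rbrakk> \<Longrightarrow> gvd X I"
| vars: "\<lbrakk>Y \<subseteq> X; I = Idl\<^bsub>mpoly_ring X\<^esub> (mvar ` Y); unmixed (mpoly_ring X) I\<rbrakk> \<Longrightarrow> gvd X I"
| decomp:
    "\<lbrakk>ideal I (mpoly_ring X); unmixed (mpoly_ring X) I;
      y \<in> X; monomial_order X r; y_compatible TYPE('k) X y r; groebner_basis X r I B;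
      init_y_ideal X y I = C_ideal X y B \<inter> (N_ideal X y B <+>\<^bsub>mpoly_ring X\<^esub> Idl\<^bsub>mpoly_ring X\<^esub> {mvar y});
      gvd (X - {y}) (C_ideal X y B \<inter> carrier (mpoly_ring (X - {y})));
      gvd (X - {y}) (N_ideal X y B \<inter> carrier (mpoly_ring (X - {y})))\<rbrakk>
     \<Longrightarrow> gvd X (I :: ('x, 'k) mpoly set)"

section \<open>Toric ideals of graphs\<close>

text \<open>
  The edge \<open>e\<^sub>i\<close>, \<open>1 \<le> i \<le> n\<close>, is the set \<open>e i\<close> of its two end points, and \<open>i\<close> is also the name of the
  corresponding variable.
\<close>

definition simple_graph :: "'v set \<Rightarrow> (nat \<Rightarrow> 'v set) \<Rightarrow> nat \<Rightarrow> bool" where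
  "simple_graph V e n \<longleftrightarrow>
    finite V \<and> (\<forall>i\<in>{1..n}. e i \<subseteq> V \<and> card (e i) = 2) \<and> inj_on e {1..n}"

text \<open>The \<open>\<bbbK>\<close>-algebra homomorphism \<open>\<phi>\<close> with \<open>\<phi>(e\<^sub>i) = x\<^sub>j x\<^sub>k\<close> for \<open>e\<^sub>i = {x\<^sub>j, x\<^sub>k}\<close>.\<close>

definition edge_hom :: "(nat \<Rightarrow> 'v set) \<Rightarrow> (nat, 'k::field) mpoly \<Rightarrow> ('v, 'k) mpoly" where
  "edge_hom e f = (\<Sum>m \<in> keys f.
     Poly_Mapping.single 0 (lookup f m) * (\<Prod>i \<in> keys m. (\<Prod>x \<in> e i. mvar x) ^ lookup m i))"

text \<open>The toric ideal, in \<open>\<bbbK>[e\<^sub>i | i \<in> A]\<close>, of the subgraph with edges \<open>e\<^sub>i\<close>, \<open>i \<in> A\<close>.\<close>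

definition toric_ideal ::
    "'v set \<Rightarrow> (nat \<Rightarrow> 'v set) \<Rightarrow> nat set \<Rightarrow> (nat, 'k::field) mpoly set" where
  "toric_ideal V e A = a_kernel (mpoly_ring A) (mpoly_ring V) (edge_hom e)"

definition closed_even_walk :: "(nat \<Rightarrow> 'v set) \<Rightarrow> nat \<Rightarrow> nat list \<Rightarrow> bool" where
  "closed_even_walk e n w \<longleftrightarrow>
    w \<noteq> [] \<and> even (length w) \<and> set w \<subseteq> {1..n} \<and>
    (\<exists>v :: nat \<Rightarrow> 'v. v 0 = v (length w) \<and> (\<forall>j < length w. e (w ! j) = {v j, v (Suc j)}))"

text \<open>List positions start at \<open>0\<close>: the edges \<open>e\<^bsub>i\<^sub>1\<^esub>, e\<^bsub>i\<^sub>3\<^esub>, \<dots>\<close> are at the even positions.\<close>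

definition walk_mon_pos :: "nat list \<Rightarrow> nat mon" where
  "walk_mon_pos w = (\<Sum>j \<in> {j. j < length w \<and> even j}. Poly_Mapping.single (w ! j) 1)"

definition walk_mon_neg :: "nat list \<Rightarrow> nat mon" where
  "walk_mon_neg w = (\<Sum>j \<in> {j. j < length w \<and> odd j}. Poly_Mapping.single (w ! j) 1)"

definition binom :: "'x mon \<Rightarrow> 'x mon \<Rightarrow> ('x, 'k::field) mpoly" where
  "binom u v = mon_poly u - mon_poly v"

text \<open>Binomials are non-zero, hence the conditions \<open>u \<noteq> v\<close> and \<open>u' \<noteq> v'\<close>.\<close>

definition primitive_binom :: "('x, 'k::field) mpoly set \<Rightarrow> 'x mon \<Rightarrow> 'x mon \<Rightarrow> bool" where
  "primitive_binom I u v \<longleftrightarrow>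
    u \<noteq> v \<and> binom u v \<in> I \<and>
    \<not> (\<exists>u' v'. u' \<noteq> v' \<and> (u', v') \<noteq> (u, v) \<and> binom u' v' \<in> I \<and> mon_dvd u' u \<and> mon_dvd v' v)"

definition universal_gb :: "'v set \<Rightarrow> (nat \<Rightarrow> 'v set) \<Rightarrow> nat \<Rightarrow> (nat, 'k::field) mpoly set" where
  "universal_gb V e n = {binom (walk_mon_pos w) (walk_mon_neg w) | w. closed_even_walk e n w \<and>
     primitive_binom (toric_ideal V e {1..n} :: (nat, 'k) mpoly set)
       (walk_mon_pos w) (walk_mon_neg w)}"

definition M_ideal ::
    "'v set \<Rightarrow> (nat \<Rightarrow> 'v set) \<Rightarrow> nat \<Rightarrow> nat set \<Rightarrow> nat set \<Rightarrow> (nat, 'k::field) mpoly set" where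
  "M_ideal V e n E F = Idl\<^bsub>mpoly_ring {1..n}\<^esub> {mon_poly m | m. \<exists>l p.
     (binom (m + l) p :: (nat, 'k) mpoly) \<in> universal_gb V e n \<and>
     init_term (lex_order n) (binom (m + l) p :: (nat, 'k) mpoly) = mon_poly (m + l) \<and>
     keys l \<noteq> {} \<and> keys l \<subseteq> E \<and>
     keys (m + l) \<inter> F = {} \<and> keys m \<inter> E = {}}"

definition I_ideal ::
    "'v set \<Rightarrow> (nat \<Rightarrow> 'v set) \<Rightarrow> nat \<Rightarrow> nat set \<Rightarrow> nat set \<Rightarrow> (nat, 'k::field) mpoly set" where
  "I_ideal V e n E F =
    Idl\<^bsub>mpoly_ring {1..n}\<^esub> (toric_ideal V e ({1..n} - (E \<union> F)))
      <+>\<^bsub>mpoly_ring {1..n}\<^esub> M_ideal V e n E F"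

end

theory Submission
  imports Defs
begin

text \<open>
  The edges are removed one at a time, in the lexicographic order.  Let \<open>J\<close> be an ideal in variables
  \<open>X\<close> whose largest variable is \<open>y\<close>.  The leading coefficients in \<open>y\<close> of the elements of \<open>J\<close> form the
  ideal \<open>all_lead_coeffs y J\<close>, and those of degree \<open>0\<close> form the contraction \<open>lead_coeffs y 0 J\<close>.  For every
  lexicographic Groebner basis these two ideals generate \<open>C\<close> and \<open>N\<close> (\<open>C_ideal_eq\<close>, \<open>N_ideal_eq\<close>).  If the
  initial ideal of \<open>J\<close> is square-free, then \<open>y\<close> occurs at most once in each of its generating monomials.
  Hence all leading coefficients occur in degree one, which is what the decomposition of
  \<open>init_y_ideal\<close> says (\<open>init_y_ideal_eq\<close>); and the initial ideals of the two new ideals are again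
  square-free.  Starting from the toric ideal, one obtains the ideals \<open>edge_ideal IG E k\<close>, where \<open>E\<close> records
  the edges at which the leading coefficients were taken.  After \<open>n\<close> steps no variable is left.  So the
  toric ideal is geometrically vertex decomposable once all ideals on the way are unmixed.

  This is where equidimensionality enters.  Primitive binomials form a Groebner basis of a toric ideal
  (\<open>exists_primitive_divisor\<close>) and come from closed even walks (\<open>primitive_in_universal_gb\<close>).  If one
  follows them through the successive leading coefficients, those that survive become binomials in the
  remaining edges or monomials that define \<open>M_ideal\<close>.  Hence \<open>I_ideal\<close> is the extension of
  \<open>edge_ideal IG E k\<close> to all variables (\<open>I_ideal_eq_extension\<close>).  Its equidimensionality yields the
  unmixedness of \<open>edge_ideal IG E k\<close> (\<open>unmixed_contraction\<close>): an ideal with square-free initial ideal is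
  radical (\<open>squarefree_lms_radical\<close>), so that its associated primes are minimal, and the extension by
  \<open>k\<close> variables adds \<open>k\<close> to the dimension of each quotient.

  The last claim rests on a description of the Krull dimension for which it is evident: the dimension
  of the quotient by \<open>J\<close> is the largest number of variables that are algebraically independent modulo \<open>J\<close>
  (\<open>krull_dim_eq_var_dim\<close>).  Independent sets grow when one descends in a chain of primes
  (\<open>independent_grows\<close>), which bounds the dimension from above.  Conversely, for a maximal independent set
  \<open>Y\<close> of a prime and \<open>y \<in> Y\<close>, there is a larger prime of which \<open>Y - {y}\<close> is independent
  (\<open>exists_larger_prime\<close>); this is a form of Zariski's lemma.  Both facts use that, up to powers of one
  denominator \<open>g\<close>, multiplication by polynomials preserves a finitely generated module over the
  polynomials in \<open>Y\<close> (\<open>stable_span\<close>).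
\<close>

section \<open>Monomials and polynomial rings\<close>

definition polys :: "'x set \<Rightarrow> ('x, 'k::field) mpoly set" where
  "polys X = {f. keys f \<subseteq> mons X}"

lemma mpoly_ring_simps [simp]:
  "carrier (mpoly_ring X) = polys X" "monoid.mult (mpoly_ring X) = (*)" "one (mpoly_ring X) = 1"
  "ring.zero (mpoly_ring X) = 0" "add (mpoly_ring X) = (+)"
  by (simp_all add: mpoly_ring_def polys_def)

lemma keys_add_mon: "keys (a + b) = keys a \<union> keys (b :: 'x mon)"
  by (auto simp: in_keys_iff lookup_add)

lemma zero_in_mons [simp]: "0 \<in> mons X"
  by (simp add: mons_def)

lemma add_in_mons_iff [simp]: "a + b \<in> mons X \<longleftrightarrow> a \<in> mons X \<and> b \<in> mons X"
  by (auto simp: mons_def keys_add_mon)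

lemma single_in_mons: "x \<in> X \<Longrightarrow> Poly_Mapping.single x k \<in> mons X"
  by (simp add: mons_def)

lemma mons_mono: "X \<subseteq> Y \<Longrightarrow> m \<in> mons X \<Longrightarrow> m \<in> mons Y"
  by (auto simp: mons_def)

lemma mons_lookup: "m \<in> mons X \<longleftrightarrow> (\<forall>x. x \<notin> X \<longrightarrow> lookup m x = 0)"
  by (auto simp: mons_def in_keys_iff)

lemma mons_empty [simp]: "mons {} = {0}"
  by (auto simp: mons_def)

lemma add_eq_zero_mon [simp]: "a + b = 0 \<longleftrightarrow> a = 0 \<and> b = (0 :: 'x mon)"
  by (metis Un_empty keys_add_mon keys_eq_empty)

lemma diff_in_mons: "a \<in> mons X \<Longrightarrow> a - b \<in> mons X"
  by (auto simp: mons_lookup lookup_minus)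

lemma mon_dvd_iff: "mon_dvd u v \<longleftrightarrow> (\<forall>x. lookup u x \<le> lookup v x)"
proof
  assume "\<forall>x. lookup u x \<le> lookup v x"
  then have "v = u + (v - u)"
    by (intro poly_mapping_eqI) (auto simp: lookup_add lookup_minus)
  then show "mon_dvd u v" unfolding mon_dvd_def by blast
qed (auto simp: mon_dvd_def lookup_add)

lemma mon_dvd_add_diff: "mon_dvd u v \<Longrightarrow> u + (v - u) = v"
  by (intro poly_mapping_eqI) (auto simp: mon_dvd_iff lookup_add lookup_minus)

lemma mon_dvd_refl [simp]: "mon_dvd u u"
  by (simp add: mon_dvd_iff)

lemma mon_dvd_trans: "mon_dvd u v \<Longrightarrow> mon_dvd v w \<Longrightarrow> mon_dvd u w"
  by (meson mon_dvd_iff le_trans)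

lemma mon_dvd_addI [simp]: "mon_dvd u (u + w)" "mon_dvd u (w + u)"
  by (auto simp: mon_dvd_iff lookup_add)

lemma mon_dvd_in_mons: "mon_dvd u v \<Longrightarrow> v \<in> mons X \<Longrightarrow> u \<in> mons X"
  by (auto simp: mon_dvd_def)

lemma in_polysD: "f \<in> polys X \<Longrightarrow> m \<in> keys f \<Longrightarrow> m \<in> mons X"
  by (auto simp: polys_def)

lemma in_polysI: "(\<And>m. m \<in> keys f \<Longrightarrow> m \<in> mons X) \<Longrightarrow> f \<in> polys X"
  by (auto simp: polys_def)

lemma zero_in_polys [simp]: "0 \<in> polys X" by (simp add: polys_def)
lemma one_in_polys [simp]: "1 \<in> polys X" by (simp add: polys_def)

lemma single_in_polys: "m \<in> mons X \<Longrightarrow> Poly_Mapping.single m c \<in> polys X"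
  by (auto simp: polys_def)

lemma const_in_polys [simp]: "Poly_Mapping.single 0 c \<in> polys X"
  by (simp add: single_in_polys)

lemma mon_poly_in_polys [simp]: "mon_poly m \<in> polys X \<longleftrightarrow> m \<in> mons X"
  by (auto simp: polys_def mon_poly_def)

lemma mvar_in_polys [simp]: "mvar x \<in> polys X \<longleftrightarrow> x \<in> X"
  by (auto simp: mvar_def mons_def)

lemma add_in_polys: "f \<in> polys X \<Longrightarrow> g \<in> polys X \<Longrightarrow> f + g \<in> polys X"
  using keys_add[of f g] by (auto simp: polys_def)

lemma uminus_in_polys [simp]: "- f \<in> polys X \<longleftrightarrow> f \<in> polys X"
  by (auto simp: polys_def in_keys_iff)

lemma diff_in_polys: "f \<in> polys X \<Longrightarrow> g \<in> polys X \<Longrightarrow> f - g \<in> polys X"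
  using add_in_polys[of f X "- g"] by simp

lemma mult_in_polys: "f \<in> polys X \<Longrightarrow> g \<in> polys X \<Longrightarrow> f * g \<in> polys X"
  using keys_mult[of f g] by (force simp: polys_def)

lemma sum_in_polys: "(\<And>i. i \<in> A \<Longrightarrow> f i \<in> polys X) \<Longrightarrow> sum f A \<in> polys X"
  by (induction A rule: infinite_finite_induct) (auto simp: add_in_polys)

lemma prod_in_polys: "(\<And>i. i \<in> A \<Longrightarrow> f i \<in> polys X) \<Longrightarrow> prod f A \<in> polys X"
  by (induction A rule: infinite_finite_induct) (auto simp: mult_in_polys)

lemma power_in_polys: "f \<in> polys X \<Longrightarrow> f ^ k \<in> polys X"
  by (induction k) (auto simp: mult_in_polys)

lemmas polys_closed = add_in_polys diff_in_polys mult_in_polys sum_in_polys power_in_polys prod_in_polys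

lemma polys_mono: "X \<subseteq> Y \<Longrightarrow> f \<in> polys X \<Longrightarrow> f \<in> polys Y"
  by (auto simp: polys_def dest: mons_mono)

lemma poly_sum_monomials: "f = (\<Sum>m\<in>keys f. Poly_Mapping.single m (lookup f m))"
proof (rule poly_mapping_eqI)
  fix k
  have "lookup (\<Sum>m\<in>keys f. Poly_Mapping.single m (lookup f m)) k
      = (\<Sum>m\<in>keys f. if m = k then lookup f m else 0)"
    by (simp add: lookup_sum lookup_single when_def)
  also have "\<dots> = lookup f k"
    by (simp add: in_keys_iff)
  finally show "lookup f k = lookup (\<Sum>m\<in>keys f. Poly_Mapping.single m (lookup f m)) k" ..
qed

lemma polys_induct [consumes 1, case_names zero single add]:
  assumes "f \<in> polys X"
    and "P 0"
    and "\<And>m c. m \<in> mons X \<Longrightarrow> P (Poly_Mapping.single m c)"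
    and "\<And>f g. f \<in> polys X \<Longrightarrow> g \<in> polys X \<Longrightarrow> P f \<Longrightarrow> P g \<Longrightarrow> P (f + g)"
  shows "P f"
proof -
  have "finite A \<Longrightarrow> A \<subseteq> keys f \<Longrightarrow> P (\<Sum>m\<in>A. Poly_Mapping.single m (lookup f m))" for A
  proof (induction A rule: finite_induct)
    case (insert x F)
    have "m \<in> mons X" if "m \<in> insert x F" for m
      using insert.prems assms(1) that by (auto simp: polys_def)
    then show ?case using insert assms(3,4)
      by (simp add: single_in_polys sum_in_polys)
  qed (simp add: assms(2))
  from this[of "keys f"] show ?thesis using poly_sum_monomials[of f] by simp
qed

lemma lookup_single_mult:
  fixes f :: "('x, 'k::field) mpoly"
  shows "lookup (Poly_Mapping.single w c * f) m
    = (if mon_dvd w m then c * lookup f (m - w) else 0)"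
proof -
  have "lookup (Poly_Mapping.single w c * f) m
      = (\<Sum>v\<in>keys f. lookup (Poly_Mapping.single w c * Poly_Mapping.single v (lookup f v)) m)"
    by (subst poly_sum_monomials[of f]) (simp add: sum_distrib_left lookup_sum)
  also have "\<dots> = (\<Sum>v\<in>keys f. if w + v = m then c * lookup f v else 0)"
    by (simp add: mult_single lookup_single when_def)
  also have "\<dots> = (if mon_dvd w m then c * lookup f (m - w) else 0)"
  proof (cases "mon_dvd w m")
    case True
    then have "w + v = m \<longleftrightarrow> v = m - w" for v
      by (metis mon_dvd_add_diff add_diff_cancel_left')
    then show ?thesis using True by (simp add: in_keys_iff)
  next
    case False
    then have "w + v \<noteq> m" for v by (auto simp: mon_dvd_def)
    then show ?thesis using False by simp
  qed
  finally show ?thesis .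
qed

lemma lookup_single_mult_add [simp]:
  fixes f :: "('x, 'k::field) mpoly"
  shows "lookup (Poly_Mapping.single w c * f) (w + m) = c * lookup f m"
  by (simp add: lookup_single_mult)

lemma keys_single_mult:
  fixes f :: "('x, 'k::field) mpoly"
  assumes "c \<noteq> 0"
  shows "keys (Poly_Mapping.single w c * f) = (+) w ` keys f"
proof (intro Set.set_eqI iffI)
  fix m assume "m \<in> keys (Poly_Mapping.single w c * f)"
  then have "mon_dvd w m" "lookup f (m - w) \<noteq> 0"
    by (auto simp: in_keys_iff lookup_single_mult split: if_splits)
  then show "m \<in> (+) w ` keys f"
    by (metis image_eqI in_keys_iff mon_dvd_add_diff)
next
  fix m assume "m \<in> (+) w ` keys f"
  then show "m \<in> keys (Poly_Mapping.single w c * f)"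
    using assms by (auto simp: in_keys_iff)
qed

lemma mvar_power: "mvar y ^ d = (mon_poly (Poly_Mapping.single y d) :: ('x, 'k::field) mpoly)"
  by (induction d) (simp_all add: mvar_def mon_poly_def mult_single single_add[symmetric])

section \<open>Ideals of polynomial rings\<close>

lemma cring_mpoly_ring: "cring (mpoly_ring X :: ('x, 'k::field) mpoly ring)"
proof (rule cringI)
  show "abelian_group (mpoly_ring X :: ('x, 'k) mpoly ring)"
  proof (rule abelian_groupI)
    fix f :: "('x, 'k) mpoly"
    assume "f \<in> carrier (mpoly_ring X)"
    then show "\<exists>y\<in>carrier (mpoly_ring X). y \<oplus>\<^bsub>mpoly_ring X\<^esub> f = \<zero>\<^bsub>mpoly_ring X\<^esub>"
      by (intro bexI[of _ "- f"]) auto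
  qed (auto simp: add_in_polys ac_simps)
  show "Group.comm_monoid (mpoly_ring X :: ('x, 'k) mpoly ring)"
    by (rule comm_monoidI) (auto simp: mult_in_polys ac_simps)
qed (auto simp: algebra_simps)

lemma ring_mpoly_ring: "ring (mpoly_ring X :: ('x, 'k::field) mpoly ring)"
  using cring_mpoly_ring by (rule cring.axioms)

text \<open>
  Negation is multiplication by \<open>- 1\<close>; ideals of the ring record are thus given by three closure
  conditions on sets of polynomials.
\<close>

lemma ideal_mpoly_ring_iff:
  fixes I :: "('x, 'k::field) mpoly set"
  shows "ideal I (mpoly_ring X) \<longleftrightarrow> I \<subseteq> polys X \<and> 0 \<in> I \<and> (\<forall>a\<in>I. \<forall>b\<in>I. a + b \<in> I) \<and>
    (\<forall>a\<in>I. \<forall>r\<in>polys X. r * a \<in> I)"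
proof (intro iffI conjI)
  assume "ideal I (mpoly_ring X)"
  then interpret ideal I "mpoly_ring X" .
  show "I \<subseteq> polys X" using a_subset by simp
  show "0 \<in> I" using additive_subgroup.zero_closed[OF additive_subgroup_axioms] by simp
  show "\<forall>a\<in>I. \<forall>b\<in>I. a + b \<in> I" using additive_subgroup.a_closed[OF additive_subgroup_axioms] by simp
  show "\<forall>a\<in>I. \<forall>r\<in>polys X. r * a \<in> I" using I_l_closed by simp
next
  assume I: "I \<subseteq> polys X \<and> 0 \<in> I \<and> (\<forall>a\<in>I. \<forall>b\<in>I. a + b \<in> I) \<and> (\<forall>a\<in>I. \<forall>r\<in>polys X. r * a \<in> I)"
  interpret cring "mpoly_ring X :: ('x, 'k) mpoly ring" by (rule cring_mpoly_ring)
  have inv: "\<ominus>\<^bsub>mpoly_ring X\<^esub> a = - a" if "a \<in> polys X" for a :: "('x, 'k) mpoly"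
    using that by (intro minus_equality) auto
  have neg: "- a \<in> I" if "a \<in> I" for a
  proof -
    have "(- 1) * a \<in> I" using I that by (metis one_in_polys uminus_in_polys)
    then show ?thesis by simp
  qed
  show "ideal I (mpoly_ring X)"
  proof (rule idealI)
    show "subgroup I (add_monoid (mpoly_ring X))"
    proof
      fix x assume "x \<in> I"
      then show "inv\<^bsub>add_monoid (mpoly_ring X)\<^esub> x \<in> I"
        using inv[of x] neg[of x] I by (auto simp: a_inv_def subset_iff)
    qed (use I in auto)
  qed (use I in \<open>auto simp: mult.commute ring_axioms\<close>)
qed

context
  fixes I :: "('x, 'k::field) mpoly set" and X :: "'x set"
  assumes I: "ideal I (mpoly_ring X)"
begin

lemma ideal_polysD: "a \<in> I \<Longrightarrow> a \<in> polys X"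
  and ideal_zero: "0 \<in> I"
  and ideal_add: "a \<in> I \<Longrightarrow> b \<in> I \<Longrightarrow> a + b \<in> I"
  and ideal_mult_left: "a \<in> I \<Longrightarrow> r \<in> polys X \<Longrightarrow> r * a \<in> I"
  using I by (auto simp: ideal_mpoly_ring_iff)

lemma ideal_mult_right: "a \<in> I \<Longrightarrow> r \<in> polys X \<Longrightarrow> a * r \<in> I"
  using ideal_mult_left[of a r] by (simp add: mult.commute)

lemma ideal_uminus: "a \<in> I \<Longrightarrow> - a \<in> I"
  using ideal_mult_left[of a "- 1"] by simp

lemma ideal_diff: "a \<in> I \<Longrightarrow> b \<in> I \<Longrightarrow> a - b \<in> I"
  using ideal_add[of a "- b"] ideal_uminus[of b] by simp

lemma ideal_sum: "(\<And>i. i \<in> A \<Longrightarrow> f i \<in> I) \<Longrightarrow> sum f A \<in> I"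
  by (induction A rule: infinite_finite_induct) (auto simp: ideal_zero ideal_add)

lemma ideal_eq_carrier_iff: "I = polys X \<longleftrightarrow> 1 \<in> I"
  using ideal_mult_left[of 1] ideal_polysD by fastforce

lemma ideal_one_const:
  assumes "Poly_Mapping.single 0 c \<in> I" "c \<noteq> 0"
  shows "1 \<in> I"
proof -
  have "Poly_Mapping.single 0 (inverse c) * Poly_Mapping.single 0 c \<in> I"
    using assms by (intro ideal_mult_left) auto
  then show ?thesis using assms by (simp add: mult_single)
qed

end

text \<open>
  By additivity, closure under multiplication has to be checked for terms only.
\<close>

lemma ideal_mpoly_ringI:
  fixes I :: "('x, 'k::field) mpoly set"
  assumes "I \<subseteq> polys X" "0 \<in> I" "\<And>a b. a \<in> I \<Longrightarrow> b \<in> I \<Longrightarrow> a + b \<in> I"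
    "\<And>a m c. a \<in> I \<Longrightarrow> m \<in> mons X \<Longrightarrow> Poly_Mapping.single m c * a \<in> I"
  shows "ideal I (mpoly_ring X)"
  unfolding ideal_mpoly_ring_iff
proof (intro conjI ballI)
  fix a r :: "('x, 'k) mpoly" assume "a \<in> I" "r \<in> polys X"
  from this(2) show "r * a \<in> I"
    by (induction r rule: polys_induct) (use assms \<open>a \<in> I\<close> in \<open>auto simp: distrib_right\<close>)
qed (use assms in auto)

lemma primeideal_mpoly_ring_iff:
  fixes P :: "('x, 'k::field) mpoly set"
  shows "primeideal P (mpoly_ring X) \<longleftrightarrow> ideal P (mpoly_ring X) \<and> 1 \<notin> P \<and>
    (\<forall>a\<in>polys X. \<forall>b\<in>polys X. a * b \<in> P \<longrightarrow> a \<in> P \<or> b \<in> P)"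
proof
  assume P: "primeideal P (mpoly_ring X)"
  then have i: "ideal P (mpoly_ring X)" by (rule primeideal.axioms)
  show "ideal P (mpoly_ring X) \<and> 1 \<notin> P \<and>
    (\<forall>a\<in>polys X. \<forall>b\<in>polys X. a * b \<in> P \<longrightarrow> a \<in> P \<or> b \<in> P)"
    using i primeideal.I_notcarr[OF P] primeideal.I_prime[OF P] ideal_eq_carrier_iff[OF i] by auto
next
  assume P: "ideal P (mpoly_ring X) \<and> 1 \<notin> P \<and>
    (\<forall>a\<in>polys X. \<forall>b\<in>polys X. a * b \<in> P \<longrightarrow> a \<in> P \<or> b \<in> P)"
  then show "primeideal P (mpoly_ring X)"
    by (intro primeidealI cring_mpoly_ring) auto
qed

lemma prime_ideal_ideal: "primeideal P (mpoly_ring X) \<Longrightarrow> ideal P (mpoly_ring X)"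
  by (rule primeideal.axioms)

lemma prime_ideal_power:
  fixes P :: "('x, 'k::field) mpoly set"
  assumes "primeideal P (mpoly_ring X)" "a \<in> polys X" "a ^ k \<in> P"
  shows "a \<in> P"
  using assms(3)
proof (induction k)
  case (Suc k)
  then show ?case using assms(1,2) power_in_polys[OF assms(2)]
    by (auto simp: primeideal_mpoly_ring_iff)
qed (use assms in \<open>auto simp: primeideal_mpoly_ring_iff\<close>)

context
  fixes S :: "('x, 'k::field) mpoly set" and X :: "'x set"
  assumes S: "S \<subseteq> polys X"
begin

lemma ideal_Idl: "ideal (Idl\<^bsub>mpoly_ring X\<^esub> S) (mpoly_ring X)"
  by (rule ring.genideal_ideal[OF ring_mpoly_ring]) (use S in simp)

lemma Idl_superset: "S \<subseteq> Idl\<^bsub>mpoly_ring X\<^esub> S"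
  by (rule ring.genideal_self[OF ring_mpoly_ring]) (use S in simp)

end

lemma Idl_least:
  fixes S :: "('x, 'k::field) mpoly set"
  shows "ideal I (mpoly_ring X) \<Longrightarrow> S \<subseteq> I \<Longrightarrow> Idl\<^bsub>mpoly_ring X\<^esub> S \<subseteq> I"
  by (rule ring.genideal_minimal[OF ring_mpoly_ring])

lemma Idl_mono:
  fixes S :: "('x, 'k::field) mpoly set"
  assumes "S \<subseteq> T" "T \<subseteq> polys X"
  shows "Idl\<^bsub>mpoly_ring X\<^esub> S \<subseteq> Idl\<^bsub>mpoly_ring X\<^esub> T"
  using assms Idl_superset[of T X] by (intro Idl_least ideal_Idl) auto

lemma Idl_ideal_id: "ideal I (mpoly_ring X) \<Longrightarrow> Idl\<^bsub>mpoly_ring X\<^esub> I = (I :: ('x, 'k::field) mpoly set)"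
  by (meson Idl_least Idl_superset subset_antisym subset_refl ideal_polysD subsetI)

lemma Idl_eqI:
  fixes S :: "('x, 'k::field) mpoly set"
  assumes "T \<subseteq> polys X" "S \<subseteq> Idl\<^bsub>mpoly_ring X\<^esub> T" "T \<subseteq> Idl\<^bsub>mpoly_ring X\<^esub> S"
  shows "Idl\<^bsub>mpoly_ring X\<^esub> S = Idl\<^bsub>mpoly_ring X\<^esub> T"
proof
  have "Idl\<^bsub>mpoly_ring X\<^esub> T \<subseteq> polys X"
    using ideal_Idl[OF assms(1)] ideal_polysD by blast
  then have S: "S \<subseteq> polys X" using assms by blast
  show "Idl\<^bsub>mpoly_ring X\<^esub> S \<subseteq> Idl\<^bsub>mpoly_ring X\<^esub> T"
    by (intro Idl_least ideal_Idl assms)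
  show "Idl\<^bsub>mpoly_ring X\<^esub> T \<subseteq> Idl\<^bsub>mpoly_ring X\<^esub> S"
    by (intro Idl_least ideal_Idl assms S)
qed

lemma set_add_mpoly: "A <+>\<^bsub>mpoly_ring X\<^esub> B = {a + b | a b. a \<in> A \<and> b \<in> B}"
  by (auto simp: set_add_def set_mult_def)

lemma Idl_Un:
  fixes S T :: "('x, 'k::field) mpoly set"
  assumes "S \<subseteq> polys X" "T \<subseteq> polys X"
  shows "Idl\<^bsub>mpoly_ring X\<^esub> S <+>\<^bsub>mpoly_ring X\<^esub> Idl\<^bsub>mpoly_ring X\<^esub> T = Idl\<^bsub>mpoly_ring X\<^esub> (S \<union> T)"
    (is "?A <+>\<^bsub>_\<^esub> ?B = ?C")
proof
  note iA = ideal_Idl[OF assms(1)] and iB = ideal_Idl[OF assms(2)]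
  have iC: "ideal ?C (mpoly_ring X)" using assms by (intro ideal_Idl) auto
  have "?A \<subseteq> ?C" "?B \<subseteq> ?C" using assms by (intro Idl_mono; blast)+
  then show "?A <+>\<^bsub>mpoly_ring X\<^esub> ?B \<subseteq> ?C" using ideal_add[OF iC] by (auto simp: set_add_mpoly)
  have "ideal (?A <+>\<^bsub>mpoly_ring X\<^esub> ?B) (mpoly_ring X)"
    by (intro ring.add_ideals[OF ring_mpoly_ring] iA iB)
  moreover have "S \<subseteq> ?A <+>\<^bsub>mpoly_ring X\<^esub> ?B"
    using Idl_superset[OF assms(1)] ideal_zero[OF iB] by (force simp: set_add_mpoly)
  moreover have "T \<subseteq> ?A <+>\<^bsub>mpoly_ring X\<^esub> ?B"
    using Idl_superset[OF assms(2)] ideal_zero[OF iA] by (force simp: set_add_mpoly)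
  ultimately show "?C \<subseteq> ?A <+>\<^bsub>mpoly_ring X\<^esub> ?B" by (intro Idl_least) auto
qed

section \<open>Coefficients with respect to a set of variables\<close>

definition restr :: "'x set \<Rightarrow> 'x mon \<Rightarrow> 'x mon" where
  "restr Z m = Poly_Mapping.mapp (\<lambda>x k. if x \<in> Z then k else 0) m"

lemma lookup_restr [simp]: "lookup (restr Z m) x = (if x \<in> Z then lookup m x else 0)"
  by (auto simp: restr_def lookup_mapp when_def in_keys_iff)

lemma restr_add: "restr Z (a + b) = restr Z a + restr Z b"
  by (intro poly_mapping_eqI) (simp add: lookup_add)

lemma restr_in_mons [simp]: "restr Z m \<in> mons Z"
  by (auto simp: mons_lookup)

lemma restr_in_mons': "m \<in> mons X \<Longrightarrow> restr Z m \<in> mons X"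
  by (auto simp: mons_lookup)

lemma restr_Diff_in_mons: "m \<in> mons X \<Longrightarrow> restr (- Z) m \<in> mons (X - Z)"
  by (auto simp: mons_lookup)

lemma restr_split: "restr Z m + restr (- Z) m = m"
  by (intro poly_mapping_eqI) (simp add: lookup_add)

lemma restr_id: "m \<in> mons Z \<Longrightarrow> restr Z m = m"
  by (intro poly_mapping_eqI) (auto simp: mons_lookup)

lemma restr_eq_zero: "m \<in> mons (X - Z) \<Longrightarrow> restr Z m = 0"
  by (intro poly_mapping_eqI) (auto simp: mons_lookup)

text \<open>
  For \<open>a \<in> mons Z\<close>, \<open>slice Z a f\<close> is the coefficient of \<open>a\<close> in \<open>f\<close>, when \<open>f\<close> is read as a polynomial
  in the variables \<open>Z\<close> over the polynomials in the other variables.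
\<close>

definition slice :: "'x set \<Rightarrow> 'x mon \<Rightarrow> ('x, 'k::field) mpoly \<Rightarrow> ('x, 'k) mpoly" where
  "slice Z a f = Abs_poly_mapping (\<lambda>m. if keys m \<inter> Z = {} then lookup f (m + a) else 0)"

lemma lookup_slice:
  "lookup (slice Z a f) m = (if keys m \<inter> Z = {} then lookup f (m + a) else 0)"
proof -
  have "finite ((\<lambda>m. m + a) -` keys f)"
    by (intro finite_vimageI) (auto simp: inj_on_def)
  then have "finite {m. (if keys m \<inter> Z = {} then lookup f (m + a) else 0) \<noteq> 0}"
    by (rule finite_subset[rotated]) (auto simp: in_keys_iff split: if_splits)
  then show ?thesis unfolding slice_def by simp
qed

lemma slice_zero [simp]: "slice Z a 0 = 0"
  by (intro poly_mapping_eqI) (simp add: lookup_slice)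

lemma slice_add: "slice Z a (f + g) = slice Z a f + slice Z a g"
  by (intro poly_mapping_eqI) (simp add: lookup_slice lookup_add)

lemma slice_diff: "slice Z a (f - g) = slice Z a f - slice Z a g"
  by (intro poly_mapping_eqI) (simp add: lookup_slice lookup_minus)

lemma slice_in_polys: "f \<in> polys X \<Longrightarrow> slice Z a f \<in> polys (X - Z)"
proof (rule in_polysI)
  fix m assume f: "f \<in> polys X" and "m \<in> keys (slice Z a f)"
  then have "keys m \<inter> Z = {}" "m + a \<in> keys f"
    by (auto simp: in_keys_iff lookup_slice split: if_splits)
  then show "m \<in> mons (X - Z)" using in_polysD[OF f, of "m + a"] by (auto simp: mons_def keys_add_mon)
qed

lemma mons_Diff_iff: "m \<in> mons (X - Z) \<longleftrightarrow> m \<in> mons X \<and> keys m \<inter> Z = {}"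
  by (auto simp: mons_def)

lemma slice_single_mult_outside:
  fixes g :: "('x, 'k::field) mpoly"
  assumes "w \<in> mons (X - Z)" "a \<in> mons Z"
  shows "slice Z a (Poly_Mapping.single w c * g) = Poly_Mapping.single w c * slice Z a g"
proof (rule poly_mapping_eqI)
  fix m
  have w0: "lookup w x = 0" if "x \<in> Z" for x using assms(1) that by (simp add: mons_lookup)
  have a0: "lookup a x = 0" if "x \<notin> Z" for x using assms(2) that by (simp add: mons_lookup)
  have dvd: "mon_dvd w (m + a) \<longleftrightarrow> mon_dvd w m"
    unfolding mon_dvd_iff lookup_add
  proof (intro iff_allI)
    fix x
    show "lookup w x \<le> lookup m x + lookup a x \<longleftrightarrow> lookup w x \<le> lookup m x"
      using w0[of x] a0[of x] by (cases "x \<in> Z") simp_all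
  qed
  have diff: "m + a - w = m - w + a" if "mon_dvd w m"
    using that by (intro poly_mapping_eqI) (simp add: mon_dvd_iff lookup_add lookup_minus)
  have keys: "keys (m - w) \<inter> Z = {} \<longleftrightarrow> keys m \<inter> Z = {}" if "mon_dvd w m"
  proof -
    have "x \<in> keys (m - w) \<longleftrightarrow> x \<in> keys m" if "x \<in> Z" for x
      using w0[OF that] by (simp add: lookup_minus in_keys_iff)
    then have "keys (m - w) \<inter> Z = keys m \<inter> Z" by blast
    then show ?thesis by simp
  qed
  show "lookup (slice Z a (Poly_Mapping.single w c * g)) m =
      lookup (Poly_Mapping.single w c * slice Z a g) m"
    by (cases "mon_dvd w m") (simp_all add: lookup_slice lookup_single_mult dvd diff keys)
qed

lemma slice_mult_outside:
  fixes g :: "('x, 'k::field) mpoly"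
  assumes "f \<in> polys (X - Z)" "a \<in> mons Z"
  shows "slice Z a (f * g) = f * slice Z a g"
  using assms(1)
  by (induction f rule: polys_induct)
     (use assms(2) in \<open>auto simp: slice_single_mult_outside slice_add distrib_right\<close>)

lemma slice_single_mult_inside:
  fixes g :: "('x, 'k::field) mpoly"
  assumes "b \<in> mons Z" "a \<in> mons Z"
  shows "slice Z a (Poly_Mapping.single b c * g) =
    (if mon_dvd b a then Poly_Mapping.single 0 c * slice Z (a - b) g else 0)"
proof (rule poly_mapping_eqI)
  fix m
  have dvd: "mon_dvd b (m + a) \<longleftrightarrow> mon_dvd b a" if m: "keys m \<inter> Z = {}"
  proof -
    have "lookup m x = 0 \<or> lookup b x = 0" for x
    proof (cases "x \<in> Z")
      case True
      then show ?thesis using m by (meson disjoint_iff in_keys_iff)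
    next
      case False
      then show ?thesis using assms(1) by (simp add: mons_lookup)
    qed
    then have "lookup b x \<le> lookup m x + lookup a x \<longleftrightarrow> lookup b x \<le> lookup a x" for x
      by (metis add.left_neutral le0)
    then show ?thesis by (simp add: mon_dvd_iff lookup_add)
  qed
  have diff: "m + a - b = m + (a - b)" if "mon_dvd b a"
    using that by (intro poly_mapping_eqI) (auto simp: mon_dvd_iff lookup_add lookup_minus)
  show "lookup (slice Z a (Poly_Mapping.single b c * g)) m =
    lookup (if mon_dvd b a then Poly_Mapping.single 0 c * slice Z (a - b) g else 0) m"
    by (auto simp: lookup_slice lookup_single_mult dvd diff mon_dvd_iff[of 0])
qed

lemma slice_mon_mult [simp]:
  fixes g :: "('x, 'k::field) mpoly"
  assumes "b \<in> mons Z" "a \<in> mons Z"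
  shows "slice Z (b + a) (mon_poly b * g) = slice Z a g"
  using assms by (simp add: mon_poly_def slice_single_mult_inside)

lemma slice_outside:
  assumes "f \<in> polys (X - Z)" "a \<in> mons Z"
  shows "slice Z a f = (if a = 0 then f else 0)"
proof (rule poly_mapping_eqI)
  fix m
  have *: "lookup f m = 0" if "keys m \<inter> Z \<noteq> {}" for m
    using assms that in_polysD[of f "X - Z" m] by (auto simp: mons_Diff_iff in_keys_iff)
  have "keys (m + a) \<inter> Z \<noteq> {}" if "a \<noteq> 0"
    using that assms(2) keys_eq_empty[of a] unfolding keys_add_mon mons_def by blast
  then show "lookup (slice Z a f) m = lookup (if a = 0 then f else 0) m"
    using *[of m] *[of "m + a"] by (auto simp: lookup_slice)
qed

lemma slice_zero_iff: "slice Z a f = 0 \<longleftrightarrow> (\<forall>m. keys m \<inter> Z = {} \<longrightarrow> m + a \<notin> keys f)"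
  by (auto simp: poly_mapping_eq_iff fun_eq_iff lookup_slice in_keys_iff)

lemma slice_eq_zero: "a \<notin> restr Z ` keys f \<Longrightarrow> a \<in> mons Z \<Longrightarrow> slice Z a f = 0"
proof -
  assume a: "a \<notin> restr Z ` keys f" "a \<in> mons Z"
  have "restr Z (m + a) = a" if "keys m \<inter> Z = {}" for m
    using that a(2) by (intro poly_mapping_eqI) (auto simp: mons_lookup lookup_add in_keys_iff disjoint_iff)
  then show ?thesis using a(1) unfolding slice_zero_iff by (metis image_eqI)
qed

lemma poly_sum_slices:
  fixes f :: "('x, 'k::field) mpoly"
  shows "f = (\<Sum>a\<in>restr Z ` keys f. mon_poly a * slice Z a f)"
proof (rule poly_mapping_eqI)
  fix m
  have "lookup (mon_poly a * slice Z a f) m = (if a = restr Z m then lookup f m else 0)"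
    if "a \<in> mons Z" for a
  proof (cases "a = restr Z m")
    case True
    have "lookup (mon_poly a * slice Z a f) (restr Z m + restr (- Z) m) = lookup f (restr (- Z) m + restr Z m)"
      unfolding True mon_poly_def by (simp add: lookup_slice disjoint_iff in_keys_iff)
    then show ?thesis using True by (simp add: restr_split add.commute[of "restr (- Z) m"])
  next
    case False
    have "keys (m - a) \<inter> Z \<noteq> {}" if "mon_dvd a m"
    proof (rule ccontr)
      assume "\<not> keys (m - a) \<inter> Z \<noteq> {}"
      then have "lookup a x = lookup m x" if "x \<in> Z" for x
        using that \<open>mon_dvd a m\<close> by (force simp: disjoint_iff in_keys_iff lookup_minus mon_dvd_iff
            intro: antisym)
      then have "a = restr Z m" using \<open>a \<in> mons Z\<close>
        by (intro poly_mapping_eqI) (auto simp: mons_lookup)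
      with False show False ..
    qed
    then show ?thesis using False by (auto simp: mon_poly_def lookup_single_mult lookup_slice)
  qed
  then have "lookup (\<Sum>a\<in>restr Z ` keys f. mon_poly a * slice Z a f) m
      = (\<Sum>a\<in>restr Z ` keys f. if a = restr Z m then lookup f m else 0)"
    unfolding lookup_sum by (intro sum.cong) auto
  also have "\<dots> = lookup f m"
    by (auto simp: in_keys_iff)
  finally show "lookup f m = lookup (\<Sum>a\<in>restr Z ` keys f. mon_poly a * slice Z a f) m" ..
qed

lemma poly_eq_zero_slices:
  fixes f :: "('x, 'k::field) mpoly"
  assumes "\<And>a. a \<in> mons Z \<Longrightarrow> slice Z a f = 0"
  shows "f = 0"
proof -
  have "(\<Sum>a\<in>restr Z ` keys f. mon_poly a * slice Z a f) = 0"
    using assms by (intro sum.neutral) auto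
  then show ?thesis using poly_sum_slices[of f Z] by simp
qed

section \<open>Extension of ideals to more variables\<close>

text \<open>
  A term factors into its part in the variables \<open>Z\<close>, which shifts the coefficients, and the remaining part,
  which multiplies each of them.
\<close>

lemma ideal_slicewise:
  fixes J :: "('x, 'k::field) mpoly set"
  assumes J: "ideal J (mpoly_ring (X - Z))"
  shows "ideal {f \<in> polys X. \<forall>a\<in>mons Z. slice Z a f \<in> J} (mpoly_ring X)"
proof (rule ideal_mpoly_ringI)
  fix f m c assume f: "f \<in> {f \<in> polys X. \<forall>a\<in>mons Z. slice Z a f \<in> J}" and m: "m \<in> mons X"
  have "slice Z a (Poly_Mapping.single m c * f) \<in> J" if a: "a \<in> mons Z" for a
  proof -
    have "Poly_Mapping.single m c * f =
        Poly_Mapping.single (restr (- Z) m) c * (Poly_Mapping.single (restr Z m) 1 * f)"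
      unfolding mult.assoc[symmetric] mult_single by (simp add: restr_split add.commute)
    then have *: "slice Z a (Poly_Mapping.single m c * f) =
        Poly_Mapping.single (restr (- Z) m) c * slice Z a (Poly_Mapping.single (restr Z m) 1 * f)"
      using slice_single_mult_outside[OF restr_Diff_in_mons[OF m] a] by metis
    show ?thesis unfolding *
      using f a m by (intro ideal_mult_left[OF J] single_in_polys restr_Diff_in_mons)
        (auto simp: slice_single_mult_inside diff_in_mons ideal_zero[OF J])
  qed
  then show "Poly_Mapping.single m c * f \<in> {f \<in> polys X. \<forall>a\<in>mons Z. slice Z a f \<in> J}"
    using f m by (auto intro!: mult_in_polys single_in_polys)
qed (auto simp: slice_add polys_closed ideal_zero[OF J] ideal_add[OF J])

text \<open>
  The polynomials with all coefficients in \<open>J\<close> form an ideal that contains \<open>J\<close>, and each of them is a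
  combination of its coefficients.
\<close>

lemma in_Idl_iff_slices:
  fixes J :: "('x, 'k::field) mpoly set"
  assumes J: "ideal J (mpoly_ring (X - Z))" and Z: "Z \<subseteq> X"
  shows "f \<in> Idl\<^bsub>mpoly_ring X\<^esub> J \<longleftrightarrow> f \<in> polys X \<and> (\<forall>a\<in>mons Z. slice Z a f \<in> J)"
proof
  have JX: "J \<subseteq> polys X" using ideal_polysD[OF J] polys_mono[of "X - Z" X] by blast
  have "J \<subseteq> {f \<in> polys X. \<forall>a\<in>mons Z. slice Z a f \<in> J}"
    using JX slice_outside[OF ideal_polysD[OF J]] ideal_zero[OF J] by auto
  then show "f \<in> polys X \<and> (\<forall>a\<in>mons Z. slice Z a f \<in> J)" if "f \<in> Idl\<^bsub>mpoly_ring X\<^esub> J"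
    using Idl_least[OF ideal_slicewise[OF J]] that by blast
  assume f: "f \<in> polys X \<and> (\<forall>a\<in>mons Z. slice Z a f \<in> J)"
  have "mon_poly a * slice Z a f \<in> Idl\<^bsub>mpoly_ring X\<^esub> J" if "a \<in> mons Z" for a
    using f that Idl_superset[OF JX] Z
    by (intro ideal_mult_left[OF ideal_Idl[OF JX]]) (auto intro: mons_mono)
  then have "(\<Sum>a\<in>restr Z ` keys f. mon_poly a * slice Z a f) \<in> Idl\<^bsub>mpoly_ring X\<^esub> J"
    by (intro ideal_sum[OF ideal_Idl[OF JX]]) auto
  then show "f \<in> Idl\<^bsub>mpoly_ring X\<^esub> J" using poly_sum_slices[of f Z] by simp
qed

lemma Idl_contraction:
  fixes J :: "('x, 'k::field) mpoly set"
  assumes J: "ideal J (mpoly_ring (X - Z))" and Z: "Z \<subseteq> X"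
  shows "Idl\<^bsub>mpoly_ring X\<^esub> J \<inter> polys (X - Z) = J"
proof
  show "Idl\<^bsub>mpoly_ring X\<^esub> J \<inter> polys (X - Z) \<subseteq> J"
  proof
    fix f assume f: "f \<in> Idl\<^bsub>mpoly_ring X\<^esub> J \<inter> polys (X - Z)"
    then have "slice Z 0 f \<in> J" using in_Idl_iff_slices[OF assms] by auto
    then show "f \<in> J" using slice_outside[of f X Z 0] f by simp
  qed
  have J': "J \<subseteq> polys (X - Z)" using ideal_polysD[OF J] by blast
  then have "J \<subseteq> polys X" using polys_mono[of "X - Z" X] by blast
  then show "J \<subseteq> Idl\<^bsub>mpoly_ring X\<^esub> J \<inter> polys (X - Z)" using J' Idl_superset by blast
qed

text \<open>
  After removal of all coefficients in the prime, the product of the two largest remaining coefficients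
  of two polynomials is a coefficient of their product.
\<close>

lemma prime_extension:
  fixes Q :: "('x::linorder, 'k::field) mpoly set"
  assumes Q: "primeideal Q (mpoly_ring (X - Z))" and Z: "Z \<subseteq> X"
  shows "primeideal (Idl\<^bsub>mpoly_ring X\<^esub> Q) (mpoly_ring X)"
proof -
  let ?E = "Idl\<^bsub>mpoly_ring X\<^esub> Q"
  note Qi = prime_ideal_ideal[OF Q]
  have QX: "Q \<subseteq> polys X" using ideal_polysD[OF Qi] polys_mono[of "X - Z" X] by blast
  note E = ideal_Idl[OF QX] and mem = in_Idl_iff_slices[OF Qi Z]
  \<comment> \<open>Modulo the extended prime, a polynomial has a leading coefficient outside the prime.\<close>
  have lead: "\<exists>\<alpha> A a'. \<alpha> \<in> mons Z \<and> A \<in> polys (X - Z) \<and> A \<notin> Q \<and> a' \<in> polys X \<and>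
      (\<forall>m\<in>keys a'. restr Z m < \<alpha>) \<and> a - (mon_poly \<alpha> * A + a') \<in> ?E"
    if a: "a \<in> polys X" "a \<notin> ?E" for a
  proof -
    define R where "R = {\<beta> \<in> restr Z ` keys a. slice Z \<beta> a \<notin> Q}"
    have fin: "finite R" by (simp add: R_def)
    have "slice Z \<beta> a \<in> Q" if "\<beta> \<in> mons Z" "\<beta> \<notin> R" for \<beta>
      using that slice_eq_zero[of \<beta> Z a] ideal_zero[OF Qi] by (auto simp: R_def)
    then have ne: "R \<noteq> {}" using a mem by blast
    define \<alpha> where "\<alpha> = Max R"
    have \<alpha>: "\<alpha> \<in> R" using Max_in[OF fin ne] by (simp add: \<alpha>_def)
    define a' where "a' = (\<Sum>\<beta>\<in>R - {\<alpha>}. mon_poly \<beta> * slice Z \<beta> a)"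
    have summand: "mon_poly \<beta> * slice Z \<beta> a \<in> polys X" if "\<beta> \<in> mons Z" for \<beta>
      using that Z a(1) slice_in_polys[of a X Z \<beta>] polys_mono[of "X - Z" X]
      by (auto intro!: mult_in_polys intro: mons_mono[OF Z])
    have Rm: "R \<subseteq> mons Z" by (auto simp: R_def)
    have "restr Z m < \<alpha>" if m: "m \<in> keys a'" for m
    proof -
      obtain \<beta> where \<beta>: "\<beta> \<in> R - {\<alpha>}" "m \<in> keys (mon_poly \<beta> * slice Z \<beta> a)"
        using m keys_sum[of "\<lambda>\<beta>. mon_poly \<beta> * slice Z \<beta> a" "R - {\<alpha>}"] unfolding a'_def by blast
      then obtain m' where m': "m = \<beta> + m'" "m' \<in> keys (slice Z \<beta> a)"
        by (auto simp: mon_poly_def keys_single_mult)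
      have "restr Z m' = 0"
        using in_polysD[OF slice_in_polys[OF a(1)] m'(2)] by (rule restr_eq_zero)
      moreover have "restr Z \<beta> = \<beta>" using \<beta>(1) Rm by (intro restr_id) auto
      ultimately have "restr Z m = \<beta>" by (simp add: m' restr_add)
      moreover have "\<beta> < \<alpha>" using \<beta>(1) Max_ge[OF fin, of \<beta>] by (auto simp: \<alpha>_def)
      ultimately show ?thesis by simp
    qed
    moreover have "a - (mon_poly \<alpha> * slice Z \<alpha> a + a') \<in> ?E"
    proof -
      have 1: "a = (\<Sum>\<beta>\<in>R. mon_poly \<beta> * slice Z \<beta> a)
          + (\<Sum>\<beta>\<in>restr Z ` keys a - R. mon_poly \<beta> * slice Z \<beta> a)"
        by (subst poly_sum_slices[of a Z], subst sum.subset_diff[of R])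
           (auto simp: R_def add.commute)
      have 2: "(\<Sum>\<beta>\<in>R. mon_poly \<beta> * slice Z \<beta> a) = mon_poly \<alpha> * slice Z \<alpha> a + a'"
        unfolding a'_def using \<alpha> fin by (subst sum.remove[of R \<alpha>]) auto
      have "(\<Sum>\<beta>\<in>restr Z ` keys a - R. mon_poly \<beta> * slice Z \<beta> a) \<in> ?E"
      proof (rule ideal_sum[OF E])
        fix \<beta> assume "\<beta> \<in> restr Z ` keys a - R"
        then have "\<beta> \<in> mons Z" "slice Z \<beta> a \<in> ?E"
          using Idl_superset[OF QX] by (auto simp: R_def)
        then show "mon_poly \<beta> * slice Z \<beta> a \<in> ?E"
          using Z by (intro ideal_mult_left[OF E]) (auto intro: mons_mono[OF Z])
      qed
      moreover have "a - (mon_poly \<alpha> * slice Z \<alpha> a + a') =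
          (\<Sum>\<beta>\<in>restr Z ` keys a - R. mon_poly \<beta> * slice Z \<beta> a)"
        by (subst 1, unfold 2) (rule add_diff_cancel_left')
      ultimately show ?thesis by (simp only:)
    qed
    moreover have "a' \<in> polys X" unfolding a'_def using summand Rm by (intro sum_in_polys) auto
    moreover have "\<alpha> \<in> mons Z" "slice Z \<alpha> a \<notin> Q" using \<alpha> Rm by (auto simp: R_def)
    ultimately show ?thesis using slice_in_polys[OF a(1), of Z \<alpha>]
      by (intro exI[of _ \<alpha>] exI[of _ "slice Z \<alpha> a"] exI[of _ a']) simp
  qed
  show ?thesis unfolding primeideal_mpoly_ring_iff
  proof (intro conjI ballI impI E)
    show "1 \<notin> ?E" using Idl_contraction[OF Qi Z] Q by (auto simp: primeideal_mpoly_ring_iff)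
    fix a b assume ab: "a \<in> polys X" "b \<in> polys X" "a * b \<in> ?E"
    show "a \<in> ?E \<or> b \<in> ?E"
    proof (rule ccontr)
      assume "\<not> (a \<in> ?E \<or> b \<in> ?E)"
      then obtain \<alpha> A a' \<beta> B b' where
        A: "\<alpha> \<in> mons Z" "A \<in> polys (X - Z)" "A \<notin> Q" "a' \<in> polys X" "\<forall>m\<in>keys a'. restr Z m < \<alpha>"
          "a - (mon_poly \<alpha> * A + a') \<in> ?E" and
        B: "\<beta> \<in> mons Z" "B \<in> polys (X - Z)" "B \<notin> Q" "b' \<in> polys X" "\<forall>m\<in>keys b'. restr Z m < \<beta>"
          "b - (mon_poly \<beta> * B + b') \<in> ?E"
        using lead[of a] lead[of b] ab by blast
      let ?f = "mon_poly \<alpha> * A + a'" and ?g = "mon_poly \<beta> * B + b'"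
      have XX: "A \<in> polys X" "B \<in> polys X" using A B by (auto intro: polys_mono[of "X - Z"])
      have fX: "?f \<in> polys X"
        using A(4) XX mons_mono[OF Z A(1)] by (simp add: add_in_polys mult_in_polys)
      have "?f * ?g = a * b - (b * (a - ?f) + ?f * (b - ?g))" by (simp add: algebra_simps)
      also have "\<dots> \<in> ?E"
        by (rule ideal_diff[OF E ab(3) ideal_add[OF E ideal_mult_left[OF E A(6) ab(2)]
            ideal_mult_left[OF E B(6) fX]]])
      finally have "slice Z (\<alpha> + \<beta>) (?f * ?g) \<in> Q" using mem A B by auto
      moreover have "slice Z (\<alpha> + \<beta>) (?f * ?g) = A * B"
      proof -
        have 1: "?f * ?g = mon_poly \<alpha> * (mon_poly \<beta> * (A * B))
            + (mon_poly \<alpha> * A * b' + a' * (mon_poly \<beta> * B) + a' * b')" (is "_ = _ + ?r")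
          by (simp add: algebra_simps)
        have rA: "restr Z m = \<alpha>" if m: "m \<in> keys (mon_poly \<alpha> * A)" for m
        proof -
          obtain m' where "m = \<alpha> + m'" "m' \<in> keys A"
            using m by (auto simp: mon_poly_def keys_single_mult)
          then show ?thesis
            using restr_eq_zero[OF in_polysD[OF A(2)], of m'] restr_id[OF A(1)] by (simp add: restr_add)
        qed
        have rB: "restr Z m = \<beta>" if m: "m \<in> keys (mon_poly \<beta> * B)" for m
        proof -
          obtain m' where "m = \<beta> + m'" "m' \<in> keys B"
            using m by (auto simp: mon_poly_def keys_single_mult)
          then show ?thesis
            using restr_eq_zero[OF in_polysD[OF B(2)], of m'] restr_id[OF B(1)] by (simp add: restr_add)
        qed
        have small: "restr Z m < \<alpha> + \<beta>" if "m \<in> keys ?r" for m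
        proof -
          have "m \<in> keys (mon_poly \<alpha> * A * b') \<union> keys (a' * (mon_poly \<beta> * B)) \<union> keys (a' * b')"
            using that keys_add[of "mon_poly \<alpha> * A * b' + a' * (mon_poly \<beta> * B)" "a' * b'"]
              keys_add[of "mon_poly \<alpha> * A * b'" "a' * (mon_poly \<beta> * B)"] by blast
          then obtain u v where "m = u + v" and
            "(u \<in> keys (mon_poly \<alpha> * A) \<and> v \<in> keys b') \<or> (u \<in> keys a' \<and> v \<in> keys (mon_poly \<beta> * B))
              \<or> (u \<in> keys a' \<and> v \<in> keys b')"
            using keys_mult[of "mon_poly \<alpha> * A" b'] keys_mult[of a' "mon_poly \<beta> * B"]
              keys_mult[of a' b'] by blast
          then show ?thesis
            using rA rB A(5) B(5) by (auto simp: restr_add intro: add_strict_mono)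
        qed
        have "slice Z (\<alpha> + \<beta>) ?r = 0"
        proof (rule slice_eq_zero)
          show "\<alpha> + \<beta> \<notin> restr Z ` keys ?r"
          proof
            assume "\<alpha> + \<beta> \<in> restr Z ` keys ?r"
            then obtain m where "\<alpha> + \<beta> = restr Z m" "m \<in> keys ?r" by (rule imageE)
            with small[of m] show False by simp
          qed
        qed (use A(1) B(1) in simp)
        then have "slice Z (\<alpha> + \<beta>) (?f * ?g) = slice Z (\<alpha> + \<beta>) (mon_poly \<alpha> * (mon_poly \<beta> * (A * B)))"
          unfolding 1 by (simp add: slice_add)
        also have "\<dots> = A * B"
          using A B slice_mon_mult[of \<beta> Z 0 "A * B"] slice_outside[of "A * B" X Z 0]
          by (simp add: mult_in_polys)
        finally show ?thesis .
      qed
      ultimately show False using Q A B by (auto simp: primeideal_mpoly_ring_iff)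
    qed
  qed
qed

section \<open>Dickson's lemma and the lexicographic order\<close>

lemma nat_seq_mono_subseq:
  fixes t :: "nat \<Rightarrow> nat"
  shows "\<exists>\<psi> :: nat \<Rightarrow> nat. strict_mono \<psi> \<and> (\<forall>i j. i \<le> j \<longrightarrow> t (\<psi> i) \<le> t (\<psi> j))"
proof -
  obtain f where f: "strict_mono f" "monoseq (\<lambda>i. t (f i))"
    using seq_monosub[of t] by blast
  from f(2) show ?thesis unfolding monoseq_def
  proof
    assume "\<forall>m. \<forall>n\<ge>m. t (f m) \<le> t (f n)"
    then show ?thesis using f(1) by blast
  next
    assume dec: "\<forall>m. \<forall>n\<ge>m. t (f n) \<le> t (f m)"
    obtain m where m: "\<And>n. t (f m) \<le> t (f n)"
      using ex_has_least_nat[of "\<lambda>_. True" 0 "\<lambda>n. t (f n)"] by auto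
    have "t (f (m + i)) = t (f m)" for i
      using m[of "m + i"] dec by (simp add: antisym)
    moreover have "strict_mono (\<lambda>i. f (m + i))"
      using f(1) by (simp add: strict_mono_def)
    ultimately show ?thesis by (intro exI[of _ "\<lambda>i. f (m + i)"]) simp
  qed
qed

text \<open>
  One variable after the other, pass to a subsequence on which its exponent is monotone.
\<close>

lemma dickson_subseq:
  fixes s :: "nat \<Rightarrow> 'x mon"
  assumes "finite X"
  shows "\<exists>\<phi> :: nat \<Rightarrow> nat. strict_mono \<phi> \<and> (\<forall>x\<in>X. \<forall>i j. i \<le> j \<longrightarrow> lookup (s (\<phi> i)) x \<le> lookup (s (\<phi> j)) x)"
  using assms
proof (induction X rule: finite_induct)
  case empty
  show ?case by (intro exI[of _ id]) (simp add: strict_mono_def)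
next
  case (insert x X)
  then obtain \<phi> :: "nat \<Rightarrow> nat" where \<phi>: "strict_mono \<phi>"
    "\<And>x i j. x \<in> X \<Longrightarrow> i \<le> j \<Longrightarrow> lookup (s (\<phi> i)) x \<le> lookup (s (\<phi> j)) x" by blast
  obtain \<psi> :: "nat \<Rightarrow> nat" where \<psi>: "strict_mono \<psi>"
    "\<And>i j. i \<le> j \<Longrightarrow> lookup (s (\<phi> (\<psi> i))) x \<le> lookup (s (\<phi> (\<psi> j))) x"
    using nat_seq_mono_subseq[of "\<lambda>i. lookup (s (\<phi> i)) x"] by blast
  have "\<psi> i \<le> \<psi> j" if "i \<le> j" for i j
    using \<psi>(1) that by (simp add: strict_mono_less_eq)
  moreover have "strict_mono (\<lambda>i. \<phi> (\<psi> i))"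
    using \<phi>(1) \<psi>(1) by (simp add: strict_mono_def)
  ultimately show ?case using \<phi>(2) \<psi>(2) by (intro exI[of _ "\<lambda>i. \<phi> (\<psi> i)"]) simp
qed

lemma dickson:
  fixes s :: "nat \<Rightarrow> 'x mon"
  assumes "finite X" "\<And>i. s i \<in> mons X"
  obtains i j where "i < j" "mon_dvd (s i) (s j)"
proof -
  obtain \<phi> :: "nat \<Rightarrow> nat" where \<phi>: "strict_mono \<phi>"
    "\<And>x i j. x \<in> X \<Longrightarrow> i \<le> j \<Longrightarrow> lookup (s (\<phi> i)) x \<le> lookup (s (\<phi> j)) x"
    using dickson_subseq[OF assms(1), of s] by blast
  have "lookup (s (\<phi> 0)) x \<le> lookup (s (\<phi> 1)) x" for x
  proof (cases "x \<in> X")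
    case False
    then show ?thesis using assms(2)[of "\<phi> 0"] by (simp add: mons_lookup)
  qed (simp add: \<phi>(2))
  moreover have "\<phi> 0 < \<phi> 1" using \<phi>(1) by (simp add: strict_mono_def)
  ultimately show ?thesis using that by (simp add: mon_dvd_iff)
qed

lemma mon_dvd_le:
  fixes u v :: "'x::linorder mon"
  assumes "mon_dvd u v"
  shows "u \<le> v"
proof (rule ccontr)
  assume "\<not> u \<le> v"
  then have "v < u" by simp
  then obtain k where "lookup v k < lookup u k"
    by (auto simp: less_poly_mapping.rep_eq less_fun_def)
  with assms show False by (simp add: mon_dvd_iff leD)
qed

text \<open>
  The order extends divisibility, so that a descending sequence would contradict Dickson's lemma.
\<close>

lemma wf_lex:
  assumes "finite X"
  shows "wf {(a, b :: 'x::linorder mon). a \<in> mons X \<and> b \<in> mons X \<and> a < b}"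
  unfolding wf_iff_no_infinite_down_chain
proof
  assume "\<exists>s. \<forall>i. (s (Suc i), s i) \<in> {(a, b :: 'x mon). a \<in> mons X \<and> b \<in> mons X \<and> a < b}"
  then obtain s where s: "\<And>i. s i \<in> mons X" "\<And>i. s (Suc i) < (s i :: 'x mon)" by auto
  obtain i j where "i < j" "mon_dvd (s i) (s j)" using dickson[of X s] assms s(1) by blast
  moreover have "s j < s i" if "i < j" for i j
    using that by (induction j) (auto simp: less_Suc_eq intro: less_trans s(2))
  ultimately show False using mon_dvd_le[of "s i" "s j"] by (meson leD)
qed

text \<open>
  The elements that are minimal for divisibility are pairwise incomparable, and hence finite in number.
\<close>

lemma finite_dvd_basis:
  fixes S :: "'x::linorder mon set"
  assumes "finite X" "S \<subseteq> mons X"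
  obtains T where "T \<subseteq> S" "finite T" "\<And>s. s \<in> S \<Longrightarrow> \<exists>t\<in>T. mon_dvd t s"
proof -
  define T where "T = {t \<in> S. \<forall>u\<in>S. mon_dvd u t \<longrightarrow> u = t}"
  have "finite T"
  proof (rule ccontr)
    assume "infinite T"
    then obtain s :: "nat \<Rightarrow> 'x mon" where s: "inj s" "range s \<subseteq> T"
      using infinite_countable_subset by blast
    have "s i \<in> mons X" for i using s(2) assms(2) by (auto simp: T_def)
    then obtain i j where ij: "i < j" "mon_dvd (s i) (s j)" using dickson[of X s] assms(1) by blast
    have "s i \<in> S" "s j \<in> T" using s(2) by (auto simp: T_def)
    then have "s i = s j" using ij(2) by (simp add: T_def)
    then show False using s(1) ij(1) by (simp add: inj_eq)
  qed
  moreover have "s \<in> S \<Longrightarrow> \<exists>t\<in>T. mon_dvd t s" for s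
  proof (induction s rule: wf_induct_rule[OF wf_lex[OF assms(1)]])
    case (1 s)
    show ?case
    proof (cases "s \<in> T")
      case False
      then obtain u where u: "u \<in> S" "mon_dvd u s" "u \<noteq> s" using 1(2) by (auto simp: T_def)
      then have "u < s" using mon_dvd_le[of u s] by (simp add: le_less)
      then obtain t where "t \<in> T" "mon_dvd t u" using 1 u assms(2) by blast
      then show ?thesis using u(2) mon_dvd_trans by blast
    qed (use mon_dvd_refl in blast)
  qed
  ultimately show ?thesis using that[of T] by (auto simp: T_def)
qed

definition lexo :: "'x::linorder set \<Rightarrow> 'x mon rel" where
  "lexo X = {(a, b). a \<in> mons X \<and> b \<in> mons X \<and> a \<le> b}"

lemma lex_order_eq: "lex_order n = lexo {1..n}"
  by (simp add: lex_order_def lexo_def)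

lemma monomial_order_lexo:
  assumes "finite X"
  shows "monomial_order X (lexo X)"
proof -
  have "lexo X - Id = {(a, b). a \<in> mons X \<and> b \<in> mons X \<and> a < b}"
    by (auto simp: lexo_def)
  then have "wf (lexo X - Id)" using wf_lex[OF assms] by simp
  then have "well_order_on (mons X) (lexo X)"
    by (auto simp: well_order_on_def linear_order_on_def partial_order_on_def preorder_on_def
        refl_on_def total_on_def lexo_def intro!: transI antisymI)
  then show ?thesis by (auto simp: monomial_order_def lexo_def)
qed

text \<open>
  The order looks at the smallest index first, hence at the largest variable \<open>y\<close>.
\<close>

lemma lex_less_smallest:
  fixes a b :: "'x::linorder mon"
  assumes "a \<in> mons X" "b \<in> mons X" "\<And>x. x \<in> X \<Longrightarrow> y \<le> x" "lookup a y < lookup b y"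
  shows "a < b"
  unfolding less_poly_mapping.rep_eq less_fun_def
proof (intro exI[of _ y] conjI allI impI)
  fix k assume "k < y"
  then have "k \<notin> X" using assms(3)[of k] by auto
  then show "lookup a k = lookup b k" using assms(1,2) by (simp add: mons_lookup)
qed (rule assms)

section \<open>Leading monomials\<close>

definition lm :: "('x::linorder, 'k::field) mpoly \<Rightarrow> 'x mon" where
  "lm f = Max (keys f)"

lemma lm_in_keys: "f \<noteq> 0 \<Longrightarrow> lm f \<in> keys f"
  by (simp add: lm_def)

lemma lm_ge: "m \<in> keys f \<Longrightarrow> m \<le> lm f"
  by (simp add: lm_def)

lemma lm_eqI: "m \<in> keys f \<Longrightarrow> (\<And>m'. m' \<in> keys f \<Longrightarrow> m' \<le> m) \<Longrightarrow> lm f = m"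
  unfolding lm_def by (intro Max_eqI) auto

lemma lm_in_mons: "f \<in> polys X \<Longrightarrow> f \<noteq> 0 \<Longrightarrow> lm f \<in> mons X"
  using in_polysD lm_in_keys by blast

lemma lookup_lm: "f \<noteq> 0 \<Longrightarrow> lookup f (lm f) \<noteq> 0"
  using lm_in_keys[of f] by (simp add: in_keys_iff)

lemma lead_mon_lexo:
  assumes "f \<in> polys X" "f \<noteq> 0"
  shows "lead_mon (lexo X) f = lm f"
  unfolding lead_mon_def
proof (rule the_equality)
  show "lm f \<in> keys f \<and> (\<forall>m'\<in>keys f. (m', lm f) \<in> lexo X)"
    using assms by (auto simp: lexo_def lm_in_keys lm_ge lm_in_mons intro: in_polysD)
  fix m assume m: "m \<in> keys f \<and> (\<forall>m'\<in>keys f. (m', m) \<in> lexo X)"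
  then show "m = lm f" using lm_eqI[of m f] by (auto simp: lexo_def)
qed

lemma init_term_lexo:
  assumes "f \<in> polys X"
  shows "init_term (lexo X) f = Poly_Mapping.single (lm f) (lookup f (lm f))"
  using assms lead_mon_lexo[of f X] by (cases "f = 0") (simp_all add: init_term_def)

lemma single_mult_eq_zero: "Poly_Mapping.single w c * f = 0 \<longleftrightarrow> c = 0 \<or> f = (0 :: ('x, 'k::field) mpoly)"
  using keys_single_mult[of c w f] by (cases "c = 0") (simp_all flip: keys_eq_empty)

lemma lm_single_mult:
  assumes "c \<noteq> 0" "f \<noteq> 0"
  shows "lm (Poly_Mapping.single w c * f) = w + lm f"
  using assms by (intro lm_eqI) (auto simp: keys_single_mult lm_in_keys lm_ge)

lemma lm_single [simp]: "c \<noteq> 0 \<Longrightarrow> lm (Poly_Mapping.single w c) = w"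
  by (intro lm_eqI) auto

lemma reduction_step:
  fixes f g :: "('x::linorder, 'k::field) mpoly"
  assumes "f \<noteq> 0" "g \<noteq> 0" "mon_dvd (lm g) (lm f)"
  defines "h \<equiv> f - Poly_Mapping.single (lm f - lm g) (lookup f (lm f) / lookup g (lm g)) * g"
  shows "h = 0 \<or> lm h < lm f"
proof (cases "h = 0")
  case False
  let ?p = "Poly_Mapping.single (lm f - lm g) (lookup f (lm f) / lookup g (lm g)) * g"
  have c: "lookup f (lm f) / lookup g (lm g) \<noteq> 0" using assms(1,2) by (simp add: lookup_lm)
  have sum: "lm f - lm g + lm g = lm f"
    using mon_dvd_add_diff[OF assms(3)] by (simp add: add.commute)
  have lmp: "lm ?p = lm f" using lm_single_mult[OF c assms(2), of "lm f - lm g"] sum by simp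
  have "lookup ?p (lm f) = lookup f (lm f)"
    using lookup_single_mult_add[of "lm f - lm g" "lookup f (lm f) / lookup g (lm g)" g "lm g"]
      sum assms(2) by (simp add: lookup_lm)
  then have "lookup h (lm f) = 0" by (simp add: h_def lookup_minus)
  then have ne: "lm h \<noteq> lm f" using lookup_lm[OF False] by auto
  have "lm h \<in> keys f \<or> lm h \<in> keys ?p"
    using lm_in_keys[OF False] by (auto simp: h_def in_keys_iff lookup_minus)
  then have "lm h \<le> lm f" using lm_ge[of "lm h" f] lm_ge[of "lm h" ?p] lmp by auto
  then show ?thesis using ne by (auto simp: le_less)
qed simp

text \<open>
  The division algorithm: successive reduction of an element of \<open>J\<close> by \<open>G\<close> ends with \<open>0\<close>, because the leading
  monomials decrease in a well-founded order.
\<close>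

lemma ideal_generated_by_leading:
  fixes J :: "('x::linorder, 'k::field) mpoly set"
  assumes "finite X" "ideal J (mpoly_ring X)" "G \<subseteq> J"
    and dvd: "\<And>f. f \<in> J \<Longrightarrow> f \<noteq> 0 \<Longrightarrow> \<exists>g\<in>G. g \<noteq> 0 \<and> mon_dvd (lm g) (lm f)"
  shows "Idl\<^bsub>mpoly_ring X\<^esub> G = J"
proof
  show "Idl\<^bsub>mpoly_ring X\<^esub> G \<subseteq> J" using assms by (intro Idl_least)
  have GX: "G \<subseteq> polys X" using assms(2,3) ideal_polysD by blast
  note iG = ideal_Idl[OF GX]
  have "f \<in> J \<Longrightarrow> f \<noteq> 0 \<Longrightarrow> lm f = m \<Longrightarrow> f \<in> Idl\<^bsub>mpoly_ring X\<^esub> G" for f m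
  proof (induction m arbitrary: f rule: wf_induct_rule[OF wf_lex[OF assms(1)]])
    case (1 m f)
    obtain g where g: "g \<in> G" "g \<noteq> 0" "mon_dvd (lm g) (lm f)" using dvd 1 by blast
    define p where "p = Poly_Mapping.single (lm f - lm g) (lookup f (lm f) / lookup g (lm g))"
    have p: "p \<in> polys X"
      unfolding p_def using 1(2,3) ideal_polysD[OF assms(2)]
      by (intro single_in_polys diff_in_mons lm_in_mons) auto
    have h: "f - p * g \<in> J"
      using g(1) assms(3) p 1(2) by (intro ideal_diff[OF assms(2)] ideal_mult_left[OF assms(2)]) auto
    have pg: "p * g \<in> Idl\<^bsub>mpoly_ring X\<^esub> G"
      using g(1) Idl_superset[OF GX] p by (intro ideal_mult_left[OF iG]) auto
    have "f - p * g = 0 \<or> lm (f - p * g) < lm f"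
      unfolding p_def by (rule reduction_step) (use 1 g in auto)
    then have "f - p * g \<in> Idl\<^bsub>mpoly_ring X\<^esub> G"
    proof (cases "f - p * g = 0")
      case False
      then have "lm (f - p * g) < m" using \<open>_ \<or> _\<close> 1(4) by auto
      moreover have "lm (f - p * g) \<in> mons X" "m \<in> mons X"
        using h False 1(2,3,4) ideal_polysD[OF assms(2)] lm_in_mons by blast+
      ultimately show ?thesis using 1(1)[of "lm (f - p * g)" "f - p * g"] h False by simp
    qed (simp add: ideal_zero[OF iG])
    then show ?case using ideal_add[OF iG _ pg] by fastforce
  qed
  then show "J \<subseteq> Idl\<^bsub>mpoly_ring X\<^esub> G" using ideal_zero[OF iG] by blast
qed

text \<open>
  It suffices to have one element for each of the finitely many leading monomials that are minimal for
  divisibility.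
\<close>

lemma exists_groebner_basis:
  fixes J :: "('x::linorder, 'k::field) mpoly set"
  assumes "finite X" "ideal J (mpoly_ring X)"
  obtains B where "groebner_basis X (lexo X) J B" "finite B" "B \<subseteq> J - {0}"
    "\<And>f. f \<in> J \<Longrightarrow> f \<noteq> 0 \<Longrightarrow> \<exists>g\<in>B. mon_dvd (lm g) (lm f)"
proof -
  have "lm ` (J - {0}) \<subseteq> mons X" using ideal_polysD[OF assms(2)] lm_in_mons by blast
  then obtain T where T: "T \<subseteq> lm ` (J - {0})" "finite T"
      "\<And>s. s \<in> lm ` (J - {0}) \<Longrightarrow> \<exists>t\<in>T. mon_dvd t s"
    using finite_dvd_basis[OF assms(1)] by metis
  obtain B where B: "B \<subseteq> J - {0}" "finite B" "lm ` B = T"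
    using finite_subset_image[OF T(2,1)] by metis
  have dvd: "\<exists>g\<in>B. mon_dvd (lm g) (lm f)" if "f \<in> J" "f \<noteq> 0" for f
  proof -
    have "lm f \<in> lm ` (J - {0})" using that by auto
    from T(3)[OF this] show ?thesis using B(3) by auto
  qed
  have JX: "J \<subseteq> polys X" using ideal_polysD[OF assms(2)] by blast
  have it: "init_term (lexo X) f = Poly_Mapping.single (lm f) (lookup f (lm f))" if "f \<in> J" for f
    using init_term_lexo that JX by blast
  have itX: "init_term (lexo X) ` J \<subseteq> polys X"
  proof (rule image_subsetI)
    fix f assume f: "f \<in> J"
    then show "init_term (lexo X) f \<in> polys X"
      using it[OF f] lm_in_mons[of f X] JX by (cases "f = 0") (auto simp: single_in_polys)
  qed
  have "Idl\<^bsub>mpoly_ring X\<^esub> (init_term (lexo X) ` J) = Idl\<^bsub>mpoly_ring X\<^esub> (init_term (lexo X) ` B)"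
  proof (rule Idl_eqI)
    show BX: "init_term (lexo X) ` B \<subseteq> polys X" using itX B(1) by blast
    have iJ: "ideal (Idl\<^bsub>mpoly_ring X\<^esub> (init_term (lexo X) ` B)) (mpoly_ring X)"
      by (rule ideal_Idl[OF BX])
    show "init_term (lexo X) ` B \<subseteq> Idl\<^bsub>mpoly_ring X\<^esub> (init_term (lexo X) ` J)"
      using Idl_superset[OF itX] B(1) by blast
    show "init_term (lexo X) ` J \<subseteq> Idl\<^bsub>mpoly_ring X\<^esub> (init_term (lexo X) ` B)"
    proof (rule image_subsetI)
      fix f assume f: "f \<in> J"
      show "init_term (lexo X) f \<in> Idl\<^bsub>mpoly_ring X\<^esub> (init_term (lexo X) ` B)"
      proof (cases "f = 0")
        case True
        then show ?thesis using it[OF f] ideal_zero[OF iJ] by simp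
      next
        case False
        then obtain g where g: "g \<in> B" "mon_dvd (lm g) (lm f)" using dvd f by blast
        then have gJ: "g \<in> J" "g \<noteq> 0" using B(1) by auto
        have "init_term (lexo X) f =
            Poly_Mapping.single (lm f - lm g) (lookup f (lm f) / lookup g (lm g)) * init_term (lexo X) g"
          using mon_dvd_add_diff[OF g(2)] lookup_lm[OF gJ(2)]
          by (simp add: it f gJ(1) mult_single add.commute)
        also have "\<dots> \<in> Idl\<^bsub>mpoly_ring X\<^esub> (init_term (lexo X) ` B)"
          using Idl_superset[OF BX] g(1) JX f False
          by (intro ideal_mult_left[OF iJ] single_in_polys diff_in_mons lm_in_mons) auto
        finally show ?thesis .
      qed
    qed
  qed
  then have "groebner_basis X (lexo X) J B"
    using B(1,2) by (simp add: groebner_basis_def init_ideal_def)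
  then show ?thesis using that B(1,2) dvd by blast
qed

section \<open>Leading coefficients with respect to one variable\<close>

abbreviation vcoeff :: "'x \<Rightarrow> nat \<Rightarrow> ('x, 'k::field) mpoly \<Rightarrow> ('x, 'k) mpoly" where
  "vcoeff y d \<equiv> slice {y} (Poly_Mapping.single y d)"

lemma single_in_mons_self [simp]: "Poly_Mapping.single y d \<in> mons {y}"
  by (simp add: mons_def)

lemma mons_singleton: "a \<in> mons {y} \<longleftrightarrow> a = Poly_Mapping.single y (lookup a y)"
proof
  assume "a \<in> mons {y}"
  then show "a = Poly_Mapping.single y (lookup a y)"
    by (intro poly_mapping_eqI) (simp add: mons_lookup lookup_single when_def)
next
  assume "a = Poly_Mapping.single y (lookup a y)"
  then show "a \<in> mons {y}" by (metis single_in_mons_self)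
qed

lemma lookup_vcoeff:
  "lookup (vcoeff y d f) m = (if lookup m y = 0 then lookup f (m + Poly_Mapping.single y d) else 0)"
  by (simp add: lookup_slice in_keys_iff)

lemma monomial_split:
  fixes m :: "'x mon"
  obtains m' where "m = m' + Poly_Mapping.single y (lookup m y)" "lookup m' y = 0"
proof
  show "m = restr (- {y}) m + Poly_Mapping.single y (lookup m y)"
    by (intro poly_mapping_eqI) (simp add: lookup_add lookup_single when_def)
qed simp

lemma vcoeff_eq_zero_iff: "vcoeff y d f = 0 \<longleftrightarrow> (\<forall>m\<in>keys f. lookup m y \<noteq> d)"
proof
  assume 0: "vcoeff y d f = 0"
  show "\<forall>m\<in>keys f. lookup m y \<noteq> d"
  proof (intro ballI notI)
    fix m assume m: "m \<in> keys f" "lookup m y = d"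
    obtain m' where "m = m' + Poly_Mapping.single y (lookup m y)" "lookup m' y = 0"
      by (rule monomial_split)
    then have "lookup (vcoeff y d f) m' = lookup f m" using m(2) by (simp add: lookup_vcoeff)
    then show False using 0 m(1) by (simp add: in_keys_iff)
  qed
next
  assume *: "\<forall>m\<in>keys f. lookup m y \<noteq> d"
  show "vcoeff y d f = 0"
  proof (rule poly_mapping_eqI)
    fix m
    have "lookup m y = 0 \<Longrightarrow> m + Poly_Mapping.single y d \<notin> keys f"
      using * by (auto simp: lookup_add)
    then show "lookup (vcoeff y d f) m = lookup 0 m" by (simp add: lookup_vcoeff in_keys_iff)
  qed
qed

lemma deg_in_ge: "m \<in> keys f \<Longrightarrow> lookup m y \<le> deg_in y f"
  by (simp add: deg_in_def)

lemma vcoeff_above_deg: "deg_in y f < j \<Longrightarrow> vcoeff y j f = 0"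
  unfolding vcoeff_eq_zero_iff by (metis deg_in_ge leD)

lemma top_coeff_eq: "top_coeff y f = vcoeff y (deg_in y f) f"
proof (rule poly_mapping_eqI)
  fix m
  let ?d = "deg_in y f" and ?K = "{u \<in> keys f. lookup u y = deg_in y f}"
  have "u - Poly_Mapping.single y ?d = m \<longleftrightarrow> u = m + Poly_Mapping.single y ?d \<and> lookup m y = 0"
    if "u \<in> ?K" for u
  proof -
    obtain u' where u': "u = u' + Poly_Mapping.single y (lookup u y)" "lookup u' y = 0"
      by (rule monomial_split)
    then have "u = u' + Poly_Mapping.single y ?d" using that by simp
    then show ?thesis using u'(2) by auto
  qed
  then have "lookup (top_coeff y f) m
      = (\<Sum>u\<in>?K. if u = m + Poly_Mapping.single y ?d \<and> lookup m y = 0 then lookup f u else 0)"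
    unfolding top_coeff_def lookup_sum by (intro sum.cong) (auto simp: lookup_single when_def)
  also have "\<dots> = lookup (vcoeff y ?d f) m"
    by (cases "lookup m y = 0") (auto simp: lookup_vcoeff in_keys_iff lookup_add)
  finally show "lookup (top_coeff y f) m = lookup (vcoeff y ?d f) m" .
qed

lemma top_coeff_nonzero: "f \<noteq> 0 \<Longrightarrow> top_coeff y f \<noteq> 0"
proof -
  assume "f \<noteq> 0"
  then have ne: "(\<lambda>m. lookup m y) ` keys f \<noteq> {}" by simp
  have "deg_in y f = Max ((\<lambda>m. lookup m y) ` keys f)"
    unfolding deg_in_def using ne by (subst Max_insert) auto
  then have "deg_in y f \<in> (\<lambda>m. lookup m y) ` keys f" using Max_in[OF _ ne] by simp
  then show ?thesis unfolding top_coeff_eq vcoeff_eq_zero_iff by auto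
qed

lemma deg_in_eqI:
  assumes "vcoeff y d f \<noteq> 0" "\<And>j. j > d \<Longrightarrow> vcoeff y j f = 0"
  shows "deg_in y f = d"
proof -
  have "f \<noteq> 0" using assms(1) by auto
  then have "vcoeff y (deg_in y f) f \<noteq> 0" using top_coeff_nonzero[of f y] by (simp add: top_coeff_eq)
  then have "\<not> deg_in y f > d" using assms(2) by blast
  moreover have "\<not> deg_in y f < d" using vcoeff_above_deg[of y f d] assms(1) by blast
  ultimately show ?thesis by simp
qed

lemma vcoeff_in_polys: "f \<in> polys X \<Longrightarrow> vcoeff y d f \<in> polys (X - {y})"
  by (rule slice_in_polys)

lemma single_eq_zero_iff: "Poly_Mapping.single x c = 0 \<longleftrightarrow> c = 0"
  by (metis lookup_single_eq lookup_zero single_zero)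

lemma vcoeff_outside:
  "f \<in> polys (X - {y}) \<Longrightarrow> vcoeff y d f = (if d = 0 then f else 0)"
  using slice_outside[of f X "{y}" "Poly_Mapping.single y d"] by (simp add: single_eq_zero_iff)

lemma vcoeff_mult_outside:
  "r \<in> polys (X - {y}) \<Longrightarrow> vcoeff y d (r * f) = r * vcoeff y d (f :: ('x, 'k::field) mpoly)"
  by (rule slice_mult_outside) auto

lemma vcoeff_mvar_power_mult:
  "vcoeff y (d + j) (mvar y ^ d * f) = vcoeff y j (f :: ('x, 'k::field) mpoly)"
  using slice_mon_mult[of "Poly_Mapping.single y d" "{y}" "Poly_Mapping.single y j" f]
  by (simp add: mvar_power single_add)

lemma vcoeff_mvar_power_mult_less:
  "j < d \<Longrightarrow> vcoeff y j (mvar y ^ d * f) = (0 :: ('x, 'k::field) mpoly)"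
  using slice_single_mult_inside[of "Poly_Mapping.single y d" "{y}" "Poly_Mapping.single y j" 1 f]
  by (auto simp: mvar_power mon_poly_def mon_dvd_iff lookup_single when_def)

lemma poly_sum_vcoeffs:
  fixes f :: "('x, 'k::field) mpoly"
  shows "f = (\<Sum>d\<le>deg_in y f. mvar y ^ d * vcoeff y d f)"
proof -
  have "f - (\<Sum>d\<le>deg_in y f. mvar y ^ d * vcoeff y d f) = 0"
  proof (rule poly_eq_zero_slices[where Z = "{y}"])
    fix a assume "a \<in> mons {y}"
    then obtain j where a: "a = Poly_Mapping.single y j" by (metis mons_singleton)
    have sum: "slice {y} a (\<Sum>d\<in>A. F d) = (\<Sum>d\<in>A. slice {y} a (F d))"
      for A and F :: "nat \<Rightarrow> ('x, 'k) mpoly"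
      by (induction A rule: infinite_finite_induct) (simp_all add: slice_add)
    have "vcoeff y j (mvar y ^ d * vcoeff y d f) = (if d = j then vcoeff y d f else 0)" for d
    proof (cases "j < d")
      case False
      then obtain k where "j = d + k" using le_Suc_ex not_less by blast
      then show ?thesis
        using vcoeff_outside[OF vcoeff_in_polys[of f UNIV y d], of k]
        by (simp add: vcoeff_mvar_power_mult polys_def mons_def)
    qed (simp add: vcoeff_mvar_power_mult_less)
    then show "slice {y} a (f - (\<Sum>d\<le>deg_in y f. mvar y ^ d * vcoeff y d f)) = 0"
      using vcoeff_above_deg[of y f j] by (simp add: a slice_diff sum[unfolded a])
  qed
  then show ?thesis by simp
qed

text \<open>
  The coefficients of \<open>y ^ d\<close> in the elements of \<open>J\<close> of degree at most \<open>d\<close> in \<open>y\<close>.  These ideals increase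
  with \<open>d\<close>, from the contraction of \<open>J\<close> to the remaining variables, for \<open>d = 0\<close>, to the ideal of all leading
  coefficients, which is their union.
\<close>

definition lead_coeffs :: "'x \<Rightarrow> nat \<Rightarrow> ('x, 'k::field) mpoly set \<Rightarrow> ('x, 'k) mpoly set" where
  "lead_coeffs y d J = {vcoeff y d f | f. f \<in> J \<and> (\<forall>j>d. vcoeff y j f = 0)}"

definition all_lead_coeffs :: "'x \<Rightarrow> ('x, 'k::field) mpoly set \<Rightarrow> ('x, 'k) mpoly set" where
  "all_lead_coeffs y J = (\<Union>d. lead_coeffs y d J)"

context
  fixes X :: "'x set" and y :: 'x and J :: "('x, 'k::field) mpoly set"
  assumes y: "y \<in> X" and J: "ideal J (mpoly_ring X)"
begin

lemma ideal_lead_coeffs: "ideal (lead_coeffs y d J) (mpoly_ring (X - {y}))"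
  unfolding ideal_mpoly_ring_iff
proof (intro conjI ballI)
  show "lead_coeffs y d J \<subseteq> polys (X - {y})"
    using ideal_polysD[OF J] vcoeff_in_polys by (force simp: lead_coeffs_def)
  show "0 \<in> lead_coeffs y d J"
    unfolding lead_coeffs_def using ideal_zero[OF J] slice_zero by force
next
  fix a b assume "a \<in> lead_coeffs y d J" "b \<in> lead_coeffs y d J"
  then obtain f g where "f \<in> J" "\<forall>j>d. vcoeff y j f = 0" "a = vcoeff y d f"
    "g \<in> J" "\<forall>j>d. vcoeff y j g = 0" "b = vcoeff y d g" by (auto simp: lead_coeffs_def)
  then show "a + b \<in> lead_coeffs y d J"
    unfolding lead_coeffs_def using ideal_add[OF J, of f g]
    by (intro CollectI exI[of _ "f + g"]) (simp add: slice_add)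
next
  fix a r :: "('x, 'k) mpoly" assume "a \<in> lead_coeffs y d J" and r: "r \<in> polys (X - {y})"
  then obtain f where f: "f \<in> J" "\<forall>j>d. vcoeff y j f = 0" "a = vcoeff y d f"
    by (auto simp: lead_coeffs_def)
  have "r \<in> polys X" using r by (rule polys_mono[rotated]) auto
  then show "r * a \<in> lead_coeffs y d J"
    unfolding lead_coeffs_def using f ideal_mult_left[OF J, of f r]
    by (intro CollectI exI[of _ "r * f"]) (simp add: vcoeff_mult_outside[OF r])
qed

text \<open>
  Multiplication by \<open>y\<close> raises the degree and keeps the leading coefficient.
\<close>

lemma lead_coeffs_Suc: "lead_coeffs y d J \<subseteq> lead_coeffs y (Suc d) J"
proof
  fix a assume "a \<in> lead_coeffs y d J"
  then obtain f where f: "f \<in> J" "\<forall>j>d. vcoeff y j f = 0" "a = vcoeff y d f"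
    by (auto simp: lead_coeffs_def)
  have 1: "vcoeff y (Suc j) (mvar y * f) = vcoeff y j f" for j
    using vcoeff_mvar_power_mult[of y 1 j f] by simp
  have "vcoeff y j (mvar y * f) = 0" if "j > Suc d" for j
    using that f(2) 1[of "j - 1"] by (cases j) auto
  moreover have "mvar y * f \<in> J" using f(1) y by (intro ideal_mult_left[OF J]) auto
  ultimately show "a \<in> lead_coeffs y (Suc d) J"
    unfolding lead_coeffs_def using 1[of d] f(3) by (intro CollectI exI[of _ "mvar y * f"]) simp
qed

lemma lead_coeffs_mono: "d \<le> d' \<Longrightarrow> lead_coeffs y d J \<subseteq> lead_coeffs y d' J"
  by (rule lift_Suc_mono_le[of "\<lambda>d. lead_coeffs y d J"]) (rule lead_coeffs_Suc)

lemma ideal_all_lead_coeffs: "ideal (all_lead_coeffs y J) (mpoly_ring (X - {y}))"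
  unfolding ideal_mpoly_ring_iff
proof (intro conjI ballI)
  note i = ideal_lead_coeffs
  show "all_lead_coeffs y J \<subseteq> polys (X - {y})"
    using ideal_polysD[OF i] by (auto simp: all_lead_coeffs_def)
  show "0 \<in> all_lead_coeffs y J" using ideal_zero[OF i] by (auto simp: all_lead_coeffs_def)
  fix a assume "a \<in> all_lead_coeffs y J"
  then obtain d where a: "a \<in> lead_coeffs y d J" by (auto simp: all_lead_coeffs_def)
  show "r * a \<in> all_lead_coeffs y J" if "r \<in> polys (X - {y})" for r
    using ideal_mult_left[OF i a that] by (auto simp: all_lead_coeffs_def)
  fix b assume "b \<in> all_lead_coeffs y J"
  then obtain d' where b: "b \<in> lead_coeffs y d' J" by (auto simp: all_lead_coeffs_def)
  have "a \<in> lead_coeffs y (max d d') J" "b \<in> lead_coeffs y (max d d') J"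
    using a b lead_coeffs_mono[of d "max d d'"] lead_coeffs_mono[of d' "max d d'"] by auto
  then show "a + b \<in> all_lead_coeffs y J"
    using ideal_add[OF i] by (auto simp: all_lead_coeffs_def)
qed

lemma lead_coeffs_0: "lead_coeffs y 0 J = J \<inter> polys (X - {y})"
proof (intro Set.set_eqI iffI)
  fix a assume "a \<in> lead_coeffs y 0 J"
  then obtain f where f: "f \<in> J" "\<forall>j>0. vcoeff y j f = 0" "a = vcoeff y 0 f"
    by (auto simp: lead_coeffs_def)
  have fX: "f \<in> polys X" using ideal_polysD[OF J f(1)] .
  have "f \<in> polys (X - {y})"
  proof (rule in_polysI)
    fix m assume m: "m \<in> keys f"
    then have "lookup m y = 0" using f(2) unfolding vcoeff_eq_zero_iff by auto
    then show "m \<in> mons (X - {y})" using in_polysD[OF fX m] by (auto simp: mons_lookup)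
  qed
  then show "a \<in> J \<inter> polys (X - {y})" using f(1,3) vcoeff_outside[of f X y 0] by simp
next
  fix a assume a: "a \<in> J \<inter> polys (X - {y})"
  then have *: "vcoeff y d a = (if d = 0 then a else 0)" for d
    using vcoeff_outside[of a X y d] by simp
  then show "a \<in> lead_coeffs y 0 J"
    unfolding lead_coeffs_def using a *[of 0] by (intro CollectI exI[of _ a]) simp
qed

lemma top_coeff_in_lead_coeffs: "f \<in> J \<Longrightarrow> top_coeff y f \<in> lead_coeffs y (deg_in y f) J"
  using vcoeff_above_deg[of y f] by (auto simp: lead_coeffs_def top_coeff_eq)

end

text \<open>
  Since the exponent of \<open>y\<close> is compared first, the leading monomial is found in the leading coefficient.
\<close>

lemma lm_vcoeff:
  fixes f :: "('x::linorder, 'k::field) mpoly"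
  assumes f: "f \<in> polys X" and y: "\<And>x. x \<in> X \<Longrightarrow> y \<le> x"
    and nz: "vcoeff y d f \<noteq> 0" and top: "\<And>j. j > d \<Longrightarrow> vcoeff y j f = 0"
  shows "lm f = lm (vcoeff y d f) + Poly_Mapping.single y d"
proof (rule lm_eqI)
  let ?m = "lm (vcoeff y d f)"
  have m: "?m \<in> keys (vcoeff y d f)" using nz by (rule lm_in_keys)
  then have m0: "lookup ?m y = 0" "?m + Poly_Mapping.single y d \<in> keys f"
    by (auto simp: in_keys_iff lookup_vcoeff split: if_splits)
  then show "?m + Poly_Mapping.single y d \<in> keys f" by simp
  fix u assume u: "u \<in> keys f"
  then have "lookup u y \<le> d" using top[of "lookup u y"] by (meson vcoeff_eq_zero_iff not_le)
  then consider "lookup u y < d" | "lookup u y = d" by linarith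
  then show "u \<le> ?m + Poly_Mapping.single y d"
  proof cases
    case 1
    then have "u < ?m + Poly_Mapping.single y d"
      using in_polysD[OF f u] in_polysD[OF f m0(2)] y m0(1)
      by (intro lex_less_smallest[of u X _ y]) (auto simp: lookup_add)
    then show ?thesis by simp
  next
    case 2
    obtain u' where u': "u = u' + Poly_Mapping.single y (lookup u y)" "lookup u' y = 0"
      by (rule monomial_split)
    then have "u' \<in> keys (vcoeff y d f)" using u 2 by (simp add: in_keys_iff lookup_vcoeff)
    then have "u' \<le> ?m" by (rule lm_ge)
    then show ?thesis using u'(1) 2 by (metis add_right_mono)
  qed
qed

lemma lm_top_coeff:
  fixes f :: "('x::linorder, 'k::field) mpoly"
  assumes "f \<in> polys X" "\<And>x. x \<in> X \<Longrightarrow> y \<le> x" "f \<noteq> 0"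
  shows "lm f = lm (top_coeff y f) + Poly_Mapping.single y (deg_in y f)"
  unfolding top_coeff_eq
  using assms top_coeff_nonzero[OF assms(3), of y] vcoeff_above_deg[of y f]
  by (intro lm_vcoeff[of f X]) (auto simp: top_coeff_eq)

lemma y_compatible_lexo:
  fixes y :: "'x::linorder"
  assumes y: "y \<in> X" "\<And>x. x \<in> X \<Longrightarrow> y \<le> x"
  shows "y_compatible TYPE('k::field) X y (lexo X)"
  unfolding y_compatible_def
proof
  fix f :: "('x::linorder, 'k) mpoly" assume "f \<in> carrier (mpoly_ring X)"
  then have f: "f \<in> polys X" by simp
  show "init_term (lexo X) f = init_term (lexo X) (init_y y f)"
  proof (cases "f = 0")
    case False
    let ?t = "top_coeff y f" and ?s = "Poly_Mapping.single y (deg_in y f)"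
    have t: "?t \<noteq> 0" "?t \<in> polys X"
      using top_coeff_nonzero[OF False] vcoeff_in_polys[OF f] polys_mono[of "X - {y}" X]
      by (auto simp: top_coeff_eq)
    have i: "init_y y f = Poly_Mapping.single ?s 1 * ?t"
      by (simp add: init_y_def mvar_power mon_poly_def mult.commute)
    have iX: "init_y y f \<in> polys X"
      unfolding i using t(2) y(1) by (intro mult_in_polys single_in_polys single_in_mons)
    have lm: "lm (init_y y f) = ?s + lm ?t" using t(1) unfolding i by (intro lm_single_mult) auto
    then have "lm (init_y y f) = lm f" using lm_top_coeff[OF f y(2) False] by (simp add: add.commute)
    moreover have "lookup (init_y y f) (?s + lm ?t) = lookup ?t (lm ?t)" unfolding i by simp
    moreover have "lookup ?t (lm ?t) = lookup f (lm f)"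
    proof -
      have "lookup (lm ?t) y = 0"
        using lm_in_keys[OF t(1)] by (auto simp: top_coeff_eq in_keys_iff lookup_vcoeff split: if_splits)
      then show ?thesis using lm_top_coeff[OF f y(2) False] by (simp add: top_coeff_eq lookup_vcoeff)
    qed
    ultimately show ?thesis using init_term_lexo[OF f] init_term_lexo[OF iX] lm by simp
  next
    case True
    then show ?thesis by (simp add: init_y_def top_coeff_def)
  qed
qed

section \<open>Square-free initial ideals\<close>

lemma lm_mult:
  fixes f g :: "('x::linorder, 'k::field) mpoly"
  assumes "f \<noteq> 0" "g \<noteq> 0"
  shows "lm (f * g) = lm f + lm g"
proof (rule lm_eqI)
  define t where "t = Poly_Mapping.single (lm f) (lookup f (lm f))"
  have "u < lm f" if "u \<in> keys (f - t)" for u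
  proof -
    have "u \<noteq> lm f" using that by (auto simp: t_def in_keys_iff lookup_minus)
    moreover have "u \<in> keys f" using that \<open>u \<noteq> lm f\<close>
      by (auto simp: t_def in_keys_iff lookup_minus lookup_single when_def)
    ultimately show ?thesis using lm_ge[of u f] by (simp add: le_less)
  qed
  then have "u < lm f + lm g" if "u \<in> keys ((f - t) * g)" for u
    using that keys_mult[of "f - t" g] lm_ge[of _ g] by (auto intro!: add_less_le_mono)
  then have "lm f + lm g \<notin> keys ((f - t) * g)" by blast
  moreover have "lookup (t * g) (lm f + lm g) \<noteq> 0"
    using lookup_single_mult_add[of "lm f" "lookup f (lm f)" g "lm g"] assms
    by (simp add: t_def lookup_lm)
  moreover have "f * g = (f - t) * g + t * g" by (simp add: algebra_simps)
  ultimately show "lm f + lm g \<in> keys (f * g)" by (simp add: in_keys_iff lookup_add)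
  show "u \<le> lm f + lm g" if "u \<in> keys (f * g)" for u
    using that keys_mult[of f g] lm_ge[of _ f] lm_ge[of _ g] by (auto intro!: add_mono)
qed

text \<open>
  Square-freeness of the initial ideal, as a property of leading monomials.  In this form it passes to
  ideals of leading coefficients without any reference to the initial ideals.
\<close>

definition squarefree_lms :: "('x::linorder, 'k::field) mpoly set \<Rightarrow> bool" where
  "squarefree_lms J \<longleftrightarrow> (\<forall>f\<in>J. f \<noteq> 0 \<longrightarrow>
    (\<exists>g\<in>J. g \<noteq> 0 \<and> mon_dvd (lm g) (lm f) \<and> (\<forall>x. lookup (lm g) x \<le> 1)))"

text \<open>
  A square-free monomial that divides the leading monomial of \<open>f * f\<close> divides that of \<open>f\<close>.  So \<open>f\<close> can be
  reduced by an element of \<open>J\<close>, and the difference satisfies the same assumptions.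
\<close>

lemma squarefree_lms_radical:
  fixes J :: "('x::linorder, 'k::field) mpoly set"
  assumes X: "finite X" and J: "ideal J (mpoly_ring X)" and sf: "squarefree_lms J"
    and f: "f \<in> polys X" "f * f \<in> J"
  shows "f \<in> J"
proof -
  have "f \<in> polys X \<Longrightarrow> f * f \<in> J \<Longrightarrow> f \<noteq> 0 \<Longrightarrow> lm f = m \<Longrightarrow> f \<in> J" for f m
  proof (induction m arbitrary: f rule: wf_induct_rule[OF wf_lex[OF X]])
    case (1 m f)
    have "f * f \<noteq> 0" using 1(4) by simp
    then obtain g where g: "g \<in> J" "g \<noteq> 0" "mon_dvd (lm g) (lm (f * f))" "\<And>x. lookup (lm g) x \<le> 1"
      using sf 1(3) unfolding squarefree_lms_def by meson
    have "lookup (lm g) x \<le> lookup (lm f) x" for x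
    proof -
      have "lookup (lm g) x \<le> lookup (lm f) x + lookup (lm f) x"
        using g(3) 1(4) by (simp add: mon_dvd_iff lm_mult lookup_add)
      then show ?thesis using g(4)[of x] by linarith
    qed
    then have dvd: "mon_dvd (lm g) (lm f)" by (simp add: mon_dvd_iff)
    define p where "p = Poly_Mapping.single (lm f - lm g) (lookup f (lm f) / lookup g (lm g))"
    define h where "h = f - p * g"
    have p: "p \<in> polys X" unfolding p_def using 1(2,4) by (intro single_in_polys diff_in_mons lm_in_mons)
    have gX: "g \<in> polys X" using g(1) by (rule ideal_polysD[OF J])
    have hX: "h \<in> polys X" unfolding h_def using 1(2) p gX by (intro polys_closed)
    have "h * h = f * f - (2 * f * p - p * p * g) * g" by (simp add: h_def algebra_simps)
    moreover have "(2 * f * p - p * p * g) * g \<in> J"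
    proof (rule ideal_mult_left[OF J g(1)])
      have "2 * f * p = f * p + f * p" by (simp add: algebra_simps)
      show "2 * f * p - p * p * g \<in> polys X"
        unfolding \<open>2 * f * p = _\<close> using 1(2) p gX by (intro polys_closed)
    qed
    ultimately have hh: "h * h \<in> J" using 1(3) ideal_diff[OF J] by simp
    have "h \<in> J"
    proof (cases "h = 0")
      case False
      have "h = 0 \<or> lm h < lm f"
        unfolding h_def p_def by (rule reduction_step) (use 1 g dvd in auto)
      then have "lm h < m" using False 1(5) by simp
      moreover have "lm h \<in> mons X" "m \<in> mons X" using lm_in_mons hX False 1(2,4,5) by blast+
      ultimately show ?thesis using 1(1)[of "lm h" h] hX hh False by simp
    qed (simp add: ideal_zero[OF J])
    moreover have "f = h + p * g" by (simp add: h_def)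
    ultimately show ?case using ideal_add[OF J] ideal_mult_left[OF J g(1) p] by simp
  qed
  then show ?thesis using f ideal_zero[OF J] by blast
qed

lemma Idl_Idl:
  fixes S :: "('x, 'k::field) mpoly set"
  assumes "S \<subseteq> polys X'" "X' \<subseteq> X"
  shows "Idl\<^bsub>mpoly_ring X\<^esub> (Idl\<^bsub>mpoly_ring X'\<^esub> S) = Idl\<^bsub>mpoly_ring X\<^esub> S"
proof (rule Idl_eqI)
  have SX: "S \<subseteq> polys X" using assms polys_mono[of X' X] by blast
  then show "S \<subseteq> polys X" .
  note i = ideal_Idl[OF SX]
  have "ideal (Idl\<^bsub>mpoly_ring X\<^esub> S \<inter> polys X') (mpoly_ring X')"
    unfolding ideal_mpoly_ring_iff
    by (auto simp: polys_closed ideal_zero[OF i] ideal_add[OF i]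
        intro: ideal_mult_left[OF i] polys_mono[OF assms(2)])
  then show "Idl\<^bsub>mpoly_ring X'\<^esub> S \<subseteq> Idl\<^bsub>mpoly_ring X\<^esub> S"
    using Idl_least[of _ X' S] Idl_superset[OF SX] assms(1) by blast
  then have "Idl\<^bsub>mpoly_ring X'\<^esub> S \<subseteq> polys X" using ideal_polysD[OF i] by blast
  then show "S \<subseteq> Idl\<^bsub>mpoly_ring X\<^esub> (Idl\<^bsub>mpoly_ring X'\<^esub> S)"
    using Idl_superset[of "Idl\<^bsub>mpoly_ring X'\<^esub> S" X] Idl_superset[OF assms(1)] by blast
qed

section \<open>One step of a geometric vertex decomposition\<close>

context
  fixes X :: "'x::linorder set" and y :: 'x and J :: "('x, 'k::field) mpoly set"
  assumes X: "finite X" and y: "y \<in> X" "\<And>x. x \<in> X \<Longrightarrow> y \<le> x"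
    and J: "ideal J (mpoly_ring X)"
begin

lemma lead_coeffs_lm:
  assumes "c \<in> lead_coeffs y d J" "c \<noteq> 0"
  obtains f where "f \<in> J" "f \<noteq> 0" "lm f = lm c + Poly_Mapping.single y d" "lookup (lm c) y = 0"
proof -
  obtain f where f: "f \<in> J" "\<forall>j>d. vcoeff y j f = 0" "c = vcoeff y d f"
    using assms(1) by (auto simp: lead_coeffs_def)
  have fX: "f \<in> polys X" using f(1) by (rule ideal_polysD[OF J])
  have "lm f = lm c + Poly_Mapping.single y d"
    unfolding f(3) using f assms(2) y(2) by (intro lm_vcoeff[OF fX]) auto
  moreover have "f \<noteq> 0" using assms(2) f(3) by auto
  moreover have "lookup (lm c) y = 0"
    using lm_in_keys[OF assms(2)] by (auto simp: f(3) in_keys_iff lookup_vcoeff split: if_splits)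
  ultimately show ?thesis using that f(1) by blast
qed

lemma lm_top_coeff_dvd:
  assumes "g \<in> J" "g \<noteq> 0" "mon_dvd (lm g) (u + Poly_Mapping.single y d)" "lookup u y = 0"
  shows "mon_dvd (lm (top_coeff y g)) u" "deg_in y g \<le> d"
    "\<forall>x. lookup (lm (top_coeff y g)) x \<le> lookup (lm g) x" "deg_in y g \<le> lookup (lm g) y"
proof -
  have gX: "g \<in> polys X" using assms(1) by (rule ideal_polysD[OF J])
  have lm: "lm g = lm (top_coeff y g) + Poly_Mapping.single y (deg_in y g)"
    by (rule lm_top_coeff[OF gX y(2) assms(2)])
  have 0: "lookup (lm (top_coeff y g)) y = 0"
    using lm_in_keys[OF top_coeff_nonzero[OF assms(2), of y]]
    by (auto simp: top_coeff_eq in_keys_iff lookup_vcoeff split: if_splits)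
  have le: "lookup (lm (top_coeff y g)) x + (deg_in y g when y = x) \<le> lookup u x + (d when y = x)" for x
    using assms(3) by (simp add: lm mon_dvd_iff lookup_add lookup_single)
  show "deg_in y g \<le> d" using le[of y] assms(4) 0 by simp
  have "lookup (lm (top_coeff y g)) x \<le> lookup u x" for x
    using le[of x] 0 by (cases "x = y") (auto simp: when_def)
  then show "mon_dvd (lm (top_coeff y g)) u" by (simp add: mon_dvd_iff)
  show "\<forall>x. lookup (lm (top_coeff y g)) x \<le> lookup (lm g) x" "deg_in y g \<le> lookup (lm g) y"
    using lm by (simp_all add: lookup_add)
qed

text \<open>
  This is where square-freeness enters: an element of \<open>J\<close> whose leading monomial is square-free has
  degree at most one in \<open>y\<close>, so that leading coefficients of degree one suffice.
\<close>

lemma squarefree_lead_coeff: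
  assumes "squarefree_lms J" "c \<in> lead_coeffs y d J" "c \<noteq> 0"
  obtains t where "t \<in> lead_coeffs y (min d 1) J" "t \<noteq> 0" "mon_dvd (lm t) (lm c)"
    "\<forall>x. lookup (lm t) x \<le> 1"
proof -
  obtain f where f: "f \<in> J" "f \<noteq> 0" "lm f = lm c + Poly_Mapping.single y d" "lookup (lm c) y = 0"
    using lead_coeffs_lm[OF assms(2,3)] .
  obtain g where g: "g \<in> J" "g \<noteq> 0" "mon_dvd (lm g) (lm f)" "\<And>x. lookup (lm g) x \<le> 1"
    using assms(1) f(1,2) unfolding squarefree_lms_def by meson
  note d = lm_top_coeff_dvd[OF g(1,2) g(3)[unfolded f(3)] f(4)]
  have "deg_in y g \<le> min d 1" using d(2,4) g(4)[of y] by linarith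
  then have "top_coeff y g \<in> lead_coeffs y (min d 1) J"
    using top_coeff_in_lead_coeffs[OF y(1) J g(1)] lead_coeffs_mono[OF y(1) J] by blast
  moreover have "\<forall>x. lookup (lm (top_coeff y g)) x \<le> 1" using d(3) g(4) order_trans by blast
  ultimately show ?thesis using that d(1) top_coeff_nonzero[OF g(2)] by blast
qed

lemma squarefree_lms_lead_coeffs_0:
  assumes "squarefree_lms J"
  shows "squarefree_lms (lead_coeffs y 0 J)"
  unfolding squarefree_lms_def
proof (intro ballI impI)
  fix c assume "c \<in> lead_coeffs y 0 J" "c \<noteq> 0"
  from squarefree_lead_coeff[OF assms this] obtain t where "t \<in> lead_coeffs y 0 J" "t \<noteq> 0"
    "mon_dvd (lm t) (lm c)" "\<forall>x. lookup (lm t) x \<le> 1" unfolding min_0L .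
  then show "\<exists>g\<in>lead_coeffs y 0 J. g \<noteq> 0 \<and> mon_dvd (lm g) (lm c) \<and> (\<forall>x. lookup (lm g) x \<le> 1)"
    by blast
qed

lemma squarefree_lms_all_lead_coeffs:
  assumes "squarefree_lms J"
  shows "squarefree_lms (all_lead_coeffs y J)"
  unfolding squarefree_lms_def
proof (intro ballI impI)
  fix c assume "c \<in> all_lead_coeffs y J" and c0: "c \<noteq> 0"
  then obtain d where "c \<in> lead_coeffs y d J" by (auto simp: all_lead_coeffs_def)
  from squarefree_lead_coeff[OF assms this c0] obtain t where "t \<in> lead_coeffs y (min d 1) J" "t \<noteq> 0"
    "mon_dvd (lm t) (lm c)" "\<forall>x. lookup (lm t) x \<le> 1" .
  then show "\<exists>g\<in>all_lead_coeffs y J. g \<noteq> 0 \<and> mon_dvd (lm g) (lm c) \<and> (\<forall>x. lookup (lm g) x \<le> 1)"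
    unfolding all_lead_coeffs_def by blast
qed

lemma all_lead_coeffs_eq_lead_coeffs_1:
  assumes "squarefree_lms J"
  shows "all_lead_coeffs y J = lead_coeffs y 1 J"
proof -
  have "Idl\<^bsub>mpoly_ring (X - {y})\<^esub> (lead_coeffs y 1 J) = all_lead_coeffs y J"
  proof (rule ideal_generated_by_leading)
    show "finite (X - {y})" using X by simp
    show "ideal (all_lead_coeffs y J) (mpoly_ring (X - {y}))"
      by (rule ideal_all_lead_coeffs[OF y(1) J])
    show "lead_coeffs y 1 J \<subseteq> all_lead_coeffs y J" by (auto simp: all_lead_coeffs_def)
    fix c assume "c \<in> all_lead_coeffs y J" and c0: "c \<noteq> 0"
    then obtain d where "c \<in> lead_coeffs y d J" by (auto simp: all_lead_coeffs_def)
    from squarefree_lead_coeff[OF assms this c0] obtain t where "t \<in> lead_coeffs y (min d 1) J" "t \<noteq> 0"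
      "mon_dvd (lm t) (lm c)" "\<forall>x. lookup (lm t) x \<le> 1" .
    moreover have "lead_coeffs y (min d 1) J \<subseteq> lead_coeffs y 1 J"
      by (rule lead_coeffs_mono[OF y(1) J]) simp
    ultimately show "\<exists>g\<in>lead_coeffs y 1 J. g \<noteq> 0 \<and> mon_dvd (lm g) (lm c)" by blast
  qed
  then show ?thesis using Idl_ideal_id[OF ideal_lead_coeffs[OF y(1) J]] by metis
qed

context
  fixes B
  assumes B: "B \<subseteq> J - {0}" "\<And>f. f \<in> J \<Longrightarrow> f \<noteq> 0 \<Longrightarrow> \<exists>g\<in>B. mon_dvd (lm g) (lm f)"
begin

text \<open>
  The leading monomial of a leading coefficient is the leading monomial of the element, with \<open>y\<close> removed.
  Divisibility of leading monomials by those of \<open>B\<close> is therefore inherited by the leading coefficients.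
\<close>

lemma C_ideal_eq: "C_ideal X y B = Idl\<^bsub>mpoly_ring X\<^esub> (all_lead_coeffs y J)"
proof -
  have sub: "top_coeff y ` B \<subseteq> all_lead_coeffs y J"
    using top_coeff_in_lead_coeffs[OF y(1) J] B(1) by (auto simp: all_lead_coeffs_def)
  have "Idl\<^bsub>mpoly_ring (X - {y})\<^esub> (top_coeff y ` B) = all_lead_coeffs y J"
  proof (rule ideal_generated_by_leading[OF _ ideal_all_lead_coeffs[OF y(1) J] sub])
    show "finite (X - {y})" using X by simp
    fix c assume "c \<in> all_lead_coeffs y J" and c0: "c \<noteq> 0"
    then obtain d where c: "c \<in> lead_coeffs y d J" by (auto simp: all_lead_coeffs_def)
    obtain f where f: "f \<in> J" "f \<noteq> 0" "lm f = lm c + Poly_Mapping.single y d" "lookup (lm c) y = 0"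
      using lead_coeffs_lm[OF c c0] .
    obtain g where g: "g \<in> B" "mon_dvd (lm g) (lm f)" using B(2) f(1,2) by blast
    then have g0: "g \<in> J" "g \<noteq> 0" using B(1) by auto
    show "\<exists>g\<in>top_coeff y ` B. g \<noteq> 0 \<and> mon_dvd (lm g) (lm c)"
      using lm_top_coeff_dvd(1)[OF g0 g(2)[unfolded f(3)] f(4)] top_coeff_nonzero[OF g0(2)] g(1)
      by blast
  qed
  moreover have "top_coeff y ` B \<subseteq> polys (X - {y})"
    using sub ideal_polysD[OF ideal_all_lead_coeffs[OF y(1) J]] by blast
  ultimately show ?thesis
    unfolding C_ideal_def using Idl_Idl[of "top_coeff y ` B" "X - {y}" X] by auto
qed

text \<open>
  A leading monomial without \<open>y\<close> can only be divisible by that of an element of degree \<open>0\<close> in \<open>y\<close>.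
\<close>

lemma N_ideal_eq: "N_ideal X y B = Idl\<^bsub>mpoly_ring X\<^esub> (lead_coeffs y 0 J)"
proof -
  let ?B = "{g \<in> B. deg_in y g = 0}"
  have sub: "top_coeff y ` ?B \<subseteq> lead_coeffs y 0 J"
    using top_coeff_in_lead_coeffs[OF y(1) J] B(1) by force
  have "Idl\<^bsub>mpoly_ring (X - {y})\<^esub> (top_coeff y ` ?B) = lead_coeffs y 0 J"
  proof (rule ideal_generated_by_leading[OF _ ideal_lead_coeffs[OF y(1) J] sub])
    show "finite (X - {y})" using X by simp
    fix c assume c: "c \<in> lead_coeffs y 0 J" "c \<noteq> 0"
    obtain f where f: "f \<in> J" "f \<noteq> 0" "lm f = lm c + Poly_Mapping.single y 0" "lookup (lm c) y = 0"
      using lead_coeffs_lm[OF c] .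
    obtain g where g: "g \<in> B" "mon_dvd (lm g) (lm f)" using B(2) f(1,2) by blast
    then have g0: "g \<in> J" "g \<noteq> 0" using B(1) by auto
    show "\<exists>g\<in>top_coeff y ` ?B. g \<noteq> 0 \<and> mon_dvd (lm g) (lm c)"
      using lm_top_coeff_dvd(1,2)[OF g0 g(2)[unfolded f(3)] f(4)] top_coeff_nonzero[OF g0(2)] g(1)
      by blast
  qed
  moreover have "top_coeff y ` ?B \<subseteq> polys (X - {y})"
    using sub ideal_polysD[OF ideal_lead_coeffs[OF y(1) J]] by blast
  ultimately show ?thesis
    unfolding N_ideal_def using Idl_Idl[of "top_coeff y ` ?B" "X - {y}" X] by auto
qed

end

lemma vcoeff_0_Idl_mvar:
  assumes "f \<in> Idl\<^bsub>mpoly_ring X\<^esub> {mvar y :: ('x, 'k) mpoly}"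
  shows "vcoeff y 0 f = 0"
proof -
  let ?I = "{f \<in> polys X. \<forall>m\<in>keys f. lookup m y \<noteq> 0} :: ('x, 'k) mpoly set"
  have "ideal ?I (mpoly_ring X)"
  proof (rule ideal_mpoly_ringI)
    fix a b assume "a \<in> ?I" "b \<in> ?I"
    then show "a + b \<in> ?I" using keys_add[of a b] by (auto simp: add_in_polys)
  next
    fix a m and c :: 'k assume "a \<in> ?I" "m \<in> mons X"
    then show "Poly_Mapping.single m c * a \<in> ?I"
      by (cases "c = 0") (auto simp: keys_single_mult lookup_add mult_in_polys single_in_polys)
  qed auto
  then have "f \<in> ?I" using assms y(1)
    by (elim Idl_least[THEN subsetD, rotated 2]) (auto simp: mvar_def mon_poly_def single_in_polys single_in_mons)
  then show ?thesis unfolding vcoeff_eq_zero_iff by blast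
qed

text \<open>
  Both sides are graded by the degree in \<open>y\<close>.  In degree \<open>0\<close> both have the coefficients \<open>lead_coeffs y 0 J\<close>.
  In degree \<open>d > 0\<close> the coefficients are \<open>lead_coeffs y d J\<close> on the left and all leading coefficients on the
  right, and these agree with \<open>lead_coeffs y 1 J\<close>.
\<close>

lemma init_y_ideal_eq:
  assumes "squarefree_lms J"
  shows "init_y_ideal X y J = Idl\<^bsub>mpoly_ring X\<^esub> (all_lead_coeffs y J) \<inter>
    (Idl\<^bsub>mpoly_ring X\<^esub> (lead_coeffs y 0 J) <+>\<^bsub>mpoly_ring X\<^esub> Idl\<^bsub>mpoly_ring X\<^esub> {mvar y})"
    (is "_ = ?C \<inter> (?N <+>\<^bsub>_\<^esub> ?Y)")
proof
  have XX: "X - {y} \<subseteq> X" "{y} \<subseteq> X" using y(1) by auto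
  note iC0 = ideal_all_lead_coeffs[OF y(1) J] and iN0 = ideal_lead_coeffs[OF y(1) J, of 0]
  have CX: "all_lead_coeffs y J \<subseteq> polys X" and NX: "lead_coeffs y 0 J \<subseteq> polys X"
    using ideal_polysD[OF iC0] ideal_polysD[OF iN0] polys_mono[OF XX(1)] by blast+
  note iC = ideal_Idl[OF CX] and iN = ideal_Idl[OF NX]
  have vX: "mvar y \<in> polys X" using y(1) by simp
  have YX: "{mvar y} \<subseteq> (polys X :: ('x, 'k) mpoly set)" using y(1) by simp
  note iY = ideal_Idl[OF YX]
  have iNY: "ideal (?N <+>\<^bsub>mpoly_ring X\<^esub> ?Y) (mpoly_ring X)"
    by (rule ring.add_ideals[OF ring_mpoly_ring iN iY])
  have init_in: "init_y y f \<in> ?C \<inter> (?N <+>\<^bsub>mpoly_ring X\<^esub> ?Y)" if f: "f \<in> J" for f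
  proof
    let ?t = "top_coeff y f"
    have t: "?t \<in> lead_coeffs y (deg_in y f) J" by (rule top_coeff_in_lead_coeffs[OF y(1) J f])
    then have tC: "?t \<in> ?C" using Idl_superset[OF CX] by (auto simp: all_lead_coeffs_def)
    then show "init_y y f \<in> ?C" unfolding init_y_def
      by (intro ideal_mult_right[OF iC] power_in_polys vX)
    show "init_y y f \<in> ?N <+>\<^bsub>mpoly_ring X\<^esub> ?Y"
    proof (cases "deg_in y f")
      case 0
      then have "init_y y f \<in> ?N" using t Idl_superset[OF NX] by (auto simp: init_y_def)
      then show ?thesis using ideal_zero[OF iY] by (force simp: set_add_mpoly)
    next
      case (Suc d)
      have "init_y y f = ?t * mvar y ^ d * mvar y" by (simp add: init_y_def Suc mult.assoc mult.commute)
      also have "\<dots> \<in> ?Y"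
        using Idl_superset[OF YX] ideal_polysD[OF iC tC] vX
        by (intro ideal_mult_left[OF iY] mult_in_polys power_in_polys) auto
      finally have "init_y y f \<in> ?Y" .
      then show ?thesis using ideal_zero[OF iN] by (force simp: set_add_mpoly)
    qed
  qed
  then have "init_y y ` (J - {0}) \<subseteq> ?C \<inter> (?N <+>\<^bsub>mpoly_ring X\<^esub> ?Y)" by auto
  moreover have "ideal (?C \<inter> (?N <+>\<^bsub>mpoly_ring X\<^esub> ?Y)) (mpoly_ring X)"
    by (rule ring.i_intersect[OF ring_mpoly_ring iC iNY])
  ultimately show "init_y_ideal X y J \<subseteq> ?C \<inter> (?N <+>\<^bsub>mpoly_ring X\<^esub> ?Y)"
    unfolding init_y_ideal_def by (intro Idl_least)
  have inX: "init_y y ` (J - {0}) \<subseteq> polys X" using init_in ideal_polysD[OF iC] by blast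
  note iI = ideal_Idl[OF inX]
  show "?C \<inter> (?N <+>\<^bsub>mpoly_ring X\<^esub> ?Y) \<subseteq> init_y_ideal X y J"
  proof
    fix f assume f: "f \<in> ?C \<inter> (?N <+>\<^bsub>mpoly_ring X\<^esub> ?Y)"
    then obtain a b where ab: "f = a + b" "a \<in> ?N" "b \<in> ?Y" by (auto simp: set_add_mpoly)
    have N0: "vcoeff y 0 f \<in> lead_coeffs y 0 J"
    proof -
      have "vcoeff y 0 f = vcoeff y 0 a" unfolding ab(1) slice_add vcoeff_0_Idl_mvar[OF ab(3)] by simp
      then show ?thesis using ab(2) in_Idl_iff_slices[OF iN0 XX(2)] by simp
    qed
    have C1: "vcoeff y d f \<in> lead_coeffs y 1 J" for d
      using f in_Idl_iff_slices[OF iC0 XX(2)] all_lead_coeffs_eq_lead_coeffs_1[OF assms]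
      by (metis IntD1 single_in_mons_self)
    have gen: "init_y y g \<in> init_y_ideal X y J" if "g \<in> J" "g \<noteq> 0" for g
      unfolding init_y_ideal_def using Idl_superset[OF inX] that by blast
    have "mvar y ^ d * vcoeff y d f \<in> init_y_ideal X y J" for d
    proof (cases "vcoeff y d f = 0")
      case True
      then show ?thesis using ideal_zero[OF iI] by (simp add: init_y_ideal_def)
    next
      case nz: False
      show ?thesis
      proof (cases d)
        case 0
        obtain g where g: "g \<in> J" "\<forall>j>0. vcoeff y j g = 0" "vcoeff y 0 f = vcoeff y 0 g"
          using N0 by (auto simp: lead_coeffs_def)
        have "deg_in y g = 0" using g nz 0 by (intro deg_in_eqI) auto
        then have "init_y y g = vcoeff y 0 f" using g(3) by (simp add: init_y_def top_coeff_eq)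
        moreover have "g \<noteq> 0" using nz 0 g(3) by auto
        ultimately show ?thesis using gen[OF g(1)] 0 by simp
      next
        case (Suc e)
        obtain g where g: "g \<in> J" "\<forall>j>1. vcoeff y j g = 0" "vcoeff y d f = vcoeff y 1 g"
          using C1[of d] by (auto simp: lead_coeffs_def)
        have "deg_in y g = 1" using g nz by (intro deg_in_eqI) auto
        then have "init_y y g = vcoeff y d f * mvar y" by (simp add: init_y_def top_coeff_eq g(3))
        then have "mvar y ^ d * vcoeff y d f = mvar y ^ e * init_y y g"
          by (simp add: Suc algebra_simps)
        moreover have "g \<noteq> 0" using nz g(3) by auto
        ultimately show ?thesis using gen[OF g(1)] vX ideal_mult_left[OF iI]
          by (simp add: init_y_ideal_def power_in_polys)
      qed
    qed
    then have "(\<Sum>d\<le>deg_in y f. mvar y ^ d * vcoeff y d f) \<in> init_y_ideal X y J"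
      unfolding init_y_ideal_def by (intro ideal_sum[OF iI])
    then show "f \<in> init_y_ideal X y J" using poly_sum_vcoeffs[of f y] by simp
  qed
qed

lemma gvd_step:
  assumes "unmixed (mpoly_ring X) J" "squarefree_lms J"
    "gvd (X - {y}) (all_lead_coeffs y J)" "gvd (X - {y}) (lead_coeffs y 0 J)"
  shows "gvd X J"
proof -
  obtain B where B: "groebner_basis X (lexo X) J B" "finite B" "B \<subseteq> J - {0}"
    "\<And>f. f \<in> J \<Longrightarrow> f \<noteq> 0 \<Longrightarrow> \<exists>g\<in>B. mon_dvd (lm g) (lm f)"
    using exists_groebner_basis[OF X J] by metis
  have C: "C_ideal X y B = Idl\<^bsub>mpoly_ring X\<^esub> (all_lead_coeffs y J)"
    by (rule C_ideal_eq[OF B(3)]) (rule B(4))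
  have N: "N_ideal X y B = Idl\<^bsub>mpoly_ring X\<^esub> (lead_coeffs y 0 J)"
    by (rule N_ideal_eq[OF B(3)]) (rule B(4))
  have y': "{y} \<subseteq> X" using y(1) by simp
  have CN: "C_ideal X y B \<inter> carrier (mpoly_ring (X - {y})) = all_lead_coeffs y J"
    "N_ideal X y B \<inter> carrier (mpoly_ring (X - {y})) = lead_coeffs y 0 J"
    using Idl_contraction[OF ideal_all_lead_coeffs[OF y(1) J] y']
      Idl_contraction[OF ideal_lead_coeffs[OF y(1) J] y'] by (simp_all add: C N)
  show ?thesis
  proof (rule gvd.decomp[OF J assms(1) y(1) monomial_order_lexo[OF X] y_compatible_lexo[OF y] B(1)])
    show "init_y_ideal X y J = C_ideal X y B \<inter>
        (N_ideal X y B <+>\<^bsub>mpoly_ring X\<^esub> Idl\<^bsub>mpoly_ring X\<^esub> {mvar y})"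
      unfolding C N by (rule init_y_ideal_eq[OF assms(2)])
  qed (use assms(3,4) CN in simp_all)
qed

end

section \<open>Krull dimension of a quotient and chains of primes\<close>

context
  fixes R (structure) and I
  assumes R: "cring R" and I: "ideal I R"
begin

lemma prime_of_quotient:
  assumes "primeideal Q (R Quot I)"
  shows "primeideal (\<Union>Q) R" "I \<subseteq> \<Union>Q" "(+>) I ` (\<Union>Q) = Q"
proof -
  interpret R: cring R by (rule R)
  interpret h: ring_hom_ring R "R Quot I" "(+>) I" by (rule ideal.rcos_ring_hom_ring[OF I])
  interpret Q: primeideal Q "R Quot I" by (rule assms)
  have Qc: "Q \<subseteq> carrier (R Quot I)" using Q.a_subset .
  have iU: "ideal (\<Union>Q) R" by (rule R.quot_ideal_imp_ring_ideal[OF I Q.is_ideal])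
  have Uc: "\<Union>Q \<subseteq> carrier R" by (rule R.canonical_proj_vimage_in_carrier[OF I Qc])
  note mem = R.canonical_proj_vimage_mem_iff[OF I Qc]
  show "primeideal (\<Union>Q) R"
  proof (rule primeidealI[OF iU R])
    show "carrier R \<noteq> \<Union>Q"
    proof
      assume "carrier R = \<Union>Q"
      then have "I +> \<one> \<in> Q" using mem[of \<one>] R.one_closed by blast
      then have "\<one>\<^bsub>R Quot I\<^esub> \<in> Q" using h.hom_one by simp
      then show False using Q.one_imp_carrier Q.I_notcarr by auto
    qed
    fix a b assume ab: "a \<in> carrier R" "b \<in> carrier R" "a \<otimes> b \<in> \<Union>Q"
    then have "(I +> a) \<otimes>\<^bsub>R Quot I\<^esub> (I +> b) \<in> Q"
      using mem[of "a \<otimes> b"] R.m_closed h.hom_mult by simp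
    then have "I +> a \<in> Q \<or> I +> b \<in> Q"
      using Q.I_prime ab(1,2) h.hom_closed by blast
    then show "a \<in> \<Union>Q \<or> b \<in> \<Union>Q" using mem ab(1,2) by blast
  qed
  have ideal_zero_closed: "\<zero> \<in> I"
    using additive_subgroup.zero_closed[OF ideal.axioms(1)[OF I]] .
  show "I \<subseteq> \<Union>Q"
  proof
    fix a assume a: "a \<in> I"
    then have ac: "a \<in> carrier R" using ideal.Icarr[OF I] by blast
    have "I +> a = I +> \<zero>"
      using R.a_rcos_zero[OF I a] R.a_rcos_zero[OF I ideal_zero_closed] by (rule trans[OF _ sym])
    also have "I +> \<zero> = \<zero>\<^bsub>R Quot I\<^esub>" by (rule h.hom_zero)
    also have "\<dots> \<in> Q" using additive_subgroup.zero_closed[OF Q.additive_subgroup_axioms] .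
    finally show "a \<in> \<Union>Q" using mem[OF ac] by blast
  qed
  show "(+>) I ` (\<Union>Q) = Q"
  proof
    show "(+>) I ` (\<Union>Q) \<subseteq> Q" using mem Uc by blast
    show "Q \<subseteq> (+>) I ` (\<Union>Q)"
    proof
      fix q assume q: "q \<in> Q"
      then obtain r where r: "r \<in> carrier R" "q = I +> r"
        using Qc unfolding FactRing_def A_RCOSETS_def' by auto
      then show "q \<in> (+>) I ` (\<Union>Q)" using mem[OF r(1)] q by blast
    qed
  qed
qed

lemma prime_to_quotient:
  assumes P: "primeideal P R" and IP: "I \<subseteq> P"
  shows "primeideal ((+>) I ` P) (R Quot I)" "\<Union>((+>) I ` P) = P"
proof -
  interpret R: cring R by (rule R)
  interpret P: primeideal P R by (rule P)
  interpret h: ring_hom_ring R "R Quot I" "(+>) I" by (rule ideal.rcos_ring_hom_ring[OF I])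
  show U: "\<Union>((+>) I ` P) = P" using R.ideal_incl_iff[OF I P.is_ideal] IP by auto
  have iQ: "ideal ((+>) I ` P) (R Quot I)"
    by (rule R.ring_ideal_imp_quot_ideal[OF I P.is_ideal])
  have Qc: "(+>) I ` P \<subseteq> carrier (R Quot I)" using P.a_subset h.hom_closed by blast
  have mem: "a \<in> P \<longleftrightarrow> I +> a \<in> (+>) I ` P" if "a \<in> carrier R" for a
    using R.canonical_proj_vimage_mem_iff[OF I Qc that] U by simp
  show "primeideal ((+>) I ` P) (R Quot I)"
  proof (rule primeidealI[OF iQ ideal.quotient_is_cring[OF I R]])
    show "carrier (R Quot I) \<noteq> (+>) I ` P"
    proof
      assume "carrier (R Quot I) = (+>) I ` P"
      then have "I +> a \<in> (+>) I ` P" if "a \<in> carrier R" for a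
        using h.hom_closed[OF that] by simp
      then have "carrier R \<subseteq> P" using mem by (intro subsetI) simp
      then show False using P.I_notcarr P.a_subset by auto
    qed
    fix a b assume ab: "a \<in> carrier (R Quot I)" "b \<in> carrier (R Quot I)"
      "a \<otimes>\<^bsub>R Quot I\<^esub> b \<in> (+>) I ` P"
    obtain r s where r: "r \<in> carrier R" "a = I +> r" and s: "s \<in> carrier R" "b = I +> s"
      using ab(1,2) unfolding FactRing_def A_RCOSETS_def' by auto
    then have "I +> (r \<otimes> s) \<in> (+>) I ` P" using ab(3) h.hom_mult by simp
    then have "r \<otimes> s \<in> P" using mem r s by simp
    then have "r \<in> P \<or> s \<in> P" using P.I_prime r s by blast
    then show "a \<in> (+>) I ` P \<or> b \<in> (+>) I ` P" using r s by blast
  qed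
qed

lemma krull_dim_quotient:
  "krull_dim (R Quot I) = Sup {enat d | d. \<exists>P :: nat \<Rightarrow> _ set.
     (\<forall>i\<le>d. primeideal (P i) R \<and> I \<subseteq> P i) \<and> (\<forall>i<d. P i \<subset> P (Suc i))}"
proof -
  have "(\<exists>P :: nat \<Rightarrow> _ set. (\<forall>i\<le>d. primeideal (P i) (R Quot I)) \<and> (\<forall>i<d. P i \<subset> P (Suc i)))
    \<longleftrightarrow> (\<exists>P :: nat \<Rightarrow> _ set. (\<forall>i\<le>d. primeideal (P i) R \<and> I \<subseteq> P i) \<and> (\<forall>i<d. P i \<subset> P (Suc i)))"
    (is "?A \<longleftrightarrow> ?B") for d
  proof
    assume ?A
    then obtain Q :: "nat \<Rightarrow> _ set" where Q: "\<And>i. i \<le> d \<Longrightarrow> primeideal (Q i) (R Quot I)"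
      "\<And>i. i < d \<Longrightarrow> Q i \<subset> Q (Suc i)" by blast
    have "\<Union>(Q i) \<subset> \<Union>(Q (Suc i))" if "i < d" for i
    proof -
      have "(+>) I ` \<Union>(Q i) = Q i" "(+>) I ` \<Union>(Q (Suc i)) = Q (Suc i)"
        using prime_of_quotient(3) Q(1) that by auto
      then have "\<Union>(Q i) \<noteq> \<Union>(Q (Suc i))" using Q(2)[OF that] by (metis psubset_eq)
      then show ?thesis using Union_mono[of "Q i" "Q (Suc i)"] Q(2)[OF that]
        by (meson psubsetI psubset_imp_subset)
    qed
    then show ?B using prime_of_quotient(1,2) Q(1)
      by (intro exI[of _ "\<lambda>i. \<Union>(Q i)"]) simp
  next
    assume ?B
    then obtain P :: "nat \<Rightarrow> _ set" where P: "\<And>i. i \<le> d \<Longrightarrow> primeideal (P i) R"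
      "\<And>i. i \<le> d \<Longrightarrow> I \<subseteq> P i" "\<And>i. i < d \<Longrightarrow> P i \<subset> P (Suc i)" by blast
    have "(+>) I ` P i \<subset> (+>) I ` P (Suc i)" if "i < d" for i
    proof -
      have "\<Union>((+>) I ` P i) = P i" "\<Union>((+>) I ` P (Suc i)) = P (Suc i)"
        using prime_to_quotient(2) P(1,2) that by auto
      then have "(+>) I ` P i \<noteq> (+>) I ` P (Suc i)" using P(3)[OF that] by (metis psubset_eq)
      then show ?thesis using image_mono[of "P i" "P (Suc i)" "(+>) I"] P(3)[OF that]
        by (meson psubsetI psubset_imp_subset)
    qed
    then show ?A using prime_to_quotient(1) P(1,2)
      by (intro exI[of _ "\<lambda>i. (+>) I ` P i"]) simp
  qed
  then show ?thesis unfolding krull_dim_def by simp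
qed

end

section \<open>Primes avoiding a multiplicative set\<close>

lemma ideal_adjoin:
  fixes P :: "('x, 'k::field) mpoly set"
  assumes P: "ideal P (mpoly_ring X)" and a: "a \<in> polys X"
  shows "ideal {p + r * a | p r. p \<in> P \<and> r \<in> polys X} (mpoly_ring X)" (is "ideal ?I _")
  unfolding ideal_mpoly_ring_iff
proof (intro conjI ballI)
  show "?I \<subseteq> polys X" using ideal_polysD[OF P] a by (auto intro!: polys_closed)
  show "0 \<in> ?I" using ideal_zero[OF P] by (intro CollectI exI[of _ 0]) simp
  fix f assume "f \<in> ?I"
  then obtain p r where f: "f = p + r * a" "p \<in> P" "r \<in> polys X" by blast
  show "s * f \<in> ?I" if "s \<in> polys X" for s
    using f that ideal_mult_left[OF P f(2) that] mult_in_polys[OF that f(3)]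
    by (intro CollectI exI[of _ "s * p"] exI[of _ "s * r"]) (simp add: algebra_simps)
  fix g assume "g \<in> ?I"
  then obtain p' r' where g: "g = p' + r' * a" "p' \<in> P" "r' \<in> polys X" by blast
  show "f + g \<in> ?I"
    using f g ideal_add[OF P f(2) g(2)] add_in_polys[OF f(3) g(3)]
    by (intro CollectI exI[of _ "p + p'"] exI[of _ "r + r'"]) (simp add: algebra_simps)
qed

text \<open>
  An ideal that is maximal among those disjoint from \<open>T\<close> is prime: if \<open>a\<close> and \<open>b\<close> are outside, then the
  ideals obtained by adjoining \<open>a\<close> and \<open>b\<close> meet \<open>T\<close>, and the product of such elements of \<open>T\<close> would be
  inside if \<open>a * b\<close> were.
\<close>

lemma exists_prime_avoiding:
  fixes J :: "('x, 'k::field) mpoly set"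
  assumes J: "ideal J (mpoly_ring X)" "J \<inter> T = {}"
    and T: "1 \<in> T" "\<forall>s\<in>T. \<forall>t\<in>T. s * t \<in> T" "T \<subseteq> polys X"
  obtains P where "primeideal P (mpoly_ring X)" "J \<subseteq> P" "P \<inter> T = {}"
proof -
  let ?A = "{I. ideal I (mpoly_ring X) \<and> J \<subseteq> I \<and> I \<inter> T = {}}"
  have "\<exists>M\<in>?A. \<forall>I\<in>?A. M \<subseteq> I \<longrightarrow> I = M"
  proof (rule subset_Zorn_nonempty)
    show "?A \<noteq> {}" using J by blast
    fix C assume C: "C \<noteq> {}" "subset.chain ?A C"
    then have id: "ideal I (mpoly_ring X)" "J \<subseteq> I" "I \<inter> T = {}" if "I \<in> C" for I
      using that by (auto simp: subset.chain_def)
    have "ideal (\<Union>C) (mpoly_ring X)"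
      unfolding ideal_mpoly_ring_iff
    proof (intro conjI ballI)
      show "\<Union>C \<subseteq> polys X" using id(1) ideal_polysD by blast
      show "0 \<in> \<Union>C" using id(1) ideal_zero C(1) by blast
      fix a assume "a \<in> \<Union>C"
      then obtain I1 where a: "a \<in> I1" "I1 \<in> C" by blast
      show "r * a \<in> \<Union>C" if "r \<in> polys X" for r
        using ideal_mult_left[OF id(1)] a that by blast
      fix b assume "b \<in> \<Union>C"
      then obtain I2 where b: "b \<in> I2" "I2 \<in> C" by blast
      have "I1 \<subseteq> I2 \<or> I2 \<subseteq> I1" using C(2) a b by (simp add: subset_chain_def)
      then show "a + b \<in> \<Union>C" using ideal_add[OF id(1)] a b by blast
    qed
    then show "\<Union>C \<in> ?A" using C(1) id by blast
  qed
  then obtain P where PA: "P \<in> ?A" "\<forall>I\<in>?A. P \<subseteq> I \<longrightarrow> I = P" by (rule bexE)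
  then have P: "ideal P (mpoly_ring X)" "J \<subseteq> P" "P \<inter> T = {}" by auto
  have max: "I = P" if "ideal I (mpoly_ring X)" "J \<subseteq> I" "I \<inter> T = {}" "P \<subseteq> I" for I
    using PA(2)[rule_format, of I] that by simp
  have meets: "\<exists>p r. p \<in> P \<and> r \<in> polys X \<and> p + r * a \<in> T" if a: "a \<in> polys X" "a \<notin> P" for a
  proof (rule ccontr)
    assume none: "\<not> ?thesis"
    let ?I = "{p + r * a | p r. p \<in> P \<and> r \<in> polys X}"
    have "P \<subseteq> ?I"
    proof
      fix p assume "p \<in> P"
      then show "p \<in> ?I" by (intro CollectI exI[of _ p] exI[of _ 0]) simp
    qed
    moreover have "?I \<inter> T = {}" using none by blast
    ultimately have "?I = P"
      using P(2) by (intro max[OF ideal_adjoin[OF P(1) a(1)]]) (rule order_trans)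
    moreover have "a \<in> ?I" using ideal_zero[OF P(1)]
      by (intro CollectI exI[of _ 0] exI[of _ 1]) simp
    ultimately show False using a(2) by blast
  qed
  have "primeideal P (mpoly_ring X)"
    unfolding primeideal_mpoly_ring_iff
  proof (intro conjI ballI impI P(1))
    show "1 \<notin> P" using P(3) T(1) by blast
    fix a b assume ab: "a \<in> polys X" "b \<in> polys X" "a * b \<in> P"
    show "a \<in> P \<or> b \<in> P"
    proof (rule ccontr)
      assume "\<not> (a \<in> P \<or> b \<in> P)"
      then obtain p r q s where p: "p \<in> P" "r \<in> polys X" "p + r * a \<in> T"
        and q: "q \<in> P" "s \<in> polys X" "q + s * b \<in> T" using meets ab by blast
      have "(p + r * a) * (q + s * b) = (q + s * b) * p + (r * a * q + r * s * (a * b))"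
        by (simp add: algebra_simps)
      also have "\<dots> \<in> P"
        using ab p q T(3)
        by (intro ideal_add[OF P(1)] ideal_mult_left[OF P(1) p(1)] ideal_mult_left[OF P(1) q(1)]
            ideal_mult_left[OF P(1) ab(3)] mult_in_polys) auto
      finally show False using bspec[OF bspec[OF T(2) p(3)] q(3)] P(3) by blast
    qed
  qed
  then show ?thesis using that P by blast
qed

section \<open>Linear dependence modulo a prime ideal\<close>

text \<open>
  A submodule of the polynomials modulo \<open>P\<close>, over the polynomials in \<open>Y\<close>, described by
  representatives; the quotient itself does not have to be formed.
\<close>

definition mspan :: "'x set \<Rightarrow> ('x, 'k::field) mpoly set \<Rightarrow> ('x, 'k) mpoly set \<Rightarrow> ('x, 'k) mpoly set" where
  "mspan Y P B = {w. \<exists>d. (\<forall>b\<in>B. d b \<in> polys Y) \<and> w - (\<Sum>b\<in>B. d b * b) \<in> P}"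

context
  fixes X Y :: "'x set" and P :: "('x, 'k::field) mpoly set"
  assumes P: "ideal P (mpoly_ring X)" and Y: "Y \<subseteq> X"
begin

lemma mspan_ideal: "p \<in> P \<Longrightarrow> p \<in> mspan Y P B"
  unfolding mspan_def by (intro CollectI exI[of _ "\<lambda>_. 0"]) simp

lemma mspan_base: "finite B \<Longrightarrow> b \<in> B \<Longrightarrow> b \<in> mspan Y P B"
  unfolding mspan_def using ideal_zero[OF P]
  by (intro CollectI exI[of _ "\<lambda>c. if c = b then 1 else 0"]) (simp add: if_distrib[of "\<lambda>c. c * _"] cong: if_cong)

lemma mspan_add: "v \<in> mspan Y P B \<Longrightarrow> w \<in> mspan Y P B \<Longrightarrow> v + w \<in> mspan Y P B"
proof -
  assume "v \<in> mspan Y P B" "w \<in> mspan Y P B"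
  then obtain d e where d: "\<forall>b\<in>B. d b \<in> polys Y" "v - (\<Sum>b\<in>B. d b * b) \<in> P"
    and e: "\<forall>b\<in>B. e b \<in> polys Y" "w - (\<Sum>b\<in>B. e b * b) \<in> P" unfolding mspan_def by blast
  have "v + w - (\<Sum>b\<in>B. (d b + e b) * b) =
      (v - (\<Sum>b\<in>B. d b * b)) + (w - (\<Sum>b\<in>B. e b * b))"
    by (simp add: distrib_right sum.distrib)
  also have "\<dots> \<in> P" using d(2) e(2) by (rule ideal_add[OF P])
  finally show "v + w \<in> mspan Y P B" unfolding mspan_def using d(1) e(1)
    by (intro CollectI exI[of _ "\<lambda>b. d b + e b"]) (simp add: add_in_polys)
qed

lemma mspan_scale: "r \<in> polys Y \<Longrightarrow> w \<in> mspan Y P B \<Longrightarrow> r * w \<in> mspan Y P B"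
proof -
  assume r: "r \<in> polys Y" and "w \<in> mspan Y P B"
  then obtain e where e: "\<forall>b\<in>B. e b \<in> polys Y" "w - (\<Sum>b\<in>B. e b * b) \<in> P" unfolding mspan_def by blast
  have "r * w - (\<Sum>b\<in>B. (r * e b) * b) = r * (w - (\<Sum>b\<in>B. e b * b))"
    by (simp add: right_diff_distrib sum_distrib_left mult.assoc)
  also have "\<dots> \<in> P" using e(2) polys_mono[OF Y r] by (rule ideal_mult_left[OF P])
  finally show "r * w \<in> mspan Y P B" unfolding mspan_def using e(1) r
    by (intro CollectI exI[of _ "\<lambda>b. r * e b"]) (simp add: mult_in_polys)
qed

lemma mspan_sum: "(\<And>i. i \<in> A \<Longrightarrow> f i \<in> mspan Y P B) \<Longrightarrow> sum f A \<in> mspan Y P B"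
  by (induction A rule: infinite_finite_induct)
     (auto intro: mspan_add mspan_ideal[OF ideal_zero[OF P]])

lemma mspan_mult:
  assumes w: "w \<in> mspan Y P B" and f: "f \<in> polys X"
    and gen: "\<And>b. b \<in> B \<Longrightarrow> f * b \<in> mspan Y P B'"
  shows "f * w \<in> mspan Y P B'"
proof -
  obtain e where e: "\<forall>b\<in>B. e b \<in> polys Y" "w - (\<Sum>b\<in>B. e b * b) \<in> P"
    using w unfolding mspan_def by blast
  have "f * w = f * (w - (\<Sum>b\<in>B. e b * b)) + (\<Sum>b\<in>B. e b * (f * b))"
    by (simp add: right_diff_distrib sum_distrib_left mult.left_commute)
  also have "\<dots> \<in> mspan Y P B'"
  proof (intro mspan_add mspan_ideal[OF ideal_mult_left[OF P e(2) f]] mspan_sum)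
    show "e b * (f * b) \<in> mspan Y P B'" if "b \<in> B" for b
      using e(1) that by (intro mspan_scale[OF _ gen]) auto
  qed
  finally show ?thesis .
qed

end

text \<open>
  Gaussian elimination without divisions: an element with a nonzero coefficient at the generator \<open>b\<close>
  serves to eliminate \<open>b\<close> from the others, at the expense of one element.
\<close>

lemma mspan_dependent:
  fixes P :: "('x::linorder, 'k::field) mpoly set"
  assumes P: "ideal P (mpoly_ring X)" and Y: "Y \<subseteq> X" and B: "finite B"
  shows "finite I \<Longrightarrow> card B < card I \<Longrightarrow> (\<And>i. i \<in> I \<Longrightarrow> z i \<in> mspan Y P B) \<Longrightarrow>
    \<exists>c. (\<forall>i\<in>I. c i \<in> polys Y) \<and> (\<exists>i\<in>I. c i \<noteq> 0) \<and> (\<Sum>i\<in>I. c i * z i) \<in> P"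
  using B
proof (induction B arbitrary: I z rule: finite_induct)
  case empty
  then have "(\<Sum>i\<in>I. 1 * z i) \<in> P" by (intro ideal_sum[OF P]) (simp add: mspan_def)
  moreover have "I \<noteq> {}" using empty by auto
  ultimately show ?case by (intro exI[of _ "\<lambda>_. 1"]) auto
next
  case (insert b B)
  have ex: "\<exists>d. (\<forall>b'\<in>insert b B. d b' \<in> polys Y) \<and> z i - (\<Sum>b'\<in>insert b B. d b' * b') \<in> P"
    if "i \<in> I" for i using insert.prems(3)[OF that] by (simp add: mspan_def)
  define D where "D i = (SOME d. (\<forall>b'\<in>insert b B. d b' \<in> polys Y) \<and>
    z i - (\<Sum>b'\<in>insert b B. d b' * b') \<in> P)" for i
  have D: "\<And>i b'. i \<in> I \<Longrightarrow> b' \<in> insert b B \<Longrightarrow> D i b' \<in> polys Y"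
    "\<And>i. i \<in> I \<Longrightarrow> z i - (\<Sum>b'\<in>insert b B. D i b' * b') \<in> P"
    using someI_ex[OF ex, folded D_def] by blast+
  define z' where "z' i = z i - D i b * b" for i
  have z': "z' i \<in> mspan Y P B" if "i \<in> I" for i
    using D[OF that] insert.hyps unfolding mspan_def z'_def
    by (intro CollectI exI[of _ "D i"]) (simp add: algebra_simps)
  show ?case
  proof (cases "\<forall>i\<in>I. D i b = 0")
    case True
    then have "z i \<in> mspan Y P B" if "i \<in> I" for i using z'[OF that] that by (simp add: z'_def)
    moreover have "card B < card I" using insert.prems(2) insert.hyps by simp
    ultimately show ?thesis using insert.IH[OF insert.prems(1)] by blast
  next
    case False
    then obtain p where p: "p \<in> I" "D p b \<noteq> 0" by blast
    define w where "w i = D p b * z i - D i b * z p" for i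
    have Db: "D i b \<in> polys Y" if "i \<in> I" for i using D(1)[OF that] by simp
    have w: "w i \<in> mspan Y P B" if "i \<in> I - {p}" for i
    proof -
      have "w i = D p b * z' i + (- D i b) * z' p" by (simp add: w_def z'_def algebra_simps)
      also have "\<dots> \<in> mspan Y P B"
        using that p(1) Db z' by (intro mspan_add[OF P Y] mspan_scale[OF P Y]) auto
      finally show ?thesis .
    qed
    have "card B < card (I - {p})"
      using insert.prems(1,2) insert.hyps p(1) by simp
    from insert.IH[of "I - {p}" w, OF _ this w] insert.prems(1)
    have "\<exists>c. (\<forall>i\<in>I - {p}. c i \<in> polys Y) \<and> (\<exists>i\<in>I - {p}. c i \<noteq> 0) \<and>
        (\<Sum>i\<in>I - {p}. c i * w i) \<in> P" by simp
    then obtain c where c: "\<forall>i\<in>I - {p}. c i \<in> polys Y" "\<exists>i\<in>I - {p}. c i \<noteq> 0"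
        "(\<Sum>i\<in>I - {p}. c i * w i) \<in> P" by (elim exE conjE)
    define c' where "c' i = (if i = p then - (\<Sum>j\<in>I - {p}. c j * D j b) else c i * D p b)" for i
    have "(\<Sum>i\<in>I. c' i * z i) = c' p * z p + (\<Sum>i\<in>I - {p}. c' i * z i)"
      using p(1) insert.prems(1) by (rule sum.remove[rotated])
    also have "(\<Sum>i\<in>I - {p}. c' i * z i) = (\<Sum>i\<in>I - {p}. c i * D p b * z i)"
      by (intro sum.cong) (auto simp: c'_def)
    also have "c' p * z p = - (\<Sum>i\<in>I - {p}. c i * D i b * z p)"
      by (simp add: c'_def sum_distrib_right)
    also have "- (\<Sum>i\<in>I - {p}. c i * D i b * z p) + (\<Sum>i\<in>I - {p}. c i * D p b * z i) =
        (\<Sum>i\<in>I - {p}. c i * w i)"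
      unfolding sum_negf[symmetric] sum.distrib[symmetric]
      by (intro sum.cong) (auto simp: w_def algebra_simps)
    finally have "(\<Sum>i\<in>I. c' i * z i) \<in> P" using c(3) by simp
    moreover have "\<exists>i\<in>I. c' i \<noteq> 0" using c(2) p(2) by (auto simp: c'_def)
    moreover have "\<forall>i\<in>I. c' i \<in> polys Y"
      using c(1) Db p(1) by (auto simp: c'_def intro!: sum_in_polys mult_in_polys)
    ultimately show ?thesis by blast
  qed
qed

section \<open>Independent sets of variables\<close>

definition indep :: "('x, 'k::field) mpoly set \<Rightarrow> 'x set \<Rightarrow> bool" where
  "indep J Y \<longleftrightarrow> J \<inter> polys Y \<subseteq> {0}"

lemma indepD: "indep J Y \<Longrightarrow> f \<in> J \<Longrightarrow> f \<in> polys Y \<Longrightarrow> f = 0"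
  unfolding indep_def by blast

lemma indep_subset: "indep J Y \<Longrightarrow> J' \<subseteq> J \<Longrightarrow> Y' \<subseteq> Y \<Longrightarrow> indep J' Y'"
  unfolding indep_def using polys_mono[of Y' Y] by blast

lemma polys_empty: "f \<in> polys {} \<Longrightarrow> f = Poly_Mapping.single 0 (lookup f 0)"
proof (rule poly_mapping_eqI)
  fix m assume f: "f \<in> polys {}"
  show "lookup f m = lookup (Poly_Mapping.single 0 (lookup f 0)) m"
    using in_polysD[OF f, of m] by (cases "m \<in> keys f") (auto simp: in_keys_iff lookup_single when_def)
qed

lemma indep_empty:
  assumes "ideal J (mpoly_ring X)" "1 \<notin> J"
  shows "indep J {}"
  unfolding indep_def
proof
  fix f assume f: "f \<in> J \<inter> polys {}"
  then have *: "f = Poly_Mapping.single 0 (lookup f 0)" using polys_empty by blast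
  have "lookup f 0 = 0"
  proof (rule ccontr)
    assume "lookup f 0 \<noteq> 0"
    then show False using ideal_one_const[OF assms(1), of "lookup f 0"] * f assms(2) by simp
  qed
  then show "f \<in> {0}" using * by simp
qed

lemma lookup_lm_power:
  fixes f :: "('x::linorder, 'k::field) mpoly"
  assumes "f \<noteq> 0"
  shows "lookup (lm (f ^ k)) y = k * lookup (lm f) y"
proof (induction k)
  case 0
  have "lm (1 :: ('x, 'k) mpoly) = 0" by (intro lm_eqI) simp_all
  then show ?case by simp
qed (simp add: lm_mult assms lookup_add)

lemma mon_poly_add: "mon_poly (u + v) = (mon_poly u * mon_poly v :: ('x, 'k::field) mpoly)"
  and mon_poly_0 [simp]: "mon_poly 0 = (1 :: ('x, 'k::field) mpoly)"
  by (simp_all add: mon_poly_def mult_single)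

section \<open>Maximal independent sets\<close>

lemma prod_notin_prime:
  fixes P :: "('x, 'k::field) mpoly set"
  assumes "primeideal P (mpoly_ring X)" "a \<in> polys X" "b \<in> polys X" "a * b \<in> P" "a \<notin> P"
  shows "b \<in> P"
  using assms by (auto simp: primeideal_mpoly_ring_iff)

text \<open>
  For a maximal independent set \<open>Y\<close> of a prime \<open>P\<close>, every variable is algebraic over \<open>polys Y\<close> modulo
  \<open>P\<close>.  A common denominator \<open>g\<close> of the leading coefficients of the algebraic relations makes a span of
  finitely many monomials stable under multiplication by \<open>g\<close> times any variable.
\<close>

context
  fixes X Y :: "'x::linorder set" and P :: "('x, 'k::field) mpoly set"
  assumes X: "finite X" and P: "primeideal P (mpoly_ring X)" and Y: "Y \<subseteq> X"
    and ind: "indep P Y"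
begin

private lemma P_ideal: "ideal P (mpoly_ring X)" using P by (rule prime_ideal_ideal)

lemma stable_span_variables:
  assumes max: "\<forall>x\<in>X - Y. \<not> indep P (insert x Y)"
  shows "\<exists>B g. finite B \<and> B \<subseteq> polys X \<and> 1 \<in> B \<and> g \<in> polys Y \<and> g \<noteq> 0 \<and>
    (\<forall>x\<in>X. \<forall>b\<in>B. g * mvar x * b \<in> mspan Y P B)"
proof -
  have "finite Z \<Longrightarrow> Z \<subseteq> X - Y \<Longrightarrow>
    \<exists>B g. finite B \<and> B \<subseteq> polys X \<and> 1 \<in> B \<and> g \<in> polys Y \<and> g \<noteq> 0 \<and>
    (\<forall>x\<in>Y \<union> Z. \<forall>b\<in>B. g * mvar x * b \<in> mspan Y P B)" for Z
  proof (induction Z rule: finite_induct)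
    case empty
    have "1 * mvar x * 1 \<in> mspan Y P {1}" if "x \<in> Y" for x
      unfolding mspan_def using that ideal_zero[OF P_ideal]
      by (intro CollectI exI[of _ "\<lambda>_. mvar x"]) simp
    then show ?case by (intro exI[of _ "{1}"] exI[of _ 1]) simp
  next
    case (insert x Z)
    from insert.IH insert.prems
    obtain B g where B: "finite B" "B \<subseteq> polys X" "1 \<in> B" and g: "g \<in> polys Y" "g \<noteq> 0"
      and st: "\<forall>x\<in>Y \<union> Z. \<forall>b\<in>B. g * mvar x * b \<in> mspan Y P B" by auto
    have xX: "x \<in> X" "x \<notin> Y" using insert.prems by auto
    obtain F where F: "F \<in> P" "F \<in> polys (insert x Y)" "F \<noteq> 0"
      using bspec[OF max, of x] xX unfolding indep_def by auto
    define d where "d = deg_in x F"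
    have Fj: "vcoeff x j F \<in> polys Y" for j
      using vcoeff_in_polys[OF F(2), of x j] xX(2) by simp
    have Fd: "vcoeff x d F \<noteq> 0"
      using top_coeff_nonzero[OF F(3), of x] by (simp add: d_def top_coeff_eq)
    have Fsum: "F = (\<Sum>j\<le>d. mvar x ^ j * vcoeff x j F)" unfolding d_def by (rule poly_sum_vcoeffs)
    have d0: "d > 0"
    proof (rule ccontr)
      assume "\<not> d > 0"
      then have d0: "d = 0" by simp
      have "F = vcoeff x 0 F" by (subst Fsum) (simp add: d0)
      then have "F \<in> polys Y" using Fj[of 0] by simp
      then show False using indepD[OF ind F(1)] F(3) by simp
    qed
    \<comment> \<open>The relation expresses \<open>x ^ d\<close>, up to its leading coefficient, by lower powers of \<open>x\<close>.\<close>
    define B' where "B' = (\<lambda>(b, j). b * mvar x ^ j) ` (B \<times> {..<d})"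
    define g' where "g' = g * vcoeff x d F"
    have B'I: "b * mvar x ^ j \<in> B'" if "b \<in> B" "j < d" for b j
      unfolding B'_def using that by (intro image_eqI[of _ _ "(b, j)"]) auto
    have B'fin: "finite B'" unfolding B'_def using B(1) by simp
    have B'X: "B' \<subseteq> polys X" unfolding B'_def using B(2) xX(1) by (auto intro!: mult_in_polys power_in_polys)
    have "1 * mvar x ^ 0 \<in> B'" by (rule B'I[OF B(3) d0])
    then have B'1: "1 \<in> B'" by simp
    have FdX: "vcoeff x d F \<in> polys X" using Fj polys_mono[OF Y] by blast
    note sc = mspan_scale[OF P_ideal Y]
    have old: "g' * mvar z * b' \<in> mspan Y P B'" if z: "z \<in> Y \<union> Z" and b': "b' \<in> B'" for z b'
    proof -
      obtain b j where bj: "b \<in> B" "j < d" "b' = b * mvar x ^ j" using b' by (auto simp: B'_def)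
      have "mvar x ^ j * c \<in> mspan Y P B'" if "c \<in> B" for c
        using mspan_base[OF P_ideal Y B'fin B'I[OF that bj(2)]] by (simp add: mult.commute)
      then have "mvar x ^ j * (g * mvar z * b) \<in> mspan Y P B'"
        using st z bj(1) xX(1)
        by (intro mspan_mult[OF P_ideal Y, of "g * mvar z * b" B]) (auto intro: power_in_polys)
      then have "vcoeff x d F * (mvar x ^ j * (g * mvar z * b)) \<in> mspan Y P B'"
        by (rule sc[OF Fj])
      then show ?thesis by (simp add: g'_def bj(3) mult.assoc mult.commute mult.left_commute)
    qed
    have new: "g' * mvar x * b' \<in> mspan Y P B'" if b': "b' \<in> B'" for b'
    proof -
      obtain b j where bj: "b \<in> B" "j < d" "b' = b * mvar x ^ j" using b' by (auto simp: B'_def)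
      have "vcoeff x d F * (b * mvar x ^ Suc j) \<in> mspan Y P B'"
      proof (cases "Suc j < d")
        case True
        show ?thesis by (rule sc[OF Fj mspan_base[OF P_ideal Y B'fin B'I[OF bj(1) True]]])
      next
        case False
        then have d: "d = Suc j" using bj(2) by simp
        have "F = (\<Sum>i<d. mvar x ^ i * vcoeff x i F) + mvar x ^ d * vcoeff x d F"
          by (subst Fsum) (simp add: lessThan_Suc_atMost[symmetric])
        then have "vcoeff x d F * (b * mvar x ^ Suc j) =
            b * F - b * (\<Sum>i<d. mvar x ^ i * vcoeff x i F)"
          by (metis (no_types, lifting) add_diff_cancel_left' d mult.commute mult.left_commute right_diff_distrib)
        also have "\<dots> = b * F + (\<Sum>i<d. (- vcoeff x i F) * (b * mvar x ^ i))"
          by (simp add: sum_distrib_left sum_negf mult.assoc mult.commute mult.left_commute)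
        also have "\<dots> \<in> mspan Y P B'"
        proof (intro mspan_add[OF P_ideal Y] mspan_sum[OF P_ideal Y])
          have "b \<in> polys X" using bj(1) B(2) by blast
          then show "b * F \<in> mspan Y P B'"
            by (intro mspan_ideal[OF P_ideal Y] ideal_mult_left[OF P_ideal F(1)])
          fix i assume "i \<in> {..<d}"
          then have "b * mvar x ^ i \<in> mspan Y P B'"
            using mspan_base[OF P_ideal Y B'fin B'I[OF bj(1)]] by simp
          then show "(- vcoeff x i F) * (b * mvar x ^ i) \<in> mspan Y P B'"
            by (rule sc[rotated]) (simp add: Fj)
        qed
        finally show ?thesis .
      qed
      then have "g * (vcoeff x d F * (b * mvar x ^ Suc j)) \<in> mspan Y P B'" by (rule sc[OF g(1)])
      then show ?thesis by (simp add: g'_def bj(3) mult.assoc mult.commute mult.left_commute)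
    qed
    have "g' \<in> polys Y" "g' \<noteq> 0" using g Fj Fd by (simp_all add: g'_def mult_in_polys)
    moreover have "\<forall>z\<in>Y \<union> insert x Z. \<forall>b\<in>B'. g' * mvar z * b \<in> mspan Y P B'"
      using old new by blast
    ultimately show ?case using B'fin B'X B'1 by (intro exI[of _ B'] exI[of _ g'] conjI)
  qed
  from this[of "X - Y"] X Y show ?thesis by (simp add: Un_absorb1)
qed

lemma stable_span:
  assumes max: "\<forall>x\<in>X - Y. \<not> indep P (insert x Y)"
  obtains B g where "finite B" "B \<subseteq> polys X" "1 \<in> B" "g \<in> polys Y" "g \<noteq> 0"
    "\<forall>f\<in>polys X. \<exists>D. \<forall>w\<in>mspan Y P B. g ^ D * f * w \<in> mspan Y P B"
proof -
  obtain B g where B: "finite B" "B \<subseteq> polys X" "1 \<in> B" and g: "g \<in> polys Y" "g \<noteq> 0"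
      and st: "\<forall>x\<in>X. \<forall>b\<in>B. g * mvar x * b \<in> mspan Y P B"
    using stable_span_variables[OF max] by auto
  have gX: "g \<in> polys X" using g(1) by (rule polys_mono[OF Y])
  let ?W = "mspan Y P B" and ?S = "\<lambda>f. \<exists>D. \<forall>w\<in>mspan Y P B. g ^ D * f * w \<in> mspan Y P B"
  have gk: "g ^ k * w \<in> ?W" if "w \<in> ?W" for k w
    using mspan_scale[OF P_ideal Y power_in_polys[OF g(1)] that] .
  have S_const: "?S (Poly_Mapping.single 0 c)" for c
    using mspan_scale[OF P_ideal Y, of "Poly_Mapping.single 0 c"] by (intro exI[of _ 0]) simp
  have S_var: "?S (mvar x)" if "x \<in> X" for x
  proof (intro exI[of _ 1] ballI)
    fix w assume "w \<in> ?W"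
    then show "g ^ 1 * mvar x * w \<in> ?W"
      using st that gX by (intro mspan_mult[OF P_ideal Y, of w B]) (auto intro: mult_in_polys)
  qed
  have S_mult: "?S (f * h)" if f: "?S f" and h: "?S h" for f h
  proof -
    obtain D E where D: "\<forall>w\<in>?W. g ^ D * f * w \<in> ?W" and E: "\<forall>w\<in>?W. g ^ E * h * w \<in> ?W"
      using f h by auto
    have "g ^ (D + E) * (f * h) * w \<in> ?W" if "w \<in> ?W" for w
    proof -
      have "g ^ D * f * (g ^ E * h * w) \<in> ?W" using D E that by simp
      then show ?thesis by (simp add: power_add mult.assoc mult.commute mult.left_commute)
    qed
    then show ?thesis by (intro exI[of _ "D + E"]) simp
  qed
  have S_add: "?S (f + h)" if f: "?S f" and h: "?S h" for f h
  proof -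
    obtain D E where D: "\<forall>w\<in>?W. g ^ D * f * w \<in> ?W" and E: "\<forall>w\<in>?W. g ^ E * h * w \<in> ?W"
      using f h by auto
    have "g ^ (D + E) * (f + h) * w \<in> ?W" if "w \<in> ?W" for w
    proof -
      have "g ^ E * (g ^ D * f * w) + g ^ D * (g ^ E * h * w) \<in> ?W"
        using D E that gk by (intro mspan_add[OF P_ideal Y]) simp_all
      then show ?thesis by (simp add: power_add algebra_simps)
    qed
    then show ?thesis by (intro exI[of _ "D + E"]) simp
  qed
  have S_one: "?S 1" using S_const[of 1] by simp
  have S_power: "?S (f ^ k)" if "?S f" for f k
    by (induction k) (simp_all only: power_0 power_Suc S_one S_mult[OF that])
  have S_prod: "?S (prod h A)" if "\<And>i. i \<in> A \<Longrightarrow> ?S (h i)" for A :: "'x set" and h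
    using that
  proof (induction A rule: infinite_finite_induct)
    case (infinite A)
    then show ?case using S_one by simp
  next
    case (insert i A)
    have "?S (h i * prod h A)" by (rule S_mult) (use insert in auto)
    then show ?case using insert by simp
  qed (simp only: prod.empty S_one)
  have "?S f" if "f \<in> polys X" for f
    using that
  proof (induction f rule: polys_induct)
    case zero
    then show ?case using S_const[of 0] by simp
  next
    case (single m c)
    have mon: "mon_poly m = (\<Prod>x\<in>keys m. mvar x ^ lookup m x :: ('x, 'k) mpoly)"
    proof -
      have "mon_poly (\<Sum>x\<in>A. Poly_Mapping.single x (lookup m x)) =
          (\<Prod>x\<in>A. mvar x ^ lookup m x :: ('x, 'k) mpoly)" for A
        by (induction A rule: infinite_finite_induct)
          (simp_all add: mvar_power mon_poly_add)
      moreover have "m = (\<Sum>x\<in>keys m. Poly_Mapping.single x (lookup m x))"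
        by (intro poly_mapping_eqI) (simp add: lookup_sum lookup_single when_def in_keys_iff)
      ultimately show ?thesis by metis
    qed
    have "?S (\<Prod>x\<in>keys m. mvar x ^ lookup m x)"
      using single by (intro S_prod S_power S_var) (auto simp: mons_def)
    then have "?S (Poly_Mapping.single 0 c * mon_poly m)" unfolding mon by (rule S_mult[OF S_const])
    then show ?case by (simp add: mon_poly_def mult_single)
  qed (rule S_add)
  then show ?thesis using that B g by blast
qed

text \<open>
  For a maximal subset \<open>B0\<close> of \<open>B\<close> that contains \<open>1\<close> and is free modulo \<open>P\<close>, every other element of \<open>B\<close>
  has a nonzero multiple in the span of \<open>B0\<close>; the product of the factors is a common denominator.
\<close>

lemma free_subspan:
  assumes B: "finite B" "1 \<in> B"
  obtains B0 c where "B0 \<subseteq> B" "1 \<in> B0" "c \<in> polys Y" "c \<noteq> 0"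
    "\<forall>d. (\<forall>b\<in>B0. d b \<in> polys Y) \<longrightarrow> (\<Sum>b\<in>B0. d b * b) \<in> P \<longrightarrow> (\<forall>b\<in>B0. d b = 0)"
    "\<forall>w\<in>mspan Y P B. c * w \<in> mspan Y P B0"
proof -
  define rel where "rel B0 d \<longleftrightarrow> (\<forall>b\<in>B0. d b \<in> polys Y) \<and> (\<Sum>b\<in>B0. d b * b) \<in> P" for B0 d
  define free where "free B0 \<longleftrightarrow> (\<forall>d. rel B0 d \<longrightarrow> (\<forall>b\<in>B0. d b = 0))" for B0
  have "free {1}" unfolding free_def rel_def using indepD[OF ind] by simp
  then have "{1} \<in> {B0. B0 \<subseteq> B \<and> 1 \<in> B0 \<and> free B0}" using B(2) by simp
  moreover have "finite {B0. B0 \<subseteq> B \<and> 1 \<in> B0 \<and> free B0}" using B(1) by simp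
  ultimately obtain B0 where B0: "B0 \<in> {B0. B0 \<subseteq> B \<and> 1 \<in> B0 \<and> free B0}"
    and max: "\<forall>C\<in>{B0. B0 \<subseteq> B \<and> 1 \<in> B0 \<and> free B0}. B0 \<subseteq> C \<longrightarrow> C = B0"
    using finite_has_maximal[of "{B0. B0 \<subseteq> B \<and> 1 \<in> B0 \<and> free B0}"] by (metis (no_types, lifting) empty_iff)
  have B0': "B0 \<subseteq> B" "1 \<in> B0" "free B0" using B0 by auto
  have fin: "finite B0" using B0'(1) B(1) by (rule finite_subset)
  have ex: "\<exists>e. e \<in> polys Y \<and> e \<noteq> 0 \<and> e * b \<in> mspan Y P B0" if b: "b \<in> B - B0" for b
  proof -
    have "\<not> free (insert b B0)"
    proof
      assume fr: "free (insert b B0)"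
      have "insert b B0 \<in> {B0. B0 \<subseteq> B \<and> 1 \<in> B0 \<and> free B0}" using fr B0'(1,2) b by simp
      from max[rule_format, OF this] have "insert b B0 = B0" by (simp add: subset_insertI)
      then show False using b by auto
    qed
    then obtain d where "rel (insert b B0) d" and nz: "\<not> (\<forall>b\<in>insert b B0. d b = 0)"
      unfolding free_def by blast
    then have d: "\<forall>b\<in>insert b B0. d b \<in> polys Y" "(\<Sum>b\<in>insert b B0. d b * b) \<in> P"
      unfolding rel_def by blast+
    obtain b' where b': "b' \<in> insert b B0" "d b' \<noteq> 0" using nz by blast
    have sum: "(\<Sum>b\<in>insert b B0. d b * b) = d b * b + (\<Sum>b\<in>B0. d b * b)" using b fin by simp
    have "d b \<noteq> 0"
    proof
      assume 0: "d b = 0"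
      then have "(\<Sum>b\<in>B0. d b * b) \<in> P" using d(2) sum by simp
      then have "\<forall>b\<in>B0. d b = 0" using B0'(3) d(1) unfolding free_def rel_def by simp
      then show False using b' 0 by auto
    qed
    moreover have "d b * b \<in> mspan Y P B0"
      unfolding mspan_def using d sum
      by (intro CollectI exI[of _ "\<lambda>b. - d b"]) (simp add: sum_negf)
    ultimately show ?thesis using d(1) by (intro exI[of _ "d b"]) simp
  qed
  define e where "e b = (SOME e. e \<in> polys Y \<and> e \<noteq> 0 \<and> e * b \<in> mspan Y P B0)" for b
  have e: "e b \<in> polys Y \<and> e b \<noteq> 0 \<and> e b * b \<in> mspan Y P B0" if "b \<in> B - B0" for b
    unfolding e_def by (rule someI_ex[OF ex[OF that]])
  define c where "c = prod e (B - B0)"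
  have finD: "finite (B - B0)" using B(1) by simp
  have cY: "c \<in> polys Y" unfolding c_def using e by (intro prod_in_polys) simp
  have c0: "c \<noteq> 0" unfolding c_def using e finD by (subst prod_zero_iff) auto
  have cX: "c \<in> polys X" using cY by (rule polys_mono[OF Y])
  have gen: "c * b \<in> mspan Y P B0" if b: "b \<in> B" for b
  proof (cases "b \<in> B0")
    case True
    show ?thesis by (rule mspan_scale[OF P_ideal Y cY mspan_base[OF P_ideal Y fin True]])
  next
    case False
    then have bD: "b \<in> B - B0" using b by simp
    have "c * b = prod e (B - B0 - {b}) * (e b * b)"
      unfolding c_def using prod.remove[OF finD bD, of e] by (simp add: mult.assoc mult.commute)
    also have "\<dots> \<in> mspan Y P B0"
      using e by (intro mspan_scale[OF P_ideal Y _ conjunct2[OF conjunct2[OF e[OF bD]]]] prod_in_polys) auto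
    finally show ?thesis .
  qed
  have "c * w \<in> mspan Y P B0" if "w \<in> mspan Y P B" for w
    by (rule mspan_mult[OF P_ideal Y that cX gen])
  moreover have "\<forall>d. (\<forall>b\<in>B0. d b \<in> polys Y) \<longrightarrow> (\<Sum>b\<in>B0. d b * b) \<in> P \<longrightarrow> (\<forall>b\<in>B0. d b = 0)"
    using B0'(3) unfolding free_def rel_def by simp
  ultimately show ?thesis using that[OF B0'(1,2) cY c0] by simp
qed

end

section \<open>Krull dimension and independent sets\<close>

context
  fixes X Y :: "'x::linorder set" and P :: "('x, 'k::field) mpoly set"
  assumes X: "finite X" and P: "primeideal P (mpoly_ring X)" and Y: "Y \<subseteq> X"
    and ind: "indep P Y" and max: "\<forall>x\<in>X - Y. \<not> indep P (insert x Y)"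
begin

text \<open>
  The polynomial \<open>c\<close> is the lowest nonzero coefficient in an algebraic equation that holds, modulo \<open>P\<close>, for a
  multiple of \<open>f\<close> over the polynomials in \<open>Y\<close>.
\<close>

lemma divides_independent:
  assumes f: "f \<in> polys X" "f \<notin> P"
  obtains a c where "a \<in> polys X" "c \<in> polys Y" "c \<noteq> 0" "a * f - c \<in> P"
proof -
  note Pi = prime_ideal_ideal[OF P]
  obtain B g where B: "finite B" "B \<subseteq> polys X" "1 \<in> B" and g: "g \<in> polys Y" "g \<noteq> 0"
    and st: "\<forall>f\<in>polys X. \<exists>D. \<forall>w\<in>mspan Y P B. g ^ D * f * w \<in> mspan Y P B"
    using stable_span[OF X P Y ind max] .
  obtain D where D: "\<forall>w\<in>mspan Y P B. g ^ D * f * w \<in> mspan Y P B" using bspec[OF st f(1)] by (rule exE)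
  define h where "h = g ^ D * f"
  have gX: "g \<in> polys X" using g(1) by (rule polys_mono[OF Y])
  have gDX: "g ^ D \<in> polys X" using gX by (rule power_in_polys)
  have hX: "h \<in> polys X" unfolding h_def using gDX f(1) by (rule mult_in_polys)
  have "g \<notin> P" using indepD[OF ind _ g(1)] g(2) by blast
  then have gDP: "g ^ D \<notin> P" using prime_ideal_power[OF P gX] by blast
  have hP: "h \<notin> P" using prod_notin_prime[OF P gDX f(1)] gDP f(2) unfolding h_def by blast
  have "1 \<in> mspan Y P B" by (rule mspan_base[OF Pi Y B(1,3)])
  then have pow: "h ^ k \<in> mspan Y P B" for k
  proof (induction k)
    case (Suc k)
    then show ?case using D by (simp add: h_def)
  qed simp
  have "\<exists>c. (\<forall>i\<in>{..card B}. c i \<in> polys Y) \<and> (\<exists>i\<in>{..card B}. c i \<noteq> 0) \<and>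
      (\<Sum>i\<in>{..card B}. c i * h ^ i) \<in> P"
    by (rule mspan_dependent[OF Pi Y B(1)]) (simp_all add: pow)
  then obtain c where c: "\<forall>i\<in>{..card B}. c i \<in> polys Y" "\<exists>i\<in>{..card B}. c i \<noteq> 0"
      "(\<Sum>i\<in>{..card B}. c i * h ^ i) \<in> P" by (elim exE conjE)
  obtain i0 where i0: "i0 \<le> card B" "c i0 \<noteq> 0" using c(2) by (elim bexE) simp
  \<comment> \<open>As \<open>P\<close> is prime, the relation can be divided by the lowest occurring power of \<open>h\<close>.\<close>
  define k where "k = (LEAST i. i \<le> card B \<and> c i \<noteq> 0)"
  have k: "k \<le> card B \<and> c k \<noteq> 0"
    unfolding k_def by (rule LeastI[of "\<lambda>i. i \<le> card B \<and> c i \<noteq> 0" i0]) (simp add: i0)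
  have below: "c i = 0" if "i < k" for i
    using not_less_Least[of i "\<lambda>i. i \<le> card B \<and> c i \<noteq> 0"] that k unfolding k_def by auto
  define s where "s = (\<Sum>i\<in>{Suc k..card B}. c i * h ^ (i - Suc k))"
  have sX: "s \<in> polys X"
    unfolding s_def using c(1) hX polys_mono[OF Y]
    by (intro sum_in_polys mult_in_polys power_in_polys) auto
  have "(\<Sum>i\<in>{..card B}. c i * h ^ i) = (\<Sum>i\<in>{k..card B}. c i * h ^ i)"
    using below by (intro sum.mono_neutral_right) auto
  also have "\<dots> = c k * h ^ k + (\<Sum>i\<in>{Suc k..card B}. c i * h ^ i)"
    using k by (simp add: sum.atLeast_Suc_atMost)
  also have "(\<Sum>i\<in>{Suc k..card B}. c i * h ^ i) = h ^ k * (h * s)"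
    unfolding s_def sum_distrib_left
  proof (rule sum.cong)
    fix i assume "i \<in> {Suc k..card B}"
    then obtain j where "i = Suc (k + j)" by (metis Suc_le_D Suc_le_mono add_Suc atLeastAtMost_iff le_Suc_ex)
    then show "c i * h ^ i = h ^ k * (h * (c i * h ^ (i - Suc k)))"
      by (simp add: power_add mult.left_commute)
  qed simp
  finally have "h ^ k * (c k + h * s) \<in> P" using c(3) by (simp add: algebra_simps)
  moreover have "c k + h * s \<in> polys X"
    using c(1) k polys_mono[OF Y] hX sX by (intro add_in_polys mult_in_polys) auto
  moreover have "h ^ k \<notin> P" using prime_ideal_power[OF P hX] hP by blast
  ultimately have "c k + h * s \<in> P" using prod_notin_prime[OF P power_in_polys[OF hX]] by blast
  then have "- (c k + h * s) \<in> P" by (rule ideal_uminus[OF Pi])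
  moreover have "- (c k + h * s) = (- (g ^ D * s)) * f - c k" by (simp add: h_def algebra_simps)
  ultimately have "(- (g ^ D * s)) * f - c k \<in> P" by (simp only:)
  moreover have "- (g ^ D * s) \<in> polys X" using gDX sX by (simp add: mult_in_polys)
  ultimately show ?thesis using that c(1) k by blast
qed

text \<open>
  Let \<open>h = 1 + y * g\<close>, where \<open>g\<close> is a denominator as in \<open>stable_span\<close>.  There is a prime as desired that
  contains \<open>h\<close>, unless \<open>a * h = t\<close> modulo \<open>P\<close> for some \<open>a\<close> and some nonzero polynomial \<open>t\<close> in \<open>Y - {y}\<close>.
  Powers of \<open>a\<close> have only powers of \<open>g\<close>, which is invertible modulo \<open>h\<close>, and one fixed \<open>c\<close> in their
  denominators, so that \<open>h ^ k\<close> divides \<open>c * t ^ k\<close>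
  for all \<open>k\<close>.  The exponents of \<open>y\<close> in the leading monomials exclude this for large \<open>k\<close>.
\<close>

lemma exists_larger_prime:
  assumes y: "y \<in> Y"
  obtains P' where "primeideal P' (mpoly_ring X)" "P \<subset> P'" "indep P' (Y - {y})"
proof -
  note Pi = prime_ideal_ideal[OF P]
  obtain B g where B: "finite B" "B \<subseteq> polys X" "1 \<in> B" and g: "g \<in> polys Y" "g \<noteq> 0"
    and st: "\<forall>f\<in>polys X. \<exists>D. \<forall>w\<in>mspan Y P B. g ^ D * f * w \<in> mspan Y P B"
    using stable_span[OF X P Y ind max] .
  obtain B0 c where B0: "B0 \<subseteq> B" "1 \<in> B0" and c: "c \<in> polys Y" "c \<noteq> 0"
    and free: "\<forall>d. (\<forall>b\<in>B0. d b \<in> polys Y) \<longrightarrow> (\<Sum>b\<in>B0. d b * b) \<in> P \<longrightarrow> (\<forall>b\<in>B0. d b = 0)"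
    and cB: "\<forall>w\<in>mspan Y P B. c * w \<in> mspan Y P B0"
    using free_subspan[OF X P Y ind B(1,3)] .
  have fin0: "finite B0" using B0(1) B(1) by (rule finite_subset)
  \<comment> \<open>Chosen such that \<open>g\<close> divides \<open>h - 1\<close> and \<open>h\<close> involves \<open>y\<close>.\<close>
  define h where "h = 1 + mvar y * g"
  have vY: "mvar y \<in> polys Y" using y by simp
  have hY: "h \<in> polys Y" unfolding h_def using vY g(1) by (intro polys_closed) auto
  have deg_h: "lookup (lm h) y \<ge> 1" and h0: "h \<noteq> 0"
  proof -
    have vg: "mvar y * g = Poly_Mapping.single (Poly_Mapping.single y 1) 1 * g"
      by (simp add: mvar_def mon_poly_def)
    let ?m = "Poly_Mapping.single y 1 + lm g"
    have nz: "mvar y * g \<noteq> 0" unfolding vg single_mult_eq_zero using g(2) by simp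
    have lm: "lm (mvar y * g) = ?m" unfolding vg using g(2) by (intro lm_single_mult) simp_all
    have ym: "lookup ?m y \<ge> 1" by (simp add: lookup_add)
    then have "?m \<noteq> 0" by (metis lookup_zero not_one_le_zero)
    then have "?m \<in> keys h"
      using lm_in_keys[OF nz] unfolding lm h_def by (simp add: in_keys_iff lookup_add lookup_one)
    moreover have "m \<le> ?m" if "m \<in> keys h" for m
    proof -
      have "m = 0 \<or> m \<in> keys (mvar y * g)"
        using that keys_add[of 1 "mvar y * g"] unfolding h_def by auto
      then show ?thesis using lm_ge[of m "mvar y * g"] mon_dvd_le[of 0 ?m] by (auto simp: lm mon_dvd_iff)
    qed
    ultimately have "lm h = ?m" by (rule lm_eqI)
    then show "lookup (lm h) y \<ge> 1" using ym by simp
    show "h \<noteq> 0" using \<open>?m \<in> keys h\<close> by auto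
  qed
  have hX: "h \<in> polys X" using hY by (rule polys_mono[OF Y])
  have gX: "g \<in> polys X" using g(1) by (rule polys_mono[OF Y])
  have cX: "c \<in> polys X" using c(1) by (rule polys_mono[OF Y])
  define T where "T = polys (Y - {y}) - {0 :: ('x, 'k) mpoly}"
  let ?I = "{p + r * h | p r. p \<in> P \<and> r \<in> polys X}"
  have "?I \<inter> T = {}"
  proof (rule ccontr)
    assume "?I \<inter> T \<noteq> {}"
    then obtain p a where p: "p \<in> P" and a: "a \<in> polys X" and tT: "p + a * h \<in> T" by blast
    define t where "t = p + a * h"
    have t: "t \<in> polys (Y - {y})" "t \<noteq> 0" using tT by (auto simp: T_def t_def)
    have tY: "t \<in> polys Y" using t(1) by (rule polys_mono[rotated]) auto
    have tX: "t \<in> polys X" using tY by (rule polys_mono[OF Y])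
    obtain D where D: "\<forall>w\<in>mspan Y P B. g ^ D * a * w \<in> mspan Y P B" using bspec[OF st a] by (rule exE)
    have "1 \<in> mspan Y P B" by (rule mspan_base[OF Pi Y B(1,3)])
    then have pow: "(g ^ D * a) ^ k \<in> mspan Y P B" for k
    proof (induction k)
      case (Suc k)
      then show ?case using D by simp
    qed simp
    have dvd: "h ^ k dvd c * t ^ k" for k
    proof -
      obtain d where d: "\<forall>b\<in>B0. d b \<in> polys Y" "c * (g ^ D * a) ^ k - (\<Sum>b\<in>B0. d b * b) \<in> P"
        using bspec[OF cB pow[of k]] unfolding mspan_def mem_Collect_eq by (elim exE conjE)
      define u where "u = c * g ^ (D * k)"
      have uY: "u \<in> polys Y" unfolding u_def using c g by (intro mult_in_polys power_in_polys)
      have uX: "u \<in> polys X" using uY by (rule polys_mono[OF Y])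
      have "(a * h) ^ k - t ^ k \<in> P"
      proof (induction k)
        case 0
        then show ?case using ideal_zero[OF Pi] by simp
      next
        case (Suc k)
        have "(a * h) ^ Suc k - t ^ Suc k = (a * h) * ((a * h) ^ k - t ^ k) + (- (t ^ k)) * p"
          by (simp add: t_def algebra_simps)
        also have "\<dots> \<in> P"
          by (rule ideal_add[OF Pi ideal_mult_left[OF Pi Suc] ideal_mult_left[OF Pi p]])
             (use a hX tX in \<open>simp_all add: mult_in_polys power_in_polys\<close>)
        finally show ?case .
      qed
      then have "u * ((a * h) ^ k - t ^ k) \<in> P" by (rule ideal_mult_left[OF Pi _ uX])
      moreover have "h ^ k * (c * (g ^ D * a) ^ k - (\<Sum>b\<in>B0. d b * b)) \<in> P"
        using d(2) power_in_polys[OF hX] by (rule ideal_mult_left[OF Pi])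
      ultimately have "h ^ k * (c * (g ^ D * a) ^ k - (\<Sum>b\<in>B0. d b * b)) - u * ((a * h) ^ k - t ^ k) \<in> P"
        by (rule ideal_diff[OF Pi, rotated])
      also have "h ^ k * (c * (g ^ D * a) ^ k - (\<Sum>b\<in>B0. d b * b)) - u * ((a * h) ^ k - t ^ k)
          = u * t ^ k - h ^ k * (\<Sum>b\<in>B0. d b * b)"
        by (simp add: u_def power_mult_distrib power_mult[symmetric] algebra_simps)
      also have "\<dots> = (\<Sum>b\<in>B0. ((if b = 1 then u * t ^ k else 0) - h ^ k * d b) * b)"
      proof -
        have "(\<Sum>b\<in>B0. (if b = 1 then u * t ^ k else 0) * b) = (\<Sum>b\<in>B0. if b = 1 then u * t ^ k else 0)"
          by (intro sum.cong) auto
        also have "\<dots> = u * t ^ k" using fin0 B0(2) by simp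
        finally show ?thesis
          by (simp only: left_diff_distrib sum_subtractf sum_distrib_left mult.assoc)
      qed
      finally have inP: "(\<Sum>b\<in>B0. ((if b = 1 then u * t ^ k else 0) - h ^ k * d b) * b) \<in> P" .
      have coeffs: "\<forall>b\<in>B0. (if b = 1 then u * t ^ k else 0) - h ^ k * d b \<in> polys Y"
        using d(1) uY tY hY by (auto intro!: polys_closed simp: mult_in_polys power_in_polys)
      from bspec[OF mp[OF mp[OF spec[OF free] coeffs] inP] B0(2)] have "u * t ^ k = h ^ k * d 1" by simp
      then have 1: "h ^ k dvd (c * t ^ k) * g ^ (D * k)" by (simp add: u_def mult.assoc mult.commute mult.left_commute)
      have 2: "h ^ k dvd v" if "h ^ k dvd v * (h - 1) ^ N" for v N
        using that
      proof (induction N)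
        case 0
        then show ?case by simp
      next
        case (Suc N)
        have "v * (h - 1) ^ N = v * (h - 1) ^ N * h ^ k
            - v * (h - 1) ^ Suc N * (\<Sum>i<k. h ^ i)"
        proof -
          have "v * (h - 1) ^ N * (h ^ k - 1) = v * (h - 1) ^ Suc N * (\<Sum>i<k. h ^ i)"
            unfolding power_diff_1_eq by (simp add: mult.assoc mult.left_commute)
          then show ?thesis by (simp add: algebra_simps)
        qed
        moreover have "h ^ k dvd v * (h - 1) ^ N * h ^ k - v * (h - 1) ^ Suc N * (\<Sum>i<k. h ^ i)"
          by (rule dvd_diff[OF dvd_triv_right dvd_mult2[OF Suc.prems]])
        ultimately have "h ^ k dvd v * (h - 1) ^ N" by (simp only:)
        then show ?case by (rule Suc.IH)
      qed
      have "h ^ k dvd (c * t ^ k) * g ^ (D * k) * mvar y ^ (D * k)" using 1 by (rule dvd_mult2)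
      also have "(c * t ^ k) * g ^ (D * k) * mvar y ^ (D * k) = (c * t ^ k) * (h - 1) ^ (D * k)"
        by (simp add: h_def power_mult_distrib mult.assoc mult.commute mult.left_commute)
      finally show ?thesis by (rule 2)
    qed
    \<comment> \<open>\<open>y\<close> occurs in the leading monomial of \<open>h ^ k\<close> at least \<open>k\<close> times, but not in that of \<open>t ^ k\<close>.\<close>
    define k where "k = Suc (lookup (lm c) y)"
    obtain q where q: "c * t ^ k = h ^ k * q" using dvd[of k] by (rule dvdE)
    have tk: "t ^ k \<noteq> 0" and hk: "h ^ k \<noteq> 0" using t(2) h0 by simp_all
    then have q0: "q \<noteq> 0" using q c(2) by auto
    have "lookup (lm t) y = 0" using lm_in_mons[OF t] by (simp add: mons_lookup)
    then have "lookup (lm c) y = k * lookup (lm h) y + lookup (lm q) y"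
      using arg_cong[OF q, of "\<lambda>f. lookup (lm f) y"]
      by (simp add: lm_mult lookup_add lookup_lm_power c(2) tk hk q0 t(2) h0)
    moreover have "k \<le> k * lookup (lm h) y" using deg_h by simp
    ultimately show False by (simp add: k_def)
  qed
  moreover have "1 \<in> T" by (simp add: T_def)
  moreover have "\<forall>s\<in>T. \<forall>t\<in>T. s * t \<in> T" by (simp add: T_def mult_in_polys)
  moreover have "T \<subseteq> polys X" using polys_mono[of "Y - {y}" X] Y by (auto simp: T_def)
  ultimately obtain P' where P': "primeideal P' (mpoly_ring X)" "?I \<subseteq> P'" "P' \<inter> T = {}"
    by (rule exists_prime_avoiding[OF ideal_adjoin[OF prime_ideal_ideal[OF P] hX]])
  have "P \<subseteq> ?I"
  proof
    fix p assume "p \<in> P"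
    then show "p \<in> ?I" by (intro CollectI exI[of _ p] exI[of _ 0]) simp
  qed
  moreover have "h \<in> ?I" using ideal_zero[OF Pi] by (intro CollectI exI[of _ 0] exI[of _ 1]) simp
  moreover have "h \<notin> P" using indepD[OF ind _ hY] h0 by blast
  ultimately have "P \<subset> P'" using P'(2) by blast
  moreover have "indep P' (Y - {y})" using P'(3) by (auto simp: indep_def T_def)
  ultimately show ?thesis using that P'(1) by blast
qed

end

lemma extend_to_maximal:
  assumes "finite X" "Y \<subseteq> X" "indep P Y"
  obtains Y' where "Y \<subseteq> Y'" "Y' \<subseteq> X" "indep P Y'" "\<forall>x\<in>X - Y'. \<not> indep P (insert x Y')"
proof -
  let ?A = "{Z. Y \<subseteq> Z \<and> Z \<subseteq> X \<and> indep P Z}"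
  have "finite ?A" using assms(1) by simp
  moreover have "Y \<in> ?A" using assms by simp
  ultimately obtain M where M: "M \<in> ?A" "\<forall>Z\<in>?A. M \<subseteq> Z \<longrightarrow> Z = M"
    using finite_has_maximal[of ?A] by (metis (no_types, lifting) empty_iff)
  have "\<not> indep P (insert x M)" if "x \<in> X - M" for x
  proof
    assume "indep P (insert x M)"
    then have "insert x M \<in> ?A" using M(1) that by auto
    from M(2)[rule_format, OF this] show False using that by auto
  qed
  then show ?thesis using that[of M] M(1) by simp
qed

definition var_dim :: "'x set \<Rightarrow> ('x, 'k::field) mpoly set \<Rightarrow> nat" where
  "var_dim X J = Max (card ` {Y. Y \<subseteq> X \<and> indep J Y})"

lemma var_dim_ge:
  assumes "finite X" "Y \<subseteq> X" "indep J Y"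
  shows "card Y \<le> var_dim X J"
  unfolding var_dim_def using assms by (intro Max_ge) auto

lemma var_dim_attained:
  assumes "finite X" "ideal J (mpoly_ring X)" "1 \<notin> J"
  obtains Y where "Y \<subseteq> X" "indep J Y" "card Y = var_dim X J"
proof -
  have "{} \<in> {Y. Y \<subseteq> X \<and> indep J Y}" using indep_empty[OF assms(2,3)] by simp
  then have ne: "card ` {Y. Y \<subseteq> X \<and> indep J Y} \<noteq> {}" by blast
  have "var_dim X J \<in> card ` {Y. Y \<subseteq> X \<and> indep J Y}"
    unfolding var_dim_def using assms(1) by (intro Max_in ne) simp
  then show ?thesis using that by auto
qed

text \<open>
  An element of \<open>P'\<close> outside \<open>P\<close> would divide, modulo \<open>P\<close>, a nonzero polynomial in \<open>Y\<close>, if \<open>Y\<close> were a maximal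
  independent set of \<open>P\<close>.  This polynomial would lie in \<open>P'\<close>.
\<close>

lemma independent_grows:
  fixes P P' :: "('x::linorder, 'k::field) mpoly set"
  assumes X: "finite X" and P: "primeideal P (mpoly_ring X)" and P': "ideal P' (mpoly_ring X)"
    and sub: "P \<subset> P'" and Y: "Y \<subseteq> X" "indep P' Y"
  obtains x where "x \<in> X - Y" "indep P (insert x Y)"
proof (rule ccontr)
  assume no: "\<not> thesis"
  have max: "\<forall>x\<in>X - Y. \<not> indep P (insert x Y)" using no that by blast
  have PP: "P \<subseteq> P'" using sub by (rule psubset_imp_subset)
  have ind: "indep P Y" by (rule indep_subset[OF Y(2) PP order_refl])
  obtain f where f: "f \<in> P'" "f \<notin> P" using sub by blast
  obtain a c where ac: "a \<in> polys X" "c \<in> polys Y" "c \<noteq> 0" "a * f - c \<in> P"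
    using divides_independent[OF X P Y(1) ind max ideal_polysD[OF P' f(1)] f(2)] .
  have "a * f - (a * f - c) \<in> P'"
    by (rule ideal_diff[OF P' ideal_mult_left[OF P' f(1) ac(1)] subsetD[OF PP ac(4)]])
  then have "c \<in> P'" by simp
  then show False using indepD[OF Y(2)] ac(2,3) by blast
qed

lemma chain_from_prime:
  fixes P :: "('x::linorder, 'k::field) mpoly set"
  assumes X: "finite X"
  shows "primeideal P (mpoly_ring X) \<Longrightarrow> Y \<subseteq> X \<Longrightarrow> indep P Y \<Longrightarrow> card Y = d \<Longrightarrow>
    \<exists>C :: nat \<Rightarrow> ('x, 'k) mpoly set. C 0 = P \<and> (\<forall>i\<le>d. primeideal (C i) (mpoly_ring X)) \<and>
      (\<forall>i<d. C i \<subset> C (Suc i))"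
proof (induction d arbitrary: P Y)
  case 0
  then show ?case by (intro exI[of _ "\<lambda>_. P"]) simp
next
  case (Suc d)
  obtain Y' where Y': "Y \<subseteq> Y'" "Y' \<subseteq> X" "indep P Y'" "\<forall>x\<in>X - Y'. \<not> indep P (insert x Y')"
    using extend_to_maximal[OF X Suc.prems(2,3)] .
  obtain y where y: "y \<in> Y" using Suc.prems(4) by (metis card_eq_0_iff equals0I nat.distinct(1))
  obtain P' where P': "primeideal P' (mpoly_ring X)" "P \<subset> P'" "indep P' (Y' - {y})"
    using exists_larger_prime[OF X Suc.prems(1) Y'(2,3,4), of y] y Y'(1) by blast
  have "indep P' (Y - {y})" using P'(3) by (rule indep_subset) (use Y'(1) in auto)
  moreover have "card (Y - {y}) = d" using y Suc.prems(4) by simp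
  ultimately obtain C :: "nat \<Rightarrow> ('x, 'k) mpoly set" where C: "C 0 = P'"
      "\<forall>i\<le>d. primeideal (C i) (mpoly_ring X)" "\<forall>i<d. C i \<subset> C (Suc i)"
    using Suc.IH[OF P'(1), of "Y - {y}"] Suc.prems(2) by auto
  show ?case
  proof (intro exI[of _ "case_nat P C"] conjI allI impI)
    fix i assume "i \<le> Suc d"
    then show "primeideal (case_nat P C i) (mpoly_ring X)"
      using C(2) Suc.prems(1) by (cases i) auto
  next
    fix i assume "i < Suc d"
    then show "case_nat P C i \<subset> case_nat P C (Suc i)"
      using C(1,3) P'(2) by (cases i) auto
  qed simp
qed

text \<open>
  From the top of a chain of primes downwards, each step makes room for one more independent variable;
  this bounds the length of chains.  Conversely, an independent set \<open>Y\<close> of \<open>J\<close> is also independent for some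
  prime above \<open>J\<close>, namely one that avoids the nonzero polynomials in \<open>Y\<close>, and a chain as long as \<open>Y\<close> starts
  there.
\<close>

theorem krull_dim_eq_var_dim:
  fixes J :: "('x::linorder, 'k::field) mpoly set"
  assumes X: "finite X" and J: "ideal J (mpoly_ring X)" and proper: "1 \<notin> J"
  shows "krull_dim (mpoly_ring X Quot J) = enat (var_dim X J)"
  unfolding krull_dim_quotient[OF cring_mpoly_ring J]
proof (rule antisym)
  show "Sup {enat d | d. \<exists>C :: nat \<Rightarrow> _ set. (\<forall>i\<le>d. primeideal (C i) (mpoly_ring X) \<and> J \<subseteq> C i) \<and>
      (\<forall>i<d. C i \<subset> C (Suc i))} \<le> enat (var_dim X J)"
  proof (rule Sup_least)
    fix x assume "x \<in> {enat d | d. \<exists>C :: nat \<Rightarrow> _ set. (\<forall>i\<le>d. primeideal (C i) (mpoly_ring X) \<and> J \<subseteq> C i) \<and>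
      (\<forall>i<d. C i \<subset> C (Suc i))}"
    then obtain d and C :: "nat \<Rightarrow> ('x, 'k) mpoly set" where x: "x = enat d"
      and C: "\<forall>i\<le>d. primeideal (C i) (mpoly_ring X) \<and> J \<subseteq> C i" "\<forall>i<d. C i \<subset> C (Suc i)" by auto
    have "\<exists>Y. Y \<subseteq> X \<and> indep (C (d - i)) Y \<and> card Y = i" if "i \<le> d" for i
      using that
    proof (induction i)
      case 0
      have "1 \<notin> C d" "ideal (C d) (mpoly_ring X)"
        using C(1) primeideal_mpoly_ring_iff by blast+
      then show ?case using indep_empty by (intro exI[of _ "{}"]) auto
    next
      case (Suc i)
      then obtain Y where Y: "Y \<subseteq> X" "indep (C (d - i)) Y" "card Y = i" by auto
      have lt: "d - Suc i < d" "Suc (d - Suc i) = d - i" using Suc.prems by auto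
      have pr: "primeideal (C (d - Suc i)) (mpoly_ring X)" "ideal (C (d - i)) (mpoly_ring X)"
        using C(1) prime_ideal_ideal[of "C (d - i)" X] by auto
      have "C (d - Suc i) \<subset> C (d - i)" using C(2) lt by metis
      then obtain z where z: "z \<in> X - Y" "indep (C (d - Suc i)) (insert z Y)"
        using independent_grows[OF X pr _ Y(1,2)] by blast
      have "finite Y" using Y(1) X by (rule finite_subset)
      then have "card (insert z Y) = Suc i" using z(1) Y(3) by simp
      then show ?case using z Y(1) by (intro exI[of _ "insert z Y"]) auto
    qed
    from this[of d] obtain Y where Y: "Y \<subseteq> X" "indep (C 0) Y" "card Y = d" by auto
    have "indep J Y" using Y(2) by (rule indep_subset) (use C(1) in auto)
    then show "x \<le> enat (var_dim X J)" using var_dim_ge[OF X Y(1)] Y(3) x by simp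
  qed
  obtain Y where Y: "Y \<subseteq> X" "indep J Y" "card Y = var_dim X J"
    using var_dim_attained[OF X J proper] .
  let ?T = "polys Y - {0 :: ('x, 'k) mpoly}"
  have "J \<inter> ?T = {}" using Y(2) by (auto simp: indep_def)
  moreover have "1 \<in> ?T" by simp
  moreover have "\<forall>s\<in>?T. \<forall>t\<in>?T. s * t \<in> ?T" by (simp add: mult_in_polys)
  moreover have "?T \<subseteq> polys X" using polys_mono[OF Y(1)] by blast
  ultimately obtain P where P: "primeideal P (mpoly_ring X)" "J \<subseteq> P" "P \<inter> ?T = {}"
    by (rule exists_prime_avoiding[OF J])
  have "indep P Y" using P(3) by (auto simp: indep_def)
  from chain_from_prime[OF X P(1) Y(1) this Y(3)]
  obtain C :: "nat \<Rightarrow> ('x, 'k) mpoly set" where C: "C 0 = P"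
    "\<forall>i\<le>var_dim X J. primeideal (C i) (mpoly_ring X)" "\<forall>i<var_dim X J. C i \<subset> C (Suc i)" by auto
  have "J \<subseteq> C i" if "i \<le> var_dim X J" for i
    using that
  proof (induction i)
    case (Suc i)
    then show ?case using C(3) by (meson Suc_le_lessD less_imp_le order_trans psubset_imp_subset)
  qed (use C(1) P(2) in simp)
  then show "enat (var_dim X J) \<le> Sup {enat d | d. \<exists>C :: nat \<Rightarrow> _ set.
      (\<forall>i\<le>d. primeideal (C i) (mpoly_ring X) \<and> J \<subseteq> C i) \<and> (\<forall>i<d. C i \<subset> C (Suc i))}"
    using C(2,3) by (intro Sup_upper CollectI exI[of _ "var_dim X J"] exI[of _ C]) auto
qed

lemma Idl_proper:
  fixes J :: "('x, 'k::field) mpoly set"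
  assumes "ideal J (mpoly_ring (X - Z))" "Z \<subseteq> X" "1 \<notin> J"
  shows "1 \<notin> Idl\<^bsub>mpoly_ring X\<^esub> J"
proof
  assume "1 \<in> Idl\<^bsub>mpoly_ring X\<^esub> J"
  then have "1 \<in> Idl\<^bsub>mpoly_ring X\<^esub> J \<inter> polys (X - Z)" by simp
  then show False using assms(3) unfolding Idl_contraction[OF assms(1,2)] by contradiction
qed

text \<open>
  The variables in \<open>Z\<close> can be added to any independent set, because the coefficients with respect to \<open>Z\<close> of
  an element of the extension lie in \<open>J\<close>; and they can be removed from any independent set.
\<close>

lemma var_dim_extension:
  fixes J :: "('x::linorder, 'k::field) mpoly set"
  assumes X: "finite X" and Z: "Z \<subseteq> X" and J: "ideal J (mpoly_ring (X - Z))" and proper: "1 \<notin> J"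
  shows "var_dim X (Idl\<^bsub>mpoly_ring X\<^esub> J) = var_dim (X - Z) J + card Z"
proof (rule antisym)
  let ?E = "Idl\<^bsub>mpoly_ring X\<^esub> J"
  have XZ: "finite (X - Z)" using X by simp
  note mem = in_Idl_iff_slices[OF J Z]
  have JX: "J \<subseteq> polys X" using ideal_polysD[OF J] polys_mono[of "X - Z" X] by blast
  have E1: "1 \<notin> ?E" by (rule Idl_proper[OF J Z proper])
  obtain Y where Y: "Y \<subseteq> X - Z" "indep J Y" "card Y = var_dim (X - Z) J"
    using var_dim_attained[OF XZ J proper] .
  have "indep ?E (Y \<union> Z)"
    unfolding indep_def
  proof
    fix f assume f: "f \<in> ?E \<inter> polys (Y \<union> Z)"
    have "slice Z a f = 0" if "a \<in> mons Z" for a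
    proof -
      have "slice Z a f \<in> polys (Y \<union> Z - Z)" using f by (intro slice_in_polys) simp
      then have "slice Z a f \<in> polys Y" by (rule polys_mono[rotated]) auto
      moreover have "slice Z a f \<in> J" using f mem that by blast
      ultimately show ?thesis using indepD[OF Y(2)] by blast
    qed
    then have "f = 0" by (rule poly_eq_zero_slices)
    then show "f \<in> {0}" by simp
  qed
  then have "card (Y \<union> Z) \<le> var_dim X ?E" using Y(1) Z by (intro var_dim_ge[OF X]) auto
  moreover have "card (Y \<union> Z) = card Y + card Z"
    using Y(1) Z X finite_subset[of Y X] finite_subset[of Z X] by (intro card_Un_disjoint) auto
  ultimately show "var_dim (X - Z) J + card Z \<le> var_dim X ?E" using Y(3) by simp
  obtain W where W: "W \<subseteq> X" "indep ?E W" "card W = var_dim X ?E"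
    using var_dim_attained[OF X ideal_Idl[OF JX] E1] .
  have "indep J (W - Z)" using W(2) Idl_superset[OF JX] by (rule indep_subset) auto
  then have "card (W - Z) \<le> var_dim (X - Z) J" using W(1) by (intro var_dim_ge[OF XZ]) auto
  moreover have "card W \<le> card (W - Z) + card Z"
  proof -
    have "card W \<le> card ((W - Z) \<union> Z)"
      using W(1) Z X finite_subset[of W X] finite_subset[of Z X] by (intro card_mono) auto
    also have "\<dots> \<le> card (W - Z) + card Z" by (rule card_Un_le)
    finally show ?thesis .
  qed
  ultimately show "var_dim X ?E \<le> var_dim (X - Z) J + card Z" using W(3) by simp
qed

section \<open>Unmixedness of a contraction\<close>

text \<open>
  The associated primes of \<open>J\<close> extend to associated primes of its extension.  These are minimal because
  \<open>J\<close> is radical: if \<open>Q'\<close> is an associated prime contained in the annihilator of \<open>f\<close>, then \<open>f \<notin> Q'\<close>, since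
  otherwise \<open>f * f \<in> J\<close>; hence \<open>Q'\<close> contains the annihilator.
\<close>

lemma unmixed_contraction:
  fixes J :: "('x::linorder, 'k::field) mpoly set"
  assumes X: "finite X" and Z: "Z \<subseteq> X" and J: "ideal J (mpoly_ring (X - Z))"
    and rad: "\<And>f. f \<in> polys (X - Z) \<Longrightarrow> f * f \<in> J \<Longrightarrow> f \<in> J"
    and eq: "equidimensional (mpoly_ring X) (Idl\<^bsub>mpoly_ring X\<^esub> J)"
  shows "unmixed (mpoly_ring (X - Z)) J"
  unfolding unmixed_def
proof
  let ?E = "\<lambda>K. Idl\<^bsub>mpoly_ring X\<^esub> K"
  note mem = in_Idl_iff_slices[OF _ Z]
  have XZ: "finite (X - Z)" using X by simp
  fix Q assume "Q \<in> assoc_primes (mpoly_ring (X - Z)) J"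
  then obtain f where Q: "primeideal Q (mpoly_ring (X - Z))" and f: "f \<in> polys (X - Z)"
    and Qf: "Q = {a \<in> polys (X - Z). a * f \<in> J}" by (auto simp: assoc_primes_def)
  note Qi = prime_ideal_ideal[OF Q]
  have fX: "f \<in> polys X" using f by (rule polys_mono[rotated]) auto
  have Q1: "1 \<notin> Q" using Q by (simp add: primeideal_mpoly_ring_iff)
  have JQ: "J \<subseteq> Q" unfolding Qf using ideal_polysD[OF J] ideal_mult_right[OF J] f by blast
  have J1: "1 \<notin> J" using Q1 JQ by blast
  have fJ: "f \<notin> J" using Q1 by (auto simp: Qf)
  have QX: "Q \<subseteq> polys X" and JX: "J \<subseteq> polys X"
    using ideal_polysD[OF Qi] ideal_polysD[OF J] polys_mono[of "X - Z" X] by blast+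
  have ann: "?E Q = {a \<in> polys X. a * f \<in> ?E J}"
  proof (intro Set.set_eqI)
    fix a
    have "slice Z b a \<in> Q \<longleftrightarrow> slice Z b (a * f) \<in> J" if "a \<in> polys X" "b \<in> mons Z" for b
      using slice_mult_outside[OF f that(2), of a] slice_in_polys[OF that(1)]
      by (simp add: Qf mult.commute)
    then show "a \<in> ?E Q \<longleftrightarrow> a \<in> {a \<in> polys X. a * f \<in> ?E J}"
      using mem[OF Qi, of a] mem[OF J, of "a * f"] mult_in_polys[OF _ fX] by auto
  qed
  have EQ: "primeideal (?E Q) (mpoly_ring X)" by (rule prime_extension[OF Q Z])
  have "?E Q \<in> assoc_primes (mpoly_ring X) (?E J)"
    using EQ fX ann by (auto simp: assoc_primes_def)
  moreover have "\<not> Q' \<subset> ?E Q" if Q': "Q' \<in> assoc_primes (mpoly_ring X) (?E J)" for Q'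
  proof
    assume sub: "Q' \<subset> ?E Q"
    obtain f' where pQ': "primeideal Q' (mpoly_ring X)" and f': "f' \<in> polys X"
      "Q' = {a \<in> polys X. a * f' \<in> ?E J}" using Q' by (auto simp: assoc_primes_def)
    have EJQ': "?E J \<subseteq> Q'"
      unfolding f'(2) using ideal_polysD[OF ideal_Idl[OF JX]] ideal_mult_right[OF ideal_Idl[OF JX]] f'(1)
      by blast
    have "f \<notin> Q'"
    proof
      assume "f \<in> Q'"
      then have "f \<in> ?E Q" using sub by blast
      then have "f * f \<in> ?E J" using ann by blast
      then have "f * f \<in> ?E J \<inter> polys (X - Z)" using mult_in_polys[OF f f] by simp
      then have "f * f \<in> J" unfolding Idl_contraction[OF J Z] .
      then show False using rad[OF f] fJ by blast
    qed
    moreover have "a \<in> Q' \<or> f \<in> Q'" if "a \<in> ?E Q" for a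
    proof -
      have "a \<in> polys X" "a * f \<in> Q'" using that ann EJQ' by auto
      then show ?thesis using pQ' fX by (simp add: primeideal_mpoly_ring_iff)
    qed
    ultimately have "?E Q \<subseteq> Q'" by blast
    then show False using sub by blast
  qed
  ultimately have "?E Q \<in> minimal_primes (mpoly_ring X) (?E J)"
    by (auto simp: minimal_primes_def)
  then have "krull_dim (mpoly_ring X Quot ?E J) = krull_dim (mpoly_ring X Quot ?E Q)"
    using eq by (auto simp: equidimensional_def)
  moreover have "1 \<notin> ?E J" by (rule Idl_proper[OF J Z J1])
  moreover have "1 \<notin> ?E Q" by (rule Idl_proper[OF Qi Z Q1])
  ultimately have "var_dim X (?E J) = var_dim X (?E Q)"
    using krull_dim_eq_var_dim[OF X ideal_Idl[OF JX]] krull_dim_eq_var_dim[OF X ideal_Idl[OF QX]] by simp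
  then have "var_dim (X - Z) J = var_dim (X - Z) Q"
    using var_dim_extension[OF X Z J J1] var_dim_extension[OF X Z Qi Q1] by simp
  then show "krull_dim (mpoly_ring (X - Z) Quot J) = krull_dim (mpoly_ring (X - Z) Quot Q)"
    using krull_dim_eq_var_dim[OF XZ J J1] krull_dim_eq_var_dim[OF XZ Qi Q1] by simp
qed

section \<open>Toric ideals of graphs\<close>

\<comment> \<open>Exponents and indices \<open>1\<close> are to keep the form that they have in the definitions.\<close>
declare One_nat_def [simp del]

text \<open>The exponent vector of the image of a monomial: the degrees of the vertices.\<close>

definition vdeg :: "(nat \<Rightarrow> 'v set) \<Rightarrow> nat mon \<Rightarrow> 'v mon" where
  "vdeg e m = (\<Sum>i\<in>keys m. \<Sum>x\<in>e i. Poly_Mapping.single x (lookup m i))"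

lemma vdeg_superset:
  assumes "finite A" "keys m \<subseteq> A"
  shows "vdeg e m = (\<Sum>i\<in>A. \<Sum>x\<in>e i. Poly_Mapping.single x (lookup m i))"
  unfolding vdeg_def using assms by (intro sum.mono_neutral_left) (auto simp: in_keys_iff)

lemma vdeg_add: "vdeg e (u + v) = vdeg e u + vdeg e v"
proof -
  have "finite (keys u \<union> keys v)" by simp
  note s = vdeg_superset[OF this]
  show ?thesis
    using s[of "u + v" e] s[of u e] s[of v e]
    by (simp add: keys_add_mon lookup_add single_add sum.distrib)
qed

lemma vdeg_zero [simp]: "vdeg e 0 = 0"
  by (simp add: vdeg_def)

lemma vdeg_single: "vdeg e (Poly_Mapping.single i 1) = (\<Sum>x\<in>e i. Poly_Mapping.single x 1)"
  by (simp add: vdeg_def)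

lemma vdeg_edge: "e i = {c, d} \<Longrightarrow> c \<noteq> d \<Longrightarrow>
    vdeg e (Poly_Mapping.single i 1) = Poly_Mapping.single c 1 + Poly_Mapping.single d 1"
  by (simp add: vdeg_single)

lemma lookup_vdeg_pos:
  assumes "lookup (vdeg e m) x > 0"
  obtains i where "i \<in> keys m" "x \<in> e i"
proof -
  have "lookup (vdeg e m) x = (\<Sum>i\<in>keys m. \<Sum>z\<in>e i. lookup (Poly_Mapping.single z (lookup m i)) x)"
    by (simp add: vdeg_def lookup_sum)
  with assms have "(\<Sum>i\<in>keys m. \<Sum>z\<in>e i. lookup (Poly_Mapping.single z (lookup m i)) x) \<noteq> 0"
    by (metis less_irrefl)
  then obtain i where i: "i \<in> keys m" "(\<Sum>z\<in>e i. lookup (Poly_Mapping.single z (lookup m i)) x) \<noteq> 0"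
    by (rule sum.not_neutral_contains_not_neutral)
  from i(2) obtain z where "z \<in> e i" "lookup (Poly_Mapping.single z (lookup m i)) x \<noteq> 0"
    by (rule sum.not_neutral_contains_not_neutral)
  then show ?thesis using that i(1) by (auto simp: lookup_single when_def split: if_splits)
qed

lemma edge_hom_superset:
  fixes f :: "(nat, 'k::field) mpoly" and e :: "nat \<Rightarrow> 'v set"
  assumes "finite A" "keys f \<subseteq> A"
  shows "edge_hom e f = (\<Sum>m\<in>A. Poly_Mapping.single (vdeg e m) (lookup f m))"
proof -
  have sum: "mon_poly (\<Sum>x\<in>B. g x) = (\<Prod>x\<in>B. mon_poly (g x) :: ('v, 'k) mpoly)"
    for B :: "'c set" and g :: "'c \<Rightarrow> 'v mon"
    by (induction B rule: infinite_finite_induct) (simp_all add: mon_poly_add)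
  have "Poly_Mapping.single 0 c * (\<Prod>i\<in>keys m. (\<Prod>x\<in>e i. mvar x) ^ lookup m i) =
      Poly_Mapping.single (vdeg e m) c" for m and c :: 'k
  proof -
    have "(\<Prod>i\<in>keys m. (\<Prod>x\<in>e i. mvar x) ^ lookup m i) = (mon_poly (vdeg e m) :: ('v, 'k) mpoly)"
      unfolding vdeg_def sum prod_power_distrib mvar_power ..
    then show ?thesis by (simp add: mon_poly_def mult_single)
  qed
  then have "edge_hom e f = (\<Sum>m\<in>keys f. Poly_Mapping.single (vdeg e m) (lookup f m))"
    by (simp add: edge_hom_def)
  also have "\<dots> = (\<Sum>m\<in>A. Poly_Mapping.single (vdeg e m) (lookup f m))"
    using assms by (intro sum.mono_neutral_left) (auto simp: in_keys_iff)
  finally show ?thesis .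
qed

lemma edge_hom_add: "edge_hom e (f + g) = edge_hom e f + edge_hom e g"
proof -
  have fin: "finite (keys f \<union> keys g)" by simp
  show ?thesis
    using edge_hom_superset[OF fin, of "f + g" e] edge_hom_superset[OF fin, of f e]
      edge_hom_superset[OF fin, of g e] keys_add[of f g]
    by (simp add: lookup_add single_add sum.distrib)
qed

lemma edge_hom_single_mult:
  "edge_hom e (Poly_Mapping.single u c * f) = Poly_Mapping.single (vdeg e u) c * edge_hom e f"
proof (cases "c = 0")
  case False
  have "edge_hom e (Poly_Mapping.single u c * f)
      = (\<Sum>m\<in>(+) u ` keys f. Poly_Mapping.single (vdeg e m) (lookup (Poly_Mapping.single u c * f) m))"
    using keys_single_mult[OF False, of u f] by (intro edge_hom_superset) auto
  also have "\<dots> = (\<Sum>m\<in>keys f. Poly_Mapping.single (vdeg e (u + m)) (c * lookup f m))"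
    by (subst sum.reindex) (auto simp: inj_on_def)
  also have "\<dots> = Poly_Mapping.single (vdeg e u) c * edge_hom e f"
    by (simp add: edge_hom_superset[OF finite_keys order_refl] sum_distrib_left vdeg_add mult_single)
  finally show ?thesis .
qed (simp add: edge_hom_def)

lemma edge_hom_mon_poly: "edge_hom e (mon_poly u) = mon_poly (vdeg e u)"
  using edge_hom_superset[of "{u}" "mon_poly u" e] by (simp add: mon_poly_def)

lemma toric_ideal_eq: "toric_ideal V e A = {f \<in> polys A. edge_hom e f = 0}"
  by (simp add: toric_ideal_def a_kernel_def kernel_def)

lemma ideal_toric: "ideal (toric_ideal V e A) (mpoly_ring A)"
  unfolding toric_ideal_eq
  by (rule ideal_mpoly_ringI)
     (auto simp: edge_hom_add edge_hom_single_mult polys_closed single_in_polys, simp add: edge_hom_def)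

lemma lookup_binom: "lookup (binom u v :: ('x, 'k::field) mpoly) m = (1 when m = u) - (1 when m = v)"
  by (simp add: binom_def mon_poly_def lookup_minus lookup_single when_def)

lemma keys_binom: "u \<noteq> v \<Longrightarrow> keys (binom u v :: ('x, 'k::field) mpoly) = {u, v}"
  by (auto simp: in_keys_iff lookup_binom when_def split: if_splits)

lemma binom_eq_iff:
  assumes "u \<noteq> v" "binom u v = (binom u' v' :: ('x, 'k::{field_char_0}) mpoly)"
  shows "u' = u" "v' = v"
proof -
  have l: "(1 when m = u) - (1 when m = v) = (1 when m = u') - ((1 when m = v') :: 'k)" for m
    using assms(2) lookup_binom[of u v m, where ?'k = 'k] lookup_binom[of u' v' m, where ?'k = 'k] by simp
  show "u' = u" using l[of u] assms(1) by (auto simp: when_def split: if_splits)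
  show "v' = v" using l[of v] assms(1) by (auto simp: when_def split: if_splits)
qed

lemma lm_binom: "v < u \<Longrightarrow> lm (binom u v :: ('x::linorder, 'k::field) mpoly) = u"
  by (intro lm_eqI) (auto simp: keys_binom)

lemma binom_in_toric_iff:
  assumes "u \<noteq> v"
  shows "(binom u v :: (nat, 'k::field) mpoly) \<in> toric_ideal V e A \<longleftrightarrow>
    u \<in> mons A \<and> v \<in> mons A \<and> vdeg e u = vdeg e v"
proof -
  have "edge_hom e (binom u v :: (nat, 'k) mpoly) + edge_hom e (mon_poly v) = edge_hom e (mon_poly u)"
    unfolding edge_hom_add[symmetric] by (simp add: binom_def)
  then have "edge_hom e (binom u v :: (nat, 'k) mpoly) = mon_poly (vdeg e u) - mon_poly (vdeg e v)"
    unfolding edge_hom_mon_poly by (simp add: eq_diff_eq)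
  moreover have "mon_poly a = (mon_poly b :: ('c, 'k) mpoly) \<longleftrightarrow> a = b" for a b :: "'c mon"
    by (metis keys_single mon_poly_def singleton_inject zero_neq_one)
  ultimately show ?thesis using keys_binom[OF assms, where ?'k = 'k]
    by (auto simp: toric_ideal_eq polys_def)
qed

text \<open>
  The image of the leading term of \<open>f\<close> has to cancel against the image of another term of \<open>f\<close>.
\<close>

lemma toric_lm_fibre:
  fixes f :: "(nat, 'k::field) mpoly"
  assumes f: "f \<in> toric_ideal V e A" "f \<noteq> 0"
  obtains v where "v \<in> mons A" "v < lm f" "vdeg e v = vdeg e (lm f)"
proof -
  have fA: "f \<in> polys A" and 0: "edge_hom e f = 0" using f(1) by (auto simp: toric_ideal_eq)
  let ?K = "{m \<in> keys f. vdeg e m = vdeg e (lm f)}"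
  have "(\<Sum>m\<in>?K. lookup f m) = (\<Sum>m\<in>keys f. lookup (Poly_Mapping.single (vdeg e m) (lookup f m)) (vdeg e (lm f)))"
    by (simp add: lookup_single when_def sum.inter_filter[symmetric])
  also have "\<dots> = lookup (edge_hom e f) (vdeg e (lm f))"
    by (simp add: edge_hom_superset[OF finite_keys order_refl] lookup_sum)
  finally have s: "(\<Sum>m\<in>?K. lookup f m) = 0" using 0 by simp
  have "\<exists>m\<in>?K. m \<noteq> lm f"
  proof (rule ccontr)
    assume "\<not> (\<exists>m\<in>?K. m \<noteq> lm f)"
    then have "?K = {lm f}" using lm_in_keys[OF f(2)] by auto
    then show False using s lookup_lm[OF f(2)] by simp
  qed
  then obtain m where m: "m \<in> keys f" "vdeg e m = vdeg e (lm f)" "m \<noteq> lm f" by auto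
  have "m < lm f" using lm_ge[OF m(1)] m(3) by simp
  then show ?thesis using that m(2) in_polysD[OF fA m(1)] by blast
qed

section \<open>Primitive binomials come from closed even walks\<close>

primrec walk_from :: "(nat \<Rightarrow> 'v set) \<Rightarrow> 'v \<Rightarrow> nat list \<Rightarrow> 'v \<Rightarrow> bool" where
  "walk_from e c [] a \<longleftrightarrow> c = a"
| "walk_from e c (i # w) a \<longleftrightarrow> (\<exists>d. e i = {c, d} \<and> walk_from e d w a)"

lemma walk_from_vertices:
  "walk_from e c w a \<Longrightarrow>
    \<exists>v :: nat \<Rightarrow> 'v. v 0 = c \<and> v (length w) = a \<and> (\<forall>j < length w. e (w ! j) = {v j, v (Suc j)})"
proof (induction w arbitrary: c)
  case Nil
  then show ?case by (intro exI[of _ "\<lambda>_. c"]) simp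
next
  case (Cons i w)
  then obtain d where d: "e i = {c, d}" "walk_from e d w a" by auto
  obtain v where v: "v 0 = d" "v (length w) = a" "\<forall>j < length w. e (w ! j) = {v j, v (Suc j)}"
    using Cons.IH[OF d(2)] by (elim exE conjE)
  have "e ((i # w) ! j) = {case_nat c v j, case_nat c v (Suc j)}" if "j < length (i # w)" for j
    using that v(1,3) d(1) by (cases j) simp_all
  then show ?case using v(2) by (intro exI[of _ "case_nat c v"]) simp
qed

lemma walk_mon_Nil [simp]: "walk_mon_pos [] = 0" "walk_mon_neg [] = 0"
  by (simp_all add: walk_mon_pos_def walk_mon_neg_def)

lemma walk_mon_Cons [simp]:
  "walk_mon_pos (i # w) = Poly_Mapping.single i 1 + walk_mon_neg w"
  "walk_mon_neg (i # w) = walk_mon_pos w"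
proof -
  have "{j. j < length (i # w) \<and> even j} = insert 0 (Suc ` {j. j < length w \<and> odd j})"
    by (auto simp: image_iff less_Suc_eq_0_disj)
  then show "walk_mon_pos (i # w) = Poly_Mapping.single i 1 + walk_mon_neg w"
    unfolding walk_mon_pos_def walk_mon_neg_def by (simp add: sum.reindex)
  have "{j. j < length (i # w) \<and> odd j} = Suc ` {j. j < length w \<and> even j}"
    by (auto simp: image_iff less_Suc_eq_0_disj)
  then show "walk_mon_neg (i # w) = walk_mon_pos w"
    unfolding walk_mon_pos_def walk_mon_neg_def by (simp add: sum.reindex)
qed

lemma mon_split_single: "i \<in> keys m \<Longrightarrow> m = (m - Poly_Mapping.single i 1) + Poly_Mapping.single i (1::nat)"
  by (intro poly_mapping_eqI) (auto simp: lookup_add lookup_minus lookup_single when_def in_keys_iff)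

context
  fixes V :: "'v set" and e :: "nat \<Rightarrow> 'v set" and n :: nat
  assumes graph: "simple_graph V e n"
begin

lemma edge_endpoints:
  assumes "i \<in> {1..n}" "c \<in> e i"
  obtains d where "e i = {c, d}" "c \<noteq> d"
proof -
  have "card (e i) = 2" using graph assms(1) by (simp add: simple_graph_def)
  then obtain a b where "e i = {a, b}" "a \<noteq> b" by (auto simp: card_2_iff)
  then show ?thesis using that[of a] that[of b] assms(2) by (cases "c = a") (auto simp: insert_commute)
qed

lemma vdeg_eq_0:
  assumes "m \<in> mons {1..n}" "vdeg e m = 0"
  shows "m = 0"
proof (rule ccontr)
  assume "m \<noteq> 0"
  then obtain i where i: "i \<in> keys m" using keys_eq_empty[of m] by blast
  then have "i \<in> {1..n}" using assms(1) by (auto simp: mons_def)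
  then have "card (e i) = 2" using graph by (simp add: simple_graph_def)
  then obtain x where x: "x \<in> e i" by fastforce
  have "card (e i) \<noteq> 0" using \<open>card (e i) = 2\<close> by simp
  obtain d where d: "e i = {x, d}" "x \<noteq> d" using edge_endpoints[OF \<open>i \<in> {1..n}\<close> x] .
  have "vdeg e m = vdeg e (m - Poly_Mapping.single i 1) + vdeg e (Poly_Mapping.single i 1)"
    using mon_split_single[OF i] by (metis vdeg_add)
  then have "lookup (vdeg e m) x > 0" by (simp add: vdeg_edge[of e, OF d] lookup_add)
  then show False using assms(2) by simp
qed

text \<open>
  If the vertices have the same degrees in \<open>v\<close> as in \<open>u\<close> plus an edge from \<open>a\<close> to \<open>c\<close>, then a walk that
  leaves \<open>c\<close> along edges of \<open>v\<close> and \<open>u\<close> in turn can only get stuck at \<open>a\<close>, after an edge of \<open>v\<close>.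
\<close>

lemma alternating_walk:
  assumes "u \<in> mons {1..n}" "v \<in> mons {1..n}"
    "vdeg e u + Poly_Mapping.single a 1 + Poly_Mapping.single c 1 = vdeg e v"
  shows "\<exists>w. walk_from e c w a \<and> odd (length w) \<and> set w \<subseteq> {1..n} \<and>
    mon_dvd (walk_mon_pos w) v \<and> mon_dvd (walk_mon_neg w) u \<and>
    vdeg e (walk_mon_pos w) = vdeg e (walk_mon_neg w) + Poly_Mapping.single a 1 + Poly_Mapping.single c 1"
  using assms
proof (induction "\<Sum>i\<in>{1..n}. lookup v i" arbitrary: u v c rule: less_induct)
  case less
  have "lookup (vdeg e v) c > 0" unfolding less.prems(3)[symmetric] by (simp add: lookup_add)
  then obtain i where i: "i \<in> keys v" "c \<in> e i" by (rule lookup_vdeg_pos)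
  have iN: "i \<in> {1..n}" using i(1) less.prems(2) by (auto simp: mons_def)
  obtain d where d: "e i = {c, d}" "c \<noteq> d" using edge_endpoints[OF iN i(2)] .
  define v' where "v' = v - Poly_Mapping.single i 1"
  have v: "v = v' + Poly_Mapping.single i 1" unfolding v'_def by (rule mon_split_single[OF i(1)])
  have v': "v' \<in> mons {1..n}" unfolding v'_def by (rule diff_in_mons[OF less.prems(2)])
  have "vdeg e u + Poly_Mapping.single a 1 + Poly_Mapping.single c 1 =
      vdeg e v' + Poly_Mapping.single d 1 + Poly_Mapping.single c 1"
    using less.prems(3) by (simp add: v vdeg_add vdeg_edge[of e, OF d] ac_simps)
  then have bal: "vdeg e u + Poly_Mapping.single a 1 = vdeg e v' + Poly_Mapping.single d 1" by simp
  show ?case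
  proof (cases "d = a")
    case True
    then have "walk_from e c [i] a" using d(1) by simp
    then show ?thesis using iN True v
      by (intro exI[of _ "[i]"]) (simp add: vdeg_edge[of e, OF d] ac_simps mon_dvd_iff lookup_add)
  next
    case False
    have "lookup (vdeg e u + Poly_Mapping.single a 1) d > 0" unfolding bal by (simp add: lookup_add)
    then have "lookup (vdeg e u) d > 0" using False by (simp add: lookup_add lookup_single when_def)
    then obtain i' where i': "i' \<in> keys u" "d \<in> e i'" by (rule lookup_vdeg_pos)
    have iN': "i' \<in> {1..n}" using i'(1) less.prems(1) by (auto simp: mons_def)
    obtain c' where c': "e i' = {d, c'}" "d \<noteq> c'" using edge_endpoints[OF iN' i'(2)] .
    define u' where "u' = u - Poly_Mapping.single i' 1"
    have u: "u = u' + Poly_Mapping.single i' 1" unfolding u'_def by (rule mon_split_single[OF i'(1)])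
    have u': "u' \<in> mons {1..n}" unfolding u'_def by (rule diff_in_mons[OF less.prems(1)])
    have "vdeg e u' + Poly_Mapping.single a 1 + Poly_Mapping.single c' 1 + Poly_Mapping.single d 1
        = vdeg e v' + Poly_Mapping.single d 1"
      using bal by (simp add: u vdeg_add vdeg_edge[of e, OF c'] ac_simps)
    then have bal': "vdeg e u' + Poly_Mapping.single a 1 + Poly_Mapping.single c' 1 = vdeg e v'" by simp
    have "(\<Sum>j\<in>{1..n}. lookup v j) = (\<Sum>j\<in>{1..n}. lookup v' j) + (\<Sum>j\<in>{1..n}. if j = i then 1 else 0)"
      unfolding sum.distrib[symmetric] by (intro sum.cong) (auto simp: v lookup_add lookup_single when_def)
    then have "(\<Sum>j\<in>{1..n}. lookup v' j) < (\<Sum>j\<in>{1..n}. lookup v j)" using iN by simp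
    from less.hyps[OF this u' v' bal'] obtain w where w: "walk_from e c' w a" "odd (length w)"
      "set w \<subseteq> {1..n}" "mon_dvd (walk_mon_pos w) v'" "mon_dvd (walk_mon_neg w) u'"
      "vdeg e (walk_mon_pos w) = vdeg e (walk_mon_neg w) + Poly_Mapping.single a 1 + Poly_Mapping.single c' 1"
      by (elim exE conjE)
    show ?thesis
    proof (intro exI[of _ "i # i' # w"] conjI)
      show "walk_from e c (i # i' # w) a" using d(1) c'(1) w(1) by auto
      show "odd (length (i # i' # w))" using w(2) by simp
      show "set (i # i' # w) \<subseteq> {1..n}" using w(3) iN iN' by simp
      show "mon_dvd (walk_mon_pos (i # i' # w)) v"
        using w(4) by (simp add: v mon_dvd_iff lookup_add)
      show "mon_dvd (walk_mon_neg (i # i' # w)) u"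
        using w(5) by (simp add: u mon_dvd_iff lookup_add)
      show "vdeg e (walk_mon_pos (i # i' # w)) = vdeg e (walk_mon_neg (i # i' # w)) +
          Poly_Mapping.single a 1 + Poly_Mapping.single c 1"
        by (simp add: vdeg_add w(6) vdeg_edge[of e, OF d] vdeg_edge[of e, OF c'] ac_simps)
    qed
  qed
qed

text \<open>
  An edge of \<open>u\<close> extends to a closed walk that alternates between edges of \<open>u\<close> and \<open>v\<close>.  Its binomial is
  nonzero, because a primitive binomial has disjoint supports; by primitivity it is \<open>u - v\<close>.
\<close>

lemma primitive_in_universal_gb:
  fixes u v :: "nat mon"
  assumes prim: "primitive_binom (toric_ideal V e {1..n} :: (nat, 'k::field) mpoly set) u v"
  shows "(binom u v :: (nat, 'k) mpoly) \<in> universal_gb V e n"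
proof -
  let ?I = "toric_ideal V e {1..n} :: (nat, 'k) mpoly set"
  have uv: "u \<noteq> v" "u \<in> mons {1..n}" "v \<in> mons {1..n}" "vdeg e u = vdeg e v"
    using prim binom_in_toric_iff[of u v, where ?'k = 'k] unfolding primitive_binom_def by blast+
  have prim': "(u', v') = (u, v)"
    if "u' \<noteq> v'" "vdeg e u' = vdeg e v'" "mon_dvd u' u" "mon_dvd v' v" for u' v'
  proof (rule ccontr)
    assume ne: "(u', v') \<noteq> (u, v)"
    have "(binom u' v' :: (nat, 'k) mpoly) \<in> ?I"
      using that(1,2) mon_dvd_in_mons[OF that(3) uv(2)] mon_dvd_in_mons[OF that(4) uv(3)]
      by (simp add: binom_in_toric_iff)
    then show False using prim that(1,3,4) ne unfolding primitive_binom_def by blast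
  qed
  have disjoint: "keys u \<inter> keys v = {}"
  proof (rule ccontr)
    assume "keys u \<inter> keys v \<noteq> {}"
    then obtain i where i: "i \<in> keys u" "i \<in> keys v" by blast
    let ?s = "Poly_Mapping.single i (1::nat)"
    note su = mon_split_single[OF i(1)] and sv = mon_split_single[OF i(2)]
    have "u - ?s \<noteq> v - ?s" using su sv uv(1) by metis
    moreover have "vdeg e (u - ?s) + vdeg e ?s = vdeg e (v - ?s) + vdeg e ?s"
      using uv(4) su sv by (metis vdeg_add)
    then have "vdeg e (u - ?s) = vdeg e (v - ?s)" by simp
    moreover have "mon_dvd (u - ?s) u" "mon_dvd (v - ?s) v" by (simp_all add: mon_dvd_iff lookup_minus)
    ultimately have "u - ?s = u" using prim' by blast
    then have "u + ?s = u" using su by simp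
    then show False by (simp add: single_eq_zero_iff)
  qed
  have "u \<noteq> 0"
  proof
    assume "u = 0"
    then have "v = 0" using uv vdeg_eq_0 by simp
    then show False using uv(1) \<open>u = 0\<close> by simp
  qed
  then obtain i where i: "i \<in> keys u" using keys_eq_empty[of u] by blast
  have iN: "i \<in> {1..n}" using i uv(2) by (auto simp: mons_def)
  have "card (e i) = 2" using graph iN by (simp add: simple_graph_def)
  then obtain a where "a \<in> e i" by fastforce
  then obtain c where c: "e i = {a, c}" "a \<noteq> c" using edge_endpoints[OF iN] by blast
  let ?s = "Poly_Mapping.single i (1::nat)"
  note su = mon_split_single[OF i]
  have "vdeg e (u - ?s) + vdeg e ?s = vdeg e v" using uv(4) su by (metis vdeg_add)
  then have "vdeg e (u - ?s) + Poly_Mapping.single a 1 + Poly_Mapping.single c 1 = vdeg e v"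
    by (simp add: vdeg_edge[of e, OF c] ac_simps)
  from alternating_walk[OF diff_in_mons[OF uv(2)] uv(3) this]
  obtain w where w: "walk_from e c w a" "odd (length w)" "set w \<subseteq> {1..n}"
      "mon_dvd (walk_mon_pos w) v" "mon_dvd (walk_mon_neg w) (u - ?s)"
      "vdeg e (walk_mon_pos w) = vdeg e (walk_mon_neg w) + Poly_Mapping.single a 1 + Poly_Mapping.single c 1"
    by (elim exE conjE)
  let ?w = "i # w"
  have "walk_from e a ?w a" using c(1) w(1) by auto
  from walk_from_vertices[OF this] obtain z where
    z: "z 0 = a" "z (length ?w) = a" "\<forall>j<length ?w. e (?w ! j) = {z j, z (Suc j)}" by (elim exE conjE)
  have cw: "closed_even_walk e n ?w"
    unfolding closed_even_walk_def
  proof (intro conjI exI[of _ z])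
    show "z 0 = z (length ?w)" using z(1,2) by (rule trans[OF _ sym])
    show "\<forall>j<length ?w. e (?w ! j) = {z j, z (Suc j)}" by (rule z(3))
  qed (use w(2,3) iN in simp_all)
  have pos: "mon_dvd (walk_mon_pos ?w) u"
    using w(5) by (subst su) (simp add: mon_dvd_iff lookup_add)
  have neg: "mon_dvd (walk_mon_neg ?w) v" using w(4) by simp
  have deg: "vdeg e (walk_mon_pos ?w) = vdeg e (walk_mon_neg ?w)"
    by (simp add: vdeg_add vdeg_edge[of e, OF c] w(6) ac_simps)
  have ne: "walk_mon_pos ?w \<noteq> walk_mon_neg ?w"
  proof
    assume eq: "walk_mon_pos ?w = walk_mon_neg ?w"
    have "lookup (walk_mon_pos ?w) i > 0" by (simp add: lookup_add)
    moreover have "lookup (walk_mon_pos ?w) i \<le> lookup v i" using neg eq by (simp add: mon_dvd_iff)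
    ultimately have "i \<in> keys v" by (simp add: in_keys_iff)
    then show False using i disjoint by blast
  qed
  have "(walk_mon_pos ?w, walk_mon_neg ?w) = (u, v)" by (rule prim'[OF ne deg pos neg])
  then have "walk_mon_pos ?w = u" "walk_mon_neg ?w = v" by simp_all
  then show ?thesis unfolding universal_gb_def using cw prim by blast
qed

text \<open>
  Take a divisor \<open>u'\<close> of \<open>u\<close> that is minimal among the leading monomials, and the smallest monomial \<open>v'\<close>
  with the same image.  Both choices together exclude a smaller binomial.
\<close>

lemma exists_primitive_divisor:
  assumes u: "u \<in> mons {1..n}" and v: "v \<in> mons {1..n}" "v < u" "vdeg e v = vdeg e u"
  obtains u' v' where "mon_dvd u' u" "v' < u'" "u' \<in> mons {1..n}" "v' \<in> mons {1..n}" "vdeg e u' = vdeg e v'"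
    "primitive_binom (toric_ideal V e {1..n} :: (nat, 'k::field) mpoly set) u' v'"
proof -
  let ?X = "{1..n}"
  define L where "L = {t \<in> mons ?X. mon_dvd t u \<and> (\<exists>s\<in>mons ?X. s < t \<and> vdeg e s = vdeg e t)}"
  have min: "\<exists>z\<in>Q. \<forall>t. t \<in> mons ?X \<and> t < z \<longrightarrow> t \<notin> Q" if "s \<in> Q" "Q \<subseteq> mons ?X" for Q s
  proof -
    have "wf {(a, b :: nat mon). a \<in> mons ?X \<and> b \<in> mons ?X \<and> a < b}" by (rule wf_lex) simp
    from mp[OF spec[OF spec[OF this[unfolded wf_eq_minimal]]] that(1)]
    have "\<exists>z\<in>Q. \<forall>t. (t, z) \<in> {(a, b). a \<in> mons ?X \<and> b \<in> mons ?X \<and> a < b} \<longrightarrow> t \<notin> Q" .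
    then show ?thesis using that(2) by auto
  qed
  have "u \<in> L" using u v by (auto simp: L_def)
  moreover have "L \<subseteq> mons ?X" by (auto simp: L_def)
  ultimately obtain u' where u': "u' \<in> L" and minu: "\<forall>t. t \<in> mons ?X \<and> t < u' \<longrightarrow> t \<notin> L"
    by (rule bexE[OF min])
  obtain s where s: "s \<in> mons ?X" "s < u'" "vdeg e s = vdeg e u'" using u' by (auto simp: L_def)
  define F where "F = {t \<in> mons ?X. vdeg e t = vdeg e u'}"
  have "s \<in> F" using s by (simp add: F_def)
  moreover have "F \<subseteq> mons ?X" by (auto simp: F_def)
  ultimately obtain v' where v': "v' \<in> F" and minv: "\<forall>t. t \<in> mons ?X \<and> t < v' \<longrightarrow> t \<notin> F"
    by (rule bexE[OF min])
  have uX: "u' \<in> mons ?X" "mon_dvd u' u" and vX: "v' \<in> mons ?X" "vdeg e v' = vdeg e u'"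
    using u' v' by (auto simp: L_def F_def)
  have "v' \<le> s"
  proof (rule ccontr)
    assume "\<not> v' \<le> s"
    then show False using spec[OF minv, of s] s(1) \<open>s \<in> F\<close> by simp
  qed
  then have less: "v' < u'" using s(2) by (rule le_less_trans)
  have "primitive_binom (toric_ideal V e ?X :: (nat, 'k) mpoly set) u' v'"
    unfolding primitive_binom_def
  proof (intro conjI notI)
    show "u' = v' \<Longrightarrow> False" using less by simp
    have ne: "u' \<noteq> v'" using less by auto
    show "(binom u' v' :: (nat, 'k) mpoly) \<in> toric_ideal V e ?X"
      unfolding binom_in_toric_iff[OF ne] using uX(1) vX by simp
    assume "\<exists>u'' v''. u'' \<noteq> v'' \<and> (u'', v'') \<noteq> (u', v') \<and>
      (binom u'' v'' :: (nat, 'k) mpoly) \<in> toric_ideal V e ?X \<and> mon_dvd u'' u' \<and> mon_dvd v'' v'"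
    then obtain a b where ab: "a \<noteq> b" "(a, b) \<noteq> (u', v')"
      "(binom a b :: (nat, 'k) mpoly) \<in> toric_ideal V e ?X" "mon_dvd a u'" "mon_dvd b v'" by (elim exE conjE)
    have m: "a \<in> mons ?X" "b \<in> mons ?X" "vdeg e a = vdeg e b"
      using ab(3) unfolding binom_in_toric_iff[OF ab(1)] by blast+
    obtain r where r: "v' = b + r" using ab(5) by (auto simp: mon_dvd_def)
    have rX: "r \<in> mons ?X" using vX(1) r by simp
    show False
    proof (cases "b < a")
      case True
      then have "a \<in> L" using m ab(4) uX(2) mon_dvd_trans[of a u' u] by (auto simp: L_def)
      then have "\<not> a < u'" using spec[OF minu, of a] m(1) by simp
      then have au: "a = u'" using mon_dvd_le[OF ab(4)] by simp
      have "vdeg e b + vdeg e r = vdeg e b" using vX(2) m(3) au by (simp add: r vdeg_add)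
      then have "r = 0" using vdeg_eq_0[OF rX] by simp
      then show False using r au ab(2) by simp
    next
      case False
      then have "a < b" using ab(1) by simp
      then have "a + r < v'" unfolding r by (rule add_strict_right_mono)
      moreover have "a + r \<in> F" using m rX vX(2) by (simp add: F_def r vdeg_add)
      ultimately show False using spec[OF minv, of "a + r"] m(1) rX by simp
    qed
  qed
  then show ?thesis using that uX less vX by simp
qed

end

section \<open>Leading coefficients along the edges\<close>

text \<open>
  The elements of \<open>E\<close> record the variables for which the ideal of leading coefficients is taken; for
  the other variables the ideal is contracted.
\<close>

primrec edge_ideal :: "(nat, 'k::field) mpoly set \<Rightarrow> nat set \<Rightarrow> nat \<Rightarrow> (nat, 'k) mpoly set" where
  "edge_ideal I E 0 = I"
| "edge_ideal I E (Suc k) = (if Suc k \<in> E then all_lead_coeffs (Suc k) (edge_ideal I E k)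
      else lead_coeffs (Suc k) 0 (edge_ideal I E k))"

lemma edge_ideal_cong: "E \<inter> {1..k} = E' \<inter> {1..k} \<Longrightarrow> edge_ideal I E k = edge_ideal I E' k"
proof (induction k)
  case (Suc k)
  have "x \<in> E \<longleftrightarrow> x \<in> E'" if "x \<in> {1..Suc k}" for x using Suc.prems that by blast
  then have "E \<inter> {1..k} = E' \<inter> {1..k}" "Suc k \<in> E \<longleftrightarrow> Suc k \<in> E'" by auto
  then show ?case using Suc.IH by simp
qed simp

lemma edge_ideal_Suc_cases:
  "edge_ideal I E (Suc k) = all_lead_coeffs (Suc k) (edge_ideal I E k) \<and> Suc k \<in> E \<or>
   edge_ideal I E (Suc k) = lead_coeffs (Suc k) 0 (edge_ideal I E k) \<and> Suc k \<notin> E"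
  by simp

lemma remove_first: "{Suc k..n} - {Suc k} = {Suc (Suc k)..n}"
  by auto

lemma ideal_edge_ideal:
  assumes "ideal I (mpoly_ring {1..n})" "k \<le> n"
  shows "ideal (edge_ideal I E k) (mpoly_ring {Suc k..n})"
  using assms(2)
proof (induction k)
  case 0
  then show ?case using assms(1) by (simp add: One_nat_def)
next
  case (Suc k)
  then have J: "ideal (edge_ideal I E k) (mpoly_ring {Suc k..n})" and y: "Suc k \<in> {Suc k..n}" by auto
  show ?case
    using ideal_all_lead_coeffs[OF y J] ideal_lead_coeffs[OF y J, of 0] by (simp add: remove_first)
qed

lemma vcoeff_mon_poly:
  "vcoeff y d (mon_poly m :: ('x, 'k::field) mpoly) = (if lookup m y = d then mon_poly (restr (- {y}) m) else 0)"
proof -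
  have m: "m = Poly_Mapping.single y (lookup m y) + restr (- {y}) m"
    by (intro poly_mapping_eqI) (simp add: lookup_add lookup_single when_def)
  have e: "mon_poly m = mvar y ^ lookup m y * (mon_poly (restr (- {y}) m) :: ('x, 'k) mpoly)"
    using arg_cong[OF m, of "mon_poly :: _ \<Rightarrow> ('x, 'k) mpoly"] by (simp add: mon_poly_add mvar_power)
  have out: "(mon_poly (restr (- {y}) m) :: ('x, 'k) mpoly) \<in> polys (UNIV - {y})"
    by (simp add: mons_lookup)
  show ?thesis
  proof (cases "lookup m y = d")
    case True
    have "vcoeff y (d + 0) (mvar y ^ d * mon_poly (restr (- {y}) m)) =
        (mon_poly (restr (- {y}) m) :: ('x, 'k) mpoly)"
      unfolding vcoeff_mvar_power_mult by (simp only: vcoeff_outside[OF out] simp_thms if_True)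
    then show ?thesis using e True by simp
  next
    case False
    then have "vcoeff y d (mon_poly m :: ('x, 'k) mpoly) = 0"
      unfolding vcoeff_eq_zero_iff by (simp add: mon_poly_def)
    then show ?thesis using False by simp
  qed
qed

lemma restr_remove: "restr (- {Suc k}) (restr {Suc k..n} a) = restr {Suc (Suc k)..n} a"
  by (intro poly_mapping_eqI) (auto simp: le_Suc_eq)

context
  fixes I :: "(nat, 'k::field) mpoly set" and n :: nat
  assumes I: "ideal I (mpoly_ring {1..n})"
begin

lemma squarefree_edge_ideal:
  assumes "squarefree_lms I" "k \<le> n"
  shows "squarefree_lms (edge_ideal I E k)"
  using assms(2)
proof (induction k)
  case (Suc k)
  have J: "ideal (edge_ideal I E k) (mpoly_ring {Suc k..n})"
    using ideal_edge_ideal[OF I] Suc.prems by simp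
  have y: "Suc k \<in> {Suc k..n}" using Suc.prems by simp
  have y': "Suc k \<le> x" if "x \<in> {Suc k..n}" for x using that by simp
  have IH: "squarefree_lms (edge_ideal I E k)" using Suc by simp
  have "squarefree_lms (all_lead_coeffs (Suc k) (edge_ideal I E k))"
    by (rule squarefree_lms_all_lead_coeffs[OF _ y y' J IH]) simp
  moreover have "squarefree_lms (lead_coeffs (Suc k) 0 (edge_ideal I E k))"
    by (rule squarefree_lms_lead_coeffs_0[OF _ y y' J IH]) simp
  ultimately show ?case by simp
qed (use assms(1) in simp)

text \<open>
  Each step removes the powers of one variable from the leading monomials; \<open>\<alpha>\<close> collects what was removed.
\<close>

lemma edge_ideal_lm:
  assumes "k \<le> n" "c \<in> edge_ideal I E k" "c \<noteq> 0"
  shows "\<exists>f\<in>I. f \<noteq> 0 \<and> (\<exists>\<alpha>\<in>mons (E \<inter> {1..k}). lm f = \<alpha> + lm c)"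
  using assms
proof (induction k arbitrary: c)
  case 0
  then show ?case by (intro bexI[of _ c] conjI bexI[of _ 0]) simp_all
next
  case (Suc k)
  have J: "ideal (edge_ideal I E k) (mpoly_ring {Suc k..n})"
    using ideal_edge_ideal[OF I] Suc.prems by simp
  have y: "Suc k \<in> {Suc k..n}" using Suc.prems by simp
  have y': "Suc k \<le> x" if "x \<in> {Suc k..n}" for x using that by simp
  obtain d where c: "c \<in> lead_coeffs (Suc k) d (edge_ideal I E k)" and d: "Suc k \<notin> E \<Longrightarrow> d = 0"
    using edge_ideal_Suc_cases[of I E k] Suc.prems(2) by (auto simp: all_lead_coeffs_def simp del: edge_ideal.simps)
  obtain g where g: "g \<in> edge_ideal I E k" "g \<noteq> 0" "lm g = lm c + Poly_Mapping.single (Suc k) d"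
    using lead_coeffs_lm[OF _ y y' J c Suc.prems(3)] by auto
  obtain f \<alpha> where f: "f \<in> I" "f \<noteq> 0" "\<alpha> \<in> mons (E \<inter> {1..k})" "lm f = \<alpha> + lm g"
    using Suc.IH[OF _ g(1,2)] Suc.prems(1) by auto
  have "Poly_Mapping.single (Suc k) d \<in> mons (E \<inter> {1..Suc k})"
  proof (cases "Suc k \<in> E")
    case True
    then show ?thesis by (intro single_in_mons) simp
  next
    case False
    then show ?thesis using d by simp
  qed
  moreover have "\<alpha> \<in> mons (E \<inter> {1..Suc k})" using f(3) by (rule mons_mono[rotated]) auto
  ultimately have "\<alpha> + Poly_Mapping.single (Suc k) d \<in> mons (E \<inter> {1..Suc k})" by simp
  moreover have "lm f = (\<alpha> + Poly_Mapping.single (Suc k) d) + lm c" by (simp add: f(4) g(3) ac_simps)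
  ultimately show ?case using f(1,2) by blast
qed

lemma edge_ideal_contraction: "k \<le> n \<Longrightarrow> I \<inter> polys {Suc k..n} \<subseteq> edge_ideal I E k"
proof (induction k)
  case (Suc k)
  have J: "ideal (edge_ideal I E k) (mpoly_ring {Suc k..n})"
    using ideal_edge_ideal[OF I] Suc.prems by simp
  have y: "Suc k \<in> {Suc k..n}" using Suc.prems by simp
  have IH: "I \<inter> polys {Suc k..n} \<subseteq> edge_ideal I E k" using Suc.IH Suc.prems by simp
  have "I \<inter> polys {Suc (Suc k)..n} \<subseteq> edge_ideal I E k \<inter> polys {Suc (Suc k)..n}"
    using IH polys_mono[of "{Suc (Suc k)..n}" "{Suc k..n}"] by auto
  also have "\<dots> = lead_coeffs (Suc k) 0 (edge_ideal I E k)"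
    using lead_coeffs_0[OF y J] by (simp add: remove_first)
  also have "\<dots> \<subseteq> edge_ideal I E (Suc k)" by (auto simp: all_lead_coeffs_def)
  finally show ?case .
qed simp

text \<open>
  Following a binomial \<open>a - b\<close> with leading monomial \<open>a\<close> through the successive leading coefficients: as long
  as the removed parts of \<open>a\<close> and \<open>b\<close> agree both terms survive, and then only the first one.
\<close>

lemma edge_ideal_binomial:
  assumes ab: "a \<in> mons {1..n}" "b \<in> mons {1..n}" "b < a" "binom a b \<in> I"
    and k: "k \<le> n" "restr {1..k} a \<in> mons E"
  shows "mon_poly (restr {Suc k..n} a) - (if restr {1..k} a = restr {1..k} b
    then mon_poly (restr {Suc k..n} b) else 0) \<in> edge_ideal I E k"
  using k
proof (induction k)
  case 0
  have "restr {1..0} a = restr {1..0} b" by (intro poly_mapping_eqI) simp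
  moreover have "restr {Suc 0..n} a = a" "restr {Suc 0..n} b = b"
    using ab(1,2) restr_id[of _ "{1..n}"] by (simp_all add: One_nat_def)
  ultimately show ?case using ab(4) by (simp add: binom_def)
next
  case (Suc k)
  let ?y = "Suc k" and ?J = "edge_ideal I E k"
  have J: "ideal ?J (mpoly_ring {Suc k..n})" using ideal_edge_ideal[OF I] Suc.prems by simp
  have y: "?y \<in> {Suc k..n}" using Suc.prems by simp
  define ay where "ay = lookup a ?y"
  define h :: "(nat, 'k) mpoly" where "h = mon_poly (restr {Suc k..n} a) -
    (if restr {1..k} a = restr {1..k} b then mon_poly (restr {Suc k..n} b) else 0)"
  have "restr {1..k} a \<in> mons E"
  proof -
    have "restr {1..k} (restr {1..Suc k} a) \<in> mons E"
      by (rule restr_in_mons'[OF Suc.prems(2)])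
    moreover have "restr {1..k} (restr {1..Suc k} a) = restr {1..k} a"
      by (intro poly_mapping_eqI) auto
    ultimately show ?thesis by simp
  qed
  then have h: "h \<in> ?J" unfolding h_def using Suc.IH Suc.prems(1) by simp
  have E: "ay = 0" if "?y \<notin> E"
    using Suc.prems(2) that unfolding mons_lookup ay_def by (auto dest: spec[of _ ?y])
  have split: "restr {1..Suc k} a = restr {1..Suc k} b \<longleftrightarrow>
      restr {1..k} a = restr {1..k} b \<and> lookup a ?y = lookup b ?y"
  proof
    assume *: "restr {1..Suc k} a = restr {1..Suc k} b"
    then have l: "lookup a x = lookup b x" if "x \<in> {1..Suc k}" for x
      using that lookup_restr[of "{1..Suc k}" a x] lookup_restr[of "{1..Suc k}" b x] by simp
    have "restr {1..k} a = restr {1..k} b" by (intro poly_mapping_eqI) (simp add: l)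
    then show "restr {1..k} a = restr {1..k} b \<and> lookup a ?y = lookup b ?y" using l[of ?y] by simp
  next
    assume *: "restr {1..k} a = restr {1..k} b \<and> lookup a ?y = lookup b ?y"
    then have l: "lookup a x = lookup b x" if "x \<in> {1..k}" for x
      using that lookup_restr[of "{1..k}" a x] lookup_restr[of "{1..k}" b x] by simp
    show "restr {1..Suc k} a = restr {1..Suc k} b"
      using * l by (intro poly_mapping_eqI) (auto simp: le_Suc_eq)
  qed
  have le: "lookup b ?y \<le> ay" if eq: "restr {1..k} a = restr {1..k} b"
  proof (rule ccontr)
    assume "\<not> lookup b ?y \<le> ay"
    then have lt: "lookup a ?y < lookup b ?y" by (simp add: ay_def)
    have "lookup a x = lookup b x" if "x < ?y" for x
    proof (cases "x \<in> {1..k}")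
      case True
      then show ?thesis using eq lookup_restr[of "{1..k}" a x] lookup_restr[of "{1..k}" b x] by simp
    next
      case False
      then have "x \<notin> {1..n}" using that by auto
      then show ?thesis using ab(1,2) by (simp add: mons_lookup)
    qed
    then have "a < b" unfolding less_poly_mapping.rep_eq less_fun_def using lt by blast
    then show False using ab(3) by simp
  qed
  have v: "vcoeff ?y d h = (if ay = d then mon_poly (restr {Suc (Suc k)..n} a) else 0) -
      (if restr {1..k} a = restr {1..k} b \<and> lookup b ?y = d
        then mon_poly (restr {Suc (Suc k)..n} b) else 0)" for d
    unfolding h_def slice_diff using y
    by (simp add: vcoeff_mon_poly restr_remove ay_def)
  have "vcoeff ?y j h = 0" if "j > ay" for j using that le unfolding v by auto
  then have "vcoeff ?y ay h \<in> lead_coeffs ?y ay ?J" using h by (auto simp: lead_coeffs_def)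
  then have "vcoeff ?y ay h \<in> edge_ideal I E (Suc k)" using E by (auto simp: all_lead_coeffs_def)
  moreover have "vcoeff ?y ay h = mon_poly (restr {Suc (Suc k)..n} a) -
      (if restr {1..Suc k} a = restr {1..Suc k} b then mon_poly (restr {Suc (Suc k)..n} b) else 0)"
    unfolding v split by (auto simp: ay_def)
  ultimately show ?case by simp
qed

end

text \<open>
  In an elimination order, a monomial below one in the small variables involves only these variables.
\<close>

lemma lex_less_in_mons:
  fixes u v :: "'x::linorder mon"
  assumes "v < u" "u \<in> mons X'" "v \<in> mons X" "\<And>x x'. x \<in> X - X' \<Longrightarrow> x' \<in> X' \<Longrightarrow> x < x'"
  shows "v \<in> mons X'"
  unfolding mons_lookup
proof (intro allI impI)
  fix x assume x: "x \<notin> X'"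
  obtain k where k: "lookup v k < lookup u k" "\<And>k'. k' < k \<Longrightarrow> lookup v k' = lookup u k'"
    using assms(1) by (auto simp: less_poly_mapping.rep_eq less_fun_def)
  have kX: "k \<in> X'"
  proof (rule ccontr)
    assume "k \<notin> X'"
    then have "lookup u k = 0" using assms(2) by (simp add: mons_lookup)
    then show False using k(1) by simp
  qed
  show "lookup v x = 0"
  proof (cases "x \<in> X")
    case True
    then have "lookup v x = lookup u x" using assms(4)[of x k] x kX k(2) by simp
    then show ?thesis using x assms(2) by (simp add: mons_lookup)
  next
    case False
    then show ?thesis using assms(3) by (simp add: mons_lookup)
  qed
qed

section \<open>Generators of the iterated coefficient ideals\<close>

text \<open>
  The monomials that generate \<open>M_ideal\<close>.  The first argument fixes the field of the polynomials.
\<close>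

definition M_monomials :: "'k::field itself \<Rightarrow> 'v set \<Rightarrow> (nat \<Rightarrow> 'v set) \<Rightarrow> nat \<Rightarrow> nat set \<Rightarrow> nat set \<Rightarrow> nat mon set" where
  "M_monomials _ V e n E F = {m. \<exists>l p.
     (binom (m + l) p :: (nat, 'k) mpoly) \<in> universal_gb V e n \<and>
     init_term (lex_order n) (binom (m + l) p :: (nat, 'k) mpoly) = mon_poly (m + l) \<and>
     keys l \<noteq> {} \<and> keys l \<subseteq> E \<and>
     keys (m + l) \<inter> F = {} \<and> keys m \<inter> E = {}}"

lemma M_ideal_eq: "(M_ideal V e n E F :: (nat, 'k::field) mpoly set) =
    Idl\<^bsub>mpoly_ring {1..n}\<^esub> (mon_poly ` M_monomials TYPE('k) V e n E F)"
  unfolding M_ideal_def M_monomials_def by (rule arg_cong[where f = "\<lambda>S. Idl\<^bsub>mpoly_ring {1..n}\<^esub> S"]) auto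

context
  fixes V :: "'v set" and e :: "nat \<Rightarrow> 'v set" and n :: nat and IG :: "(nat, 'k::field_char_0) mpoly set"
  assumes graph: "simple_graph V e n" and IG: "IG = toric_ideal V e {1..n}"
begin

lemma ideal_IG: "ideal IG (mpoly_ring {1..n})"
  unfolding IG by (rule ideal_toric)

text \<open>
  The leading monomial \<open>m + l\<close> of a primitive binomial and its other monomial \<open>p\<close> do not have the same part
  \<open>l\<close> in the first \<open>k\<close> variables, since otherwise \<open>l\<close> could be cancelled.  So \<open>p\<close> disappears in the leading
  coefficients, and \<open>m\<close> remains.
\<close>

lemma M_monomial_in_edge_ideal:
  assumes k: "k \<le> n" and E: "E \<subseteq> {1..k}"
    and m: "m \<in> M_monomials TYPE('k) V e n E ({1..k} - E)"
  shows "mon_poly m \<in> edge_ideal IG E k" "m \<in> mons {Suc k..n}"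
proof -
  obtain l p where g: "(binom (m + l) p :: (nat, 'k) mpoly) \<in> universal_gb V e n"
    and it: "init_term (lex_order n) (binom (m + l) p :: (nat, 'k) mpoly) = mon_poly (m + l)"
    and l: "keys l \<noteq> {}" "keys l \<subseteq> E" and F: "keys (m + l) \<inter> ({1..k} - E) = {}" "keys m \<inter> E = {}"
    using m unfolding M_monomials_def by auto
  obtain w where w: "binom (m + l) p = (binom (walk_mon_pos w) (walk_mon_neg w) :: (nat, 'k) mpoly)"
    and prim: "primitive_binom IG (walk_mon_pos w) (walk_mon_neg w)"
    using g unfolding universal_gb_def IG by blast
  have ne: "walk_mon_pos w \<noteq> walk_mon_neg w" using prim by (simp add: primitive_binom_def)
  from binom_eq_iff[OF ne w[symmetric]] prim have prim: "primitive_binom IG (m + l) p" by simp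
  then have p: "m + l \<noteq> p" "binom (m + l) p \<in> IG" by (auto simp: primitive_binom_def)
  then have mons: "m + l \<in> mons {1..n}" "p \<in> mons {1..n}" "vdeg e (m + l) = vdeg e p"
    using binom_in_toric_iff[OF p(1), where ?'k = 'k] unfolding IG by blast+
  show m': "m \<in> mons {Suc k..n}"
  proof -
    have "x \<in> {Suc k..n}" if x: "x \<in> keys m" for x
    proof -
      have "x \<in> {1..n}" using mons(1) x by (auto simp: mons_def keys_add_mon)
      moreover have "x \<notin> {1..k}" using F x by (auto simp: keys_add_mon)
      ultimately show ?thesis by auto
    qed
    then show ?thesis by (auto simp: mons_def)
  qed
  have l': "l \<in> mons {1..k}" using l(2) E by (auto simp: mons_def)
  have less: "p < m + l"
  proof (rule ccontr)
    assume "\<not> p < m + l"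
    then have lt: "m + l < p" using p(1) by simp
    let ?b = "binom (m + l) p :: (nat, 'k) mpoly"
    have "lm ?b = p" using lt by (intro lm_eqI) (auto simp: keys_binom[OF p(1)])
    moreover have "?b \<in> polys {1..n}" using ideal_polysD[OF ideal_IG p(2)] .
    ultimately have "init_term (lex_order n) ?b = Poly_Mapping.single p (lookup ?b p)"
      using init_term_lexo[of ?b "{1..n}"] by (simp add: lex_order_eq)
    moreover have "lookup ?b p = - 1" using p(1) by (simp add: lookup_binom when_def)
    ultimately have "Poly_Mapping.single p (- 1) = (mon_poly (m + l) :: (nat, 'k) mpoly)" using it by simp
    then have "keys (Poly_Mapping.single p (- 1) :: (nat, 'k) mpoly) = keys (mon_poly (m + l) :: (nat, 'k) mpoly)"
      by simp
    then show False using p(1) by (simp add: mon_poly_def)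
  qed
  have low: "restr {1..k} (m + l) = l"
  proof -
    have "restr {1..k} m = 0" using m' by (intro poly_mapping_eqI) (simp add: mons_lookup)
    then show ?thesis using restr_id[OF l'] by (simp add: restr_add)
  qed
  have high: "restr {Suc k..n} (m + l) = m"
  proof -
    have "restr {Suc k..n} l = 0" using l' by (intro poly_mapping_eqI) (simp add: mons_lookup)
    then show ?thesis using restr_id[OF m'] by (simp add: restr_add)
  qed
  have "restr {1..k} (m + l) \<noteq> restr {1..k} p"
  proof
    assume eq: "restr {1..k} (m + l) = restr {1..k} p"
    let ?q = "restr (- {1..k}) p"
    have pq: "p = l + ?q" using restr_split[of "{1..k}" p] eq low by simp
    have "vdeg e l + vdeg e m = vdeg e l + vdeg e ?q"
      using mons(3) pq by (metis vdeg_add add.commute)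
    then have "vdeg e m = vdeg e ?q" by simp
    moreover have "m \<noteq> ?q" using p(1) pq by (metis add.commute)
    moreover have "?q \<in> mons {1..n}" using mons(2) by (rule restr_in_mons')
    moreover have "m \<in> mons {1..n}" using mons(1) by simp
    ultimately have "binom m ?q \<in> IG" unfolding IG by (simp add: binom_in_toric_iff)
    moreover have "(m, ?q) \<noteq> (m + l, p)" using l(1) by auto
    moreover have "mon_dvd m (m + l)" by simp
    moreover have "mon_dvd ?q p" by (subst pq) simp
    ultimately show False using prim \<open>m \<noteq> ?q\<close> unfolding primitive_binom_def by blast
  qed
  moreover have "restr {1..k} (m + l) \<in> mons E" using low l(2) by (simp add: mons_def)
  ultimately show "mon_poly m \<in> edge_ideal IG E k"
    using edge_ideal_binomial[OF ideal_IG mons(1,2) less p(2) k, of E] high by simp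
qed

text \<open>
  The leading monomial of an element of the iterated coefficient ideal is divisible by the leading
  monomial of some primitive binomial from which the first \<open>k\<close> variables have been removed.  If nothing had
  to be removed, then this is a binomial in the remaining variables; otherwise it yields a monomial of
  \<open>M_monomials\<close>.
\<close>

lemma edge_ideal_generators:
  assumes k: "k \<le> n" and E: "E \<subseteq> {1..k}"
  shows "Idl\<^bsub>mpoly_ring {Suc k..n}\<^esub> (toric_ideal V e {Suc k..n} \<union>
    mon_poly ` M_monomials TYPE('k) V e n E ({1..k} - E)) = edge_ideal IG E k"
proof (rule ideal_generated_by_leading)
  let ?F = "{1..k} - E"
  show "finite {Suc k..n}" by simp
  show "ideal (edge_ideal IG E k) (mpoly_ring {Suc k..n})" by (rule ideal_edge_ideal[OF ideal_IG k])
  have "toric_ideal V e {Suc k..n} \<subseteq> edge_ideal IG E k"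
  proof -
    have "toric_ideal V e {Suc k..n} \<subseteq> IG \<inter> polys {Suc k..n}"
      unfolding IG toric_ideal_eq using polys_mono[of "{Suc k..n}" "{1..n}"] by auto
    then show ?thesis using edge_ideal_contraction[OF ideal_IG k] by blast
  qed
  then show "toric_ideal V e {Suc k..n} \<union> mon_poly ` M_monomials TYPE('k) V e n E ?F \<subseteq> edge_ideal IG E k"
    using M_monomial_in_edge_ideal(1)[OF k E] by auto
  fix c assume c: "c \<in> edge_ideal IG E k" "c \<noteq> 0"
  obtain f \<alpha> where f: "f \<in> IG" "f \<noteq> 0" "\<alpha> \<in> mons (E \<inter> {1..k})" "lm f = \<alpha> + lm c"
    using edge_ideal_lm[OF ideal_IG k c] by auto
  have lmf: "lm f \<in> mons {1..n}" using lm_in_mons[OF ideal_polysD[OF ideal_IG f(1)] f(2)] .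
  obtain v where v: "v \<in> mons {1..n}" "v < lm f" "vdeg e v = vdeg e (lm f)"
    using toric_lm_fibre[of f V e "{1..n}"] f(1,2) unfolding IG by auto
  obtain u' v' where u': "mon_dvd u' (lm f)" "v' < u'" "u' \<in> mons {1..n}" "v' \<in> mons {1..n}"
      "vdeg e u' = vdeg e v'" "primitive_binom IG u' v'"
    using exists_primitive_divisor[OF graph lmf v, where ?'k = 'k] unfolding IG by blast
  have ne: "u' \<noteq> v'" using u'(2) by auto
  have gb: "(binom u' v' :: (nat, 'k) mpoly) \<in> universal_gb V e n"
    using primitive_in_universal_gb[OF graph] u'(6) unfolding IG by blast
  define l where "l = restr {1..k} u'"
  define m where "m = restr (- {1..k}) u'"
  have u'eq: "u' = m + l" using restr_split[of "{1..k}" u'] by (simp add: l_def m_def add.commute)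
  have mX: "m \<in> mons {Suc k..n}"
    unfolding m_def mons_lookup using u'(3) by (auto simp: mons_lookup)
  have dvd: "mon_dvd m (lm c)"
    unfolding mon_dvd_iff
  proof
    fix x
    show "lookup m x \<le> lookup (lm c) x"
    proof (cases "x \<in> {1..k}")
      case False
      then have "lookup \<alpha> x = 0" using f(3) by (simp add: mons_lookup)
      then have "lookup u' x \<le> lookup (lm c) x"
        using u'(1) by (simp add: f(4) mon_dvd_iff lookup_add) (metis add.left_neutral)
      then show ?thesis by (simp add: m_def)
    qed (simp add: m_def)
  qed
  have lE: "keys l \<subseteq> E"
  proof
    fix x assume x: "x \<in> keys l"
    show "x \<in> E"
    proof (rule ccontr)
      assume xE: "x \<notin> E"
      have xk: "x \<in> {1..k}" "lookup u' x \<noteq> 0" using x by (auto simp: l_def in_keys_iff split: if_splits)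
      have "lookup \<alpha> x = 0" using f(3) xE by (simp add: mons_lookup)
      moreover have "lookup (lm c) x = 0"
      proof -
        have "lm c \<in> mons {Suc k..n}"
          using lm_in_mons[OF ideal_polysD[OF ideal_edge_ideal[OF ideal_IG k] c(1)] c(2)] .
        then show ?thesis using xk(1) by (simp add: mons_lookup)
      qed
      moreover have "lookup u' x \<le> lookup (lm f) x" using u'(1) by (simp add: mon_dvd_iff)
      ultimately show False using xk(2) by (simp add: f(4) lookup_add)
    qed
  qed
  show "\<exists>g\<in>(toric_ideal V e {Suc k..n} :: (nat, 'k) mpoly set) \<union>
      mon_poly ` M_monomials TYPE('k) V e n E ?F.
      g \<noteq> 0 \<and> mon_dvd (lm g) (lm c)"
  proof (cases "l = 0")
    case True
    then have um: "u' = m" by (simp add: u'eq)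
    have "v' \<in> mons {Suc k..n}"
      using u'(2) mX u'(4) unfolding um by (rule lex_less_in_mons) auto
    then have "(binom u' v' :: (nat, 'k) mpoly) \<in> toric_ideal V e {Suc k..n}"
      unfolding binom_in_toric_iff[OF ne] using u'(5) mX um by simp
    moreover have "(binom u' v' :: (nat, 'k) mpoly) \<noteq> 0"
      using keys_binom[OF ne, where ?'k = 'k] by auto
    moreover have "mon_dvd (lm (binom u' v' :: (nat, 'k) mpoly)) (lm c)"
      using lm_binom[OF u'(2), where ?'k = 'k] dvd um by simp
    ultimately show ?thesis by (intro bexI[of _ "binom u' v' :: (nat, 'k) mpoly"] conjI UnI1)
  next
    case False
    have pX: "(binom u' v' :: (nat, 'k) mpoly) \<in> polys {1..n}"
      using u'(3,4) keys_binom[OF ne, where ?'k = 'k] by (simp add: polys_def)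
    have "init_term (lex_order n) (binom u' v' :: (nat, 'k) mpoly) = mon_poly u'"
      using init_term_lexo[OF pX] lm_binom[OF u'(2), where ?'k = 'k] ne
      by (simp add: lex_order_eq lookup_binom when_def mon_poly_def)
    moreover have "keys (m + l) \<inter> ?F = {}"
    proof -
      have "keys m \<inter> {1..k} = {}" using mX by (auto simp: mons_def)
      then show ?thesis using lE by (auto simp: keys_add_mon)
    qed
    moreover have "keys m \<inter> E = {}"
    proof -
      have "keys m \<inter> {1..k} = {}" using mX by (auto simp: mons_def)
      then show ?thesis using E by blast
    qed
    ultimately have "m \<in> M_monomials TYPE('k) V e n E ?F"
      unfolding M_monomials_def using gb lE False u'eq
      by (intro CollectI exI[of _ l] exI[of _ v']) simp
    moreover have "(mon_poly m :: (nat, 'k) mpoly) \<noteq> 0" by (simp add: mon_poly_def single_eq_zero_iff)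
    moreover have "mon_dvd (lm (mon_poly m :: (nat, 'k) mpoly)) (lm c)"
      using dvd by (simp add: mon_poly_def)
    ultimately show ?thesis by (intro bexI[of _ "mon_poly m :: (nat, 'k) mpoly"] conjI UnI2 imageI)
  qed
qed

lemma I_ideal_eq_extension:
  assumes k: "k \<le> n" and E: "E \<subseteq> {1..k}"
  shows "(I_ideal V e n E ({1..k} - E) :: (nat, 'k) mpoly set) =
    Idl\<^bsub>mpoly_ring {1..n}\<^esub> (edge_ideal IG E k)"
proof -
  let ?M = "mon_poly ` M_monomials TYPE('k) V e n E ({1..k} - E) :: (nat, 'k) mpoly set"
  let ?T = "toric_ideal V e {Suc k..n} :: (nat, 'k) mpoly set"
  have "{1..n} - (E \<union> ({1..k} - E)) = {Suc k..n}" using E k by auto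
  then have "I_ideal V e n E ({1..k} - E) =
      Idl\<^bsub>mpoly_ring {1..n}\<^esub> ?T <+>\<^bsub>mpoly_ring {1..n}\<^esub> Idl\<^bsub>mpoly_ring {1..n}\<^esub> ?M"
    by (simp add: I_ideal_def M_ideal_eq)
  have TX: "?T \<subseteq> polys {Suc k..n}" by (auto simp: toric_ideal_eq)
  have MX: "?M \<subseteq> polys {Suc k..n}" using M_monomial_in_edge_ideal(2)[OF k E] by auto
  have sub: "{Suc k..n} \<subseteq> {1..n}" by auto
  have "I_ideal V e n E ({1..k} - E) = Idl\<^bsub>mpoly_ring {1..n}\<^esub> (?T \<union> ?M)"
    using Idl_Un[of ?T "{1..n}" ?M] TX MX polys_mono[OF sub] \<open>I_ideal V e n E ({1..k} - E) = _\<close> by blast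
  also have "\<dots> = Idl\<^bsub>mpoly_ring {1..n}\<^esub> (Idl\<^bsub>mpoly_ring {Suc k..n}\<^esub> (?T \<union> ?M))"
    using TX MX by (intro Idl_Idl[symmetric] sub) simp
  finally show ?thesis unfolding edge_ideal_generators[OF k E] .
qed

end

lemma ideal_monomial_multiples:
  fixes S :: "'x mon set"
  shows "ideal {f \<in> polys X. \<forall>m\<in>keys f. \<exists>s\<in>S. mon_dvd s m} (mpoly_ring X :: ('x, 'k::field) mpoly ring)"
proof (rule ideal_mpoly_ringI)
  fix f g :: "('x, 'k) mpoly"
  assume "f \<in> {f \<in> polys X. \<forall>m\<in>keys f. \<exists>s\<in>S. mon_dvd s m}" "g \<in> {f \<in> polys X. \<forall>m\<in>keys f. \<exists>s\<in>S. mon_dvd s m}"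
  then show "f + g \<in> {f \<in> polys X. \<forall>m\<in>keys f. \<exists>s\<in>S. mon_dvd s m}"
    using keys_add[of f g] by (auto simp: add_in_polys)
next
  fix f :: "('x, 'k) mpoly" and w c
  assume f: "f \<in> {f \<in> polys X. \<forall>m\<in>keys f. \<exists>s\<in>S. mon_dvd s m}" and w: "w \<in> mons X"
  have "\<exists>s\<in>S. mon_dvd s m" if m: "m \<in> keys (Poly_Mapping.single w c * f)" for m
  proof -
    have "c \<noteq> 0" using m by auto
    then obtain u where u: "m = w + u" "u \<in> keys f" using m by (auto simp: keys_single_mult)
    then obtain s where "s \<in> S" "mon_dvd s u" using f by auto
    then show ?thesis using mon_dvd_trans[of s u m] by (auto simp: u(1))
  qed
  then show "Poly_Mapping.single w c * f \<in> {f \<in> polys X. \<forall>m\<in>keys f. \<exists>s\<in>S. mon_dvd s m}"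
    using f w by (auto intro!: mult_in_polys single_in_polys)
qed auto

text \<open>
  A monomial ideal contains a polynomial only if each of its monomials is divisible by a generator.  So
  a leading monomial is divisible by a square-free generator, which in turn is divisible by a leading
  monomial.
\<close>

lemma squarefree_initial_ideal_lms:
  fixes J :: "('x::linorder, 'k::field) mpoly set"
  assumes J: "ideal J (mpoly_ring X)"
    and sf: "squarefree_monomial_ideal X (init_ideal X (lexo X) J)"
  shows "squarefree_lms J"
  unfolding squarefree_lms_def
proof (intro ballI impI)
  obtain S where S: "S \<subseteq> {m \<in> mons X. \<forall>x. lookup m x \<le> 1}"
    and IS: "init_ideal X (lexo X) J = Idl\<^bsub>mpoly_ring X\<^esub> (mon_poly ` S)"
    using sf unfolding squarefree_monomial_ideal_def by blast
  have it: "init_term (lexo X) g = Poly_Mapping.single (lm g) (lookup g (lm g))" if "g \<in> J" for g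
    using init_term_lexo ideal_polysD[OF J that] by blast
  have itX: "init_term (lexo X) ` J \<subseteq> polys X"
  proof (rule image_subsetI)
    fix g assume g: "g \<in> J"
    then show "init_term (lexo X) g \<in> polys X"
      using it[OF g] lm_in_mons[OF ideal_polysD[OF J g]] by (cases "g = 0") (auto simp: single_in_polys)
  qed
  have SX: "mon_poly ` S \<subseteq> (polys X :: ('x, 'k) mpoly set)" using S by auto
  fix f assume f: "f \<in> J" "f \<noteq> 0"
  have "init_term (lexo X) f \<in> Idl\<^bsub>mpoly_ring X\<^esub> (mon_poly ` S)"
    using Idl_superset[OF itX] f(1) unfolding IS[symmetric] init_ideal_def by blast
  also have "Idl\<^bsub>mpoly_ring X\<^esub> (mon_poly ` S) \<subseteq>
      {f :: ('x, 'k) mpoly. f \<in> polys X \<and> (\<forall>m\<in>keys f. \<exists>s\<in>S. mon_dvd s m)}"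
    using SX by (intro Idl_least ideal_monomial_multiples) (auto simp: mon_poly_def intro: mon_dvd_refl)
  finally obtain s where s: "s \<in> S" "mon_dvd s (lm f)"
    using f it[OF f(1)] lookup_lm[OF f(2)] by auto
  have "mon_poly s \<in> Idl\<^bsub>mpoly_ring X\<^esub> (init_term (lexo X) ` J)"
    using Idl_superset[OF SX] s(1) unfolding IS[symmetric] init_ideal_def by blast
  also have "Idl\<^bsub>mpoly_ring X\<^esub> (init_term (lexo X) ` J) \<subseteq>
      {f :: ('x, 'k) mpoly. f \<in> polys X \<and> (\<forall>m\<in>keys f. \<exists>s\<in>lm ` (J - {0}). mon_dvd s m)}"
  proof (intro Idl_least ideal_monomial_multiples image_subsetI CollectI conjI ballI)
    fix g m assume g: "g \<in> J" and m: "m \<in> keys (init_term (lexo X) g)"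
    then have "m = lm g" "g \<noteq> 0" using it[OF g] by (auto split: if_splits)
    then show "\<exists>s\<in>lm ` (J - {0}). mon_dvd s m" using g by (intro bexI[of _ "lm g"]) auto
  qed (use itX in blast)
  finally obtain g where g: "g \<in> J" "g \<noteq> 0" "mon_dvd (lm g) s"
    by (auto simp: mon_poly_def)
  have "lookup (lm g) x \<le> 1" for x
  proof -
    have "lookup (lm g) x \<le> lookup s x" using g(3) by (simp add: mon_dvd_iff)
    also have "\<dots> \<le> 1" using S s(1) by auto
    finally show ?thesis .
  qed
  then show "\<exists>g\<in>J. g \<noteq> 0 \<and> mon_dvd (lm g) (lm f) \<and> (\<forall>x. lookup (lm g) x \<le> 1)"
    using g mon_dvd_trans[OF g(3) s(2)] by blast
qed

lemma gvd_no_variables: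
  fixes J :: "('x, 'k::field) mpoly set"
  assumes J: "ideal J (mpoly_ring {})"
  shows "gvd {} J"
proof (cases "1 \<in> J")
  case True
  then have "J = carrier (mpoly_ring {})" using ideal_eq_carrier_iff[OF J] by simp
  then show ?thesis using gvd.const_unit by simp
next
  case False
  have "J = {0}"
    using indepD[OF indep_empty[OF J False]] ideal_polysD[OF J] ideal_zero[OF J] by blast
  then show ?thesis using gvd.const by simp
qed

section \<open>Toric ideals of graphs with square-free degenerations\<close>

theorem theorem6p6:
  fixes V :: "'v set" and e :: "nat \<Rightarrow> 'v set" and n :: nat
    and IG :: "(nat, 'k :: {alg_closed_field, field_char_0}) mpoly set"
  assumes "simple_graph V e n"
    and "IG = toric_ideal V e {1..n}"
    and "squarefree_monomial_ideal {1..n} (init_ideal {1..n} (lex_order n) IG)"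
    and "\<And>E F l. \<lbrakk>l \<le> n; E \<inter> F = {}; E \<union> F = {1..l}\<rbrakk> \<Longrightarrow>
           equidimensional (mpoly_ring {1..n}) (I_ideal V e n E F :: (nat, 'k) mpoly set)"
  shows "gvd {1..n} IG"
proof -
  note graph = assms(1) and IG = assms(2)
  have I: "ideal IG (mpoly_ring {1..n})" by (rule ideal_IG[OF graph IG])
  have sf: "squarefree_lms IG"
    using squarefree_initial_ideal_lms[OF I] assms(3) by (simp add: lex_order_eq)
  have diff: "{1..n} - {1..k} = {Suc k..n}" for k by auto
  have unmixed: "unmixed (mpoly_ring {Suc k..n}) (edge_ideal IG E k)" if k: "k \<le> n" for k E
  proof -
    have J: "ideal (edge_ideal IG E k) (mpoly_ring {Suc k..n})" by (rule ideal_edge_ideal[OF I k])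
    have cong: "edge_ideal IG E k = edge_ideal IG (E \<inter> {1..k}) k" by (rule edge_ideal_cong) blast
    have "equidimensional (mpoly_ring {1..n})
        (I_ideal V e n (E \<inter> {1..k}) ({1..k} - (E \<inter> {1..k})) :: (nat, 'k) mpoly set)"
      by (rule assms(4)[OF k]) auto
    then have "equidimensional (mpoly_ring {1..n}) (Idl\<^bsub>mpoly_ring {1..n}\<^esub> (edge_ideal IG E k))"
      using I_ideal_eq_extension[OF graph IG k, of "E \<inter> {1..k}"] cong by simp
    moreover have "f \<in> edge_ideal IG E k"
      if "f \<in> polys {Suc k..n}" "f * f \<in> edge_ideal IG E k" for f
      using squarefree_lms_radical[OF _ J squarefree_edge_ideal[OF I sf k] that] by simp
    moreover have "{1..k} \<subseteq> {1..n}" using k by simp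
    ultimately show ?thesis
      using unmixed_contraction[of "{1..n}" "{1..k}" "edge_ideal IG E k"] J by (simp add: diff)
  qed
  \<comment> \<open>Downwards from \<open>k = n\<close>, where no variables are left.\<close>
  have "gvd {Suc k..n} (edge_ideal IG E k)" if "k \<le> n" for k E
    using that
  proof (induction k arbitrary: E rule: inc_induct)
    case base
    have "{Suc n..n} = {}" by simp
    then show ?case using gvd_no_variables ideal_edge_ideal[OF I order_refl, of E] by metis
  next
    case (step k)
    let ?y = "Suc k"
    have k: "k \<le> n" using step.hyps by simp
    have "edge_ideal IG (insert ?y E) k = edge_ideal IG E k" "edge_ideal IG (E - {?y}) k = edge_ideal IG E k"
      by (rule edge_ideal_cong, force)+
    then have "all_lead_coeffs ?y (edge_ideal IG E k) = edge_ideal IG (insert ?y E) (Suc k)"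
      "lead_coeffs ?y 0 (edge_ideal IG E k) = edge_ideal IG (E - {?y}) (Suc k)" by simp_all
    then have "gvd ({Suc k..n} - {?y}) (all_lead_coeffs ?y (edge_ideal IG E k))"
      "gvd ({Suc k..n} - {?y}) (lead_coeffs ?y 0 (edge_ideal IG E k))"
      using step.IH by (simp_all only: remove_first)
    then show ?case
      using step.hyps ideal_edge_ideal[OF I k] unmixed[OF k] squarefree_edge_ideal[OF I sf k]
      by (intro gvd_step[of "{Suc k..n}" ?y]) auto
  qed
  from this[of 0] show ?thesis by (simp add: One_nat_def)
qed

end
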